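(* Let $v>4$ be an integer with prime factorization $v=p_1^{n_1}\cdots p_k^{n_k}$, and let $\#C(v_3)$ denote the number of isomorphism classes of connected cyclic configurations of type $(v_3)$. Then \[ \#C(v_3)=\begin{cases}\frac{v}{6}\prod_{i=1}^k\big(1+\frac{1}{p_i}\big)+\alpha 2^k-2 & \text{if } v \text{ is odd},\\[1ex] \frac{v}{6}\prod_{i=1}^k\big(1+\frac{1}{p_i}\big)+\beta 2^k-3 & \text{if } v \text{ is even},\end{cases} \] where, for $v$ odd, \[ \alpha=\begin{cases}5/6 & \text{if every } p_i\equiv 1 \pmod 3,\\ 2/3 & \text{if } p_1^{n_1}=3 \text{ and } p_i\equiv 1\pmod 3 \text{ for all } i>1,\\ 1/2 & \text{otherwise},\end{cases} \] and, for $v$ even, \[ \beta=\begin{cases}1/4 & \text{if } v\equiv 2 \text{ or } 6 \pmod 8,\\ 1/2 & \text{if } v\equiv 4\pmod 8,\\ 1 & \text{if } v\equiv 0\pmod 8.\end{cases} \]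
   Context: A (combinatorial) configuration of type $(v_r,b_k)$ is a pair $(P,\mathcal{B})$ where $P$ is a set of $v$ points and $\mathcal{B}$ is a collection of $b$ subsets of $P$ (lines) with $|B_i\cap B_j|\le 1$ for distinct lines, every point lying on exactly $r$ lines, and every line having exactly $k\ge 3$ points. It is balanced, of type $(v_k)$, when $v=b$ (hence $r=k$). It is decomposable if it is the disjoint union of two configurations $(P_1,\mathcal{B}_1),(P_2,\mathcal{B}_2)$ with $P=P_1\cup P_2$, $P_1\cap P_2=\emptyset$, $\mathcal{B}=\mathcal{B}_1\cup\mathcal{B}_2$; otherwise it is connected. An isomorphism between two configurations is a bijection between point sets mapping the set of lines onto the set of lines; an automorphism is an isomorphism of a configuration to itself. A configuration is cyclic if it has an automorphism permuting its points in a single full cycle. The primes $p_1,\dots,p_k$ are distinct and, in the case defining $\alpha=2/3$, the factor $p_1^{n_1}$ is the $3$-part of $v$. *)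

theory Defs
  imports
    Complex_Main
    "HOL-Combinatorics.Orbits"
    "HOL-Computational_Algebra.Primes"
    "HOL-Number_Theory.Cong"
begin

text \<open>
  A configuration is given by its set of points and its set of lines. The point set is
  required to be nonempty: otherwise every configuration would be the disjoint union of
  itself and the empty one, and none would be connected.
\<close>

type_synonym 'a incidence = "'a set \<times> 'a set set"

definition configuration :: "nat \<Rightarrow> nat \<Rightarrow> nat \<Rightarrow> nat \<Rightarrow> 'a incidence \<Rightarrow> bool" where
  "configuration v r b k C \<longleftrightarrow> (case C of (P, \<B>) \<Rightarrow>
     P \<noteq> {} \<and> finite P \<and> card P = v \<and>
     \<B> \<subseteq> Pow P \<and> card \<B> = b \<and>
     (\<forall>B1\<in>\<B>. \<forall>B2\<in>\<B>. B1 \<noteq> B2 \<longrightarrow> card (B1 \<inter> B2) \<le> 1) \<and>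
     (\<forall>x\<in>P. card {B \<in> \<B>. x \<in> B} = r) \<and>
     k \<ge> 3 \<and> (\<forall>B\<in>\<B>. card B = k))"

definition balanced_configuration :: "nat \<Rightarrow> nat \<Rightarrow> 'a incidence \<Rightarrow> bool" where
  "balanced_configuration v k C \<longleftrightarrow> configuration v k v k C"

definition decomposable :: "'a incidence \<Rightarrow> bool" where
  "decomposable C \<longleftrightarrow> (\<exists>P1 \<B>1 P2 \<B>2.
     (\<exists>v r b k. configuration v r b k (P1, \<B>1)) \<and>
     (\<exists>v r b k. configuration v r b k (P2, \<B>2)) \<and>
     P1 \<inter> P2 = {} \<and> C = (P1 \<union> P2, \<B>1 \<union> \<B>2))"

definition connected_configuration :: "'a incidence \<Rightarrow> bool" where
  "connected_configuration C \<longleftrightarrow> \<not> decomposable C"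

definition isomorphism :: "('a \<Rightarrow> 'b) \<Rightarrow> 'a incidence \<Rightarrow> 'b incidence \<Rightarrow> bool" where
  "isomorphism f C D \<longleftrightarrow> bij_betw f (fst C) (fst D) \<and> (`) f ` snd C = snd D"

definition automorphism :: "('a \<Rightarrow> 'a) \<Rightarrow> 'a incidence \<Rightarrow> bool" where
  "automorphism f C \<longleftrightarrow> isomorphism f C C"

definition cyclic_configuration :: "'a incidence \<Rightarrow> bool" where
  "cyclic_configuration C \<longleftrightarrow> (\<exists>f. automorphism f C \<and> cyclic_on f (fst C))"

text \<open>
  Every finite configuration is isomorphic to one whose points are natural numbers, so
  isomorphism classes may be counted among those.
\<close>

definition connected_cyclic_configurations :: "nat \<Rightarrow> nat \<Rightarrow> nat incidence set" where
  "connected_cyclic_configurations v k =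
     {C. balanced_configuration v k C \<and> connected_configuration C \<and> cyclic_configuration C}"

definition isomorphic_on :: "'a incidence set \<Rightarrow> ('a incidence \<times> 'a incidence) set" where
  "isomorphic_on S = {(C, D). C \<in> S \<and> D \<in> S \<and> (\<exists>f. isomorphism f C D)}"

definition num_connected_cyclic :: "nat \<Rightarrow> nat \<Rightarrow> nat" where
  "num_connected_cyclic v k =
     card (connected_cyclic_configurations v k //
           isomorphic_on (connected_cyclic_configurations v k))"

definition alpha :: "nat \<Rightarrow> real" where
  "alpha v =
     (if \<forall>p\<in>prime_factors v. [p = 1] (mod 3) then 5/6
      else if 3 ^ multiplicity 3 v = (3::nat) \<and> (\<forall>p\<in>prime_factors v - {3}. [p = 1] (mod 3))
        then 2/3
      else 1/2)"

text \<open>Only used for even \<open>v\<close>, so that the last case is \<open>v \<equiv> 0 (mod 8)\<close>.\<close>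

definition beta :: "nat \<Rightarrow> real" where
  "beta v =
     (if [v = 2] (mod 8) \<or> [v = 6] (mod 8) then 1/4
      else if [v = 4] (mod 8) then 1/2
      else 1)"

lemma isomorphism_refl: "isomorphism id C C"
  by (simp add: isomorphism_def)

lemma isomorphism_sym:
  assumes "isomorphism f C D" and "snd C \<subseteq> Pow (fst C)"
  shows "isomorphism (inv_into (fst C) f) D C"
proof -
  let ?g = "inv_into (fst C) f"
  have bij: "bij_betw f (fst C) (fst D)" and im: "(`) f ` snd C = snd D"
    using assms(1) by (auto simp: isomorphism_def)
  have "?g ` f ` B = B" if "B \<in> snd C" for B
    using that assms(2) bij by (intro inv_into_image_cancel) (auto simp: bij_betw_def)
  then have "(`) ?g ` (`) f ` snd C = snd C"
    by (simp add: image_image)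
  then show ?thesis
    using bij_betw_inv_into[OF bij] im by (simp add: isomorphism_def)
qed

lemma isomorphism_trans:
  assumes "isomorphism f C D" and "isomorphism g D E"
  shows "isomorphism (g \<circ> f) C E"
proof -
  have "(`) (g \<circ> f) ` snd C = (`) g ` (`) f ` snd C"
    by (auto simp: image_comp image_image)
  then show ?thesis
    using assms by (auto simp: isomorphism_def intro: bij_betw_trans)
qed

lemma configuration_lines: "configuration v r b k C \<Longrightarrow> snd C \<subseteq> Pow (fst C)"
  by (auto simp: configuration_def split: prod.splits)

lemma equiv_isomorphic_on:
  "equiv (connected_cyclic_configurations v k)
     (isomorphic_on (connected_cyclic_configurations v k))"
proof (rule equivI)
  let ?S = "connected_cyclic_configurations v k"
  show "refl_on ?S (isomorphic_on ?S)"
    by (auto simp: refl_on_def isomorphic_on_def intro: isomorphism_refl)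
  show "isomorphic_on ?S \<subseteq> ?S \<times> ?S"
    by (auto simp: isomorphic_on_def)
  show "sym (isomorphic_on ?S)"
  proof (rule symI)
    fix C D assume *: "(C, D) \<in> isomorphic_on ?S"
    then have "snd C \<subseteq> Pow (fst C)"
      using configuration_lines[of v k v k C]
      by (auto simp: isomorphic_on_def connected_cyclic_configurations_def balanced_configuration_def)
    with * show "(D, C) \<in> isomorphic_on ?S"
      using isomorphism_sym unfolding isomorphic_on_def by blast
  qed
  show "trans (isomorphic_on ?S)"
  proof (rule transI)
    fix C D E assume "(C, D) \<in> isomorphic_on ?S" "(D, E) \<in> isomorphic_on ?S"
    then obtain f g where "C \<in> ?S" "E \<in> ?S" "isomorphism f C D" "isomorphism g D E"
      unfolding isomorphic_on_def by blast
    then show "(C, E) \<in> isomorphic_on ?S"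
      using isomorphism_trans[of f C D g E] unfolding isomorphic_on_def by blast
  qed
qed

text \<open>
  The quotient is finite, so that the cardinality used in \<open>num_connected_cyclic\<close> never
  takes the default value 0 of infinite sets.
\<close>

lemma finite_quotient_isomorphic_on:
  "finite (connected_cyclic_configurations v k //
           isomorphic_on (connected_cyclic_configurations v k))"
proof -
  let ?S = "connected_cyclic_configurations v k"
  let ?N = "{0..<v}"
  define F :: "nat set set \<Rightarrow> nat incidence set"
    where "F L = {C \<in> ?S. \<exists>f. isomorphism f C (?N, L)}" for L
  have "X \<in> F ` Pow (Pow ?N)" if X_in: "X \<in> ?S // isomorphic_on ?S" for X
  proof -
    obtain C where C: "C \<in> ?S" and X: "X = isomorphic_on ?S `` {C}"
      using X_in by (rule quotientE)
    have cfg: "configuration v k v k C"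
      using C by (simp add: connected_cyclic_configurations_def balanced_configuration_def)
    then have "finite (fst C)" "card (fst C) = v"
      by (auto simp: configuration_def split: prod.splits)
    then obtain f where f: "bij_betw f (fst C) ?N"
      using ex_bij_betw_finite_nat by blast
    define L where "L = (`) f ` snd C"
    have iso: "isomorphism f C (?N, L)"
      using f by (simp add: isomorphism_def L_def)
    have lines: "L \<subseteq> Pow ?N"
    proof -
      have "f ` B \<subseteq> ?N" if "B \<in> snd C" for B
        using that configuration_lines[OF cfg] f by (auto simp: bij_betw_def)
      then show ?thesis by (auto simp: L_def)
    qed
    have "D \<in> X \<longleftrightarrow> D \<in> F L" for D
    proof
      assume "D \<in> X"
      then have "(C, D) \<in> isomorphic_on ?S"
        using X by simp
      moreover have "sym (isomorphic_on ?S)"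
        using equiv_isomorphic_on by (rule equivE)
      ultimately have "(D, C) \<in> isomorphic_on ?S"
        by (meson symD)
      then have D: "D \<in> ?S" "(D, C) \<in> isomorphic_on ?S"
        unfolding isomorphic_on_def by blast+
      then obtain g where "isomorphism g D C"
        by (auto simp: isomorphic_on_def)
      then show "D \<in> F L"
        using D(1) isomorphism_trans[OF _ iso] unfolding F_def by blast
    next
      assume "D \<in> F L"
      then obtain g where D: "D \<in> ?S" and g: "isomorphism g D (?N, L)"
        by (auto simp: F_def)
      have "snd D \<subseteq> Pow (fst D)"
        using D configuration_lines[of v k v k D]
        by (simp add: connected_cyclic_configurations_def balanced_configuration_def)
      from isomorphism_trans[OF iso isomorphism_sym[OF g this]]
      show "D \<in> X"
        using C D unfolding X isomorphic_on_def by blast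
    qed
    then have "X = F L" by (rule set_eqI)
    then show ?thesis using lines by blast
  qed
  then have "?S // isomorphic_on ?S \<subseteq> F ` Pow (Pow ?N)"
    by (rule subsetI)
  moreover have "finite (F ` Pow (Pow ?N))"
    by simp
  ultimately show ?thesis
    by (rule finite_subset)
qed

end

theory Submission
  imports Defs "HOL-Number_Theory.Residue_Primitive_Roots"
begin

text \<open>
  A cyclic automorphism identifies the points with the integers modulo \<open>v\<close>. Some line has
  trivial stabilizer (a line with nontrivial stabilizer is a coset of the subgroup of order 3,
  and only one of these passes through a given point), so the lines are all the translates of
  one base line. The incidence graph is then a quotient of the hexagonal lattice, whose edges are
  colored by the three points of the base line.

  The crucial point is that isomorphic configurations have affinely equivalent base lines. The
  hexagonal faces are the 6-cycles colored \<open>abcabc\<close>. Further 6-cycles need an extra relation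
  between the differences of the base line: either \<open>3 d = 0\<close> for a difference \<open>d\<close>, or
  \<open>2 d = d'\<close> for two cyclically oriented differences. The second kind of relation forces the
  base line to be equivalent to \<open>{0, 1, 3}\<close>, and it is visible in the incidence graph. Otherwise
  the faces can be recognised in the graph, so an isomorphism permutes the colors in the same way
  at every vertex, and therefore it is affine.

  Hence the classes correspond to orbits of \<open>S\<^sub>3\<close> times the units modulo \<open>v\<close> on primitive
  triples of differences with sum zero. Burnside's lemma counts all orbits: the identity
  contributes the projective line over the integers modulo \<open>v\<close>, transpositions the roots of
  \<open>x\<^sup>2 - 1\<close> and 3-cycles the roots of \<open>x\<^sup>2 + x + 1\<close>. The 2 or 3 degenerate orbits, represented by
  \<open>(0, 1, -1)\<close>, \<open>(1, 1, -2)\<close> and, for even \<open>v\<close>, \<open>(v/2, 1, v/2 - 1)\<close>, do not give configurations.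
\<close>

section \<open>Base lines and hexagons\<close>

text \<open>The obstacle is that an isomorphism need not carry one cyclic automorphism to a power of
  the other. What it preserves is incidence, so the cyclic structure has to be recovered from paths
  in the incidence graph. Points and lines alternate along a walk, so the alternating sum of the
  offsets of its edges decides whether it closes, and every condition becomes a congruence between
  offsets.

  Translations disappear on passing from offsets to differences. Taken in cyclic order these sum to
  zero, and reversing the order only changes the sign.

  Burnside's lemma is applied to a group of order 6 times \<open>totient v\<close>. Each fixed-point
  sum carries the factor \<open>totient v\<close>, and division leaves 1/6, 1/2 and 1/3:
  \<open>beta\<close> is the share of the roots of \<open>x^2 - 1\<close>, and \<open>alpha\<close>
  is 1/2 plus the share of the roots of \<open>x^2 + x + 1\<close>. The bound v > 4 enters twice:
  \<open>v\<close> must not divide 3, and for v = 4 the second and the third degenerate orbit would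
  coincide.\<close>

datatype color = Red | Green | Blue

lemma UNIV_color: "(UNIV :: color set) = {Red, Green, Blue}"
  using color.exhaust by auto

lemma all_color: "(\<forall>i. P i) \<longleftrightarrow> P Red \<and> P Green \<and> P Blue"
  by (metis color.exhaust)

lemma ex_color: "(\<exists>i. P i) \<longleftrightarrow> P Red \<or> P Green \<or> P Blue"
  by (metis color.exhaust)

lemma finite_color [simp]: "finite (A :: color set)"
  by (rule finite_subset[of _ "{Red, Green, Blue}"]) (use color.exhaust in auto)

lemma card_UNIV_color: "card (UNIV :: color set) = 3"
  by (simp add: UNIV_color)

text \<open>Two translates with two common points would produce one difference in two ways, so this
  is the condition that lines meet at most once. It also makes the three offsets distinct.\<close>

definition sidon :: "int \<Rightarrow> (color \<Rightarrow> int) \<Rightarrow> bool" where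
  "sidon m s \<longleftrightarrow> (\<forall>i j k l. i \<noteq> k \<longrightarrow> j \<noteq> l \<longrightarrow> [s i - s k = s j - s l] (mod m) \<longrightarrow> i = j \<and> k = l)"

text \<open>The differences generate the integers modulo \<open>m\<close>; for the translates of the
  base line this amounts to connectedness.\<close>

definition primitive :: "int \<Rightarrow> (color \<Rightarrow> int) \<Rightarrow> bool" where
  "primitive m s \<longleftrightarrow> (\<forall>g. g dvd m \<longrightarrow> (\<forall>i j. g dvd s i - s j) \<longrightarrow> g dvd 1)"

definition line :: "(color \<Rightarrow> int) \<Rightarrow> (int \<Rightarrow> 'a) \<Rightarrow> int \<Rightarrow> 'a set" where
  "line s \<phi> y = range (\<lambda>i. \<phi> (y + s i))"

text \<open>Points and lines are indexed by all integers, with \<open>\<phi>\<close> periodic modulo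
  \<open>m\<close>, so that congruences need no reduced representatives. That lines with incongruent
  indices differ is a consequence of \<open>sidon\<close>.\<close>

definition coordinates :: "int \<Rightarrow> (color \<Rightarrow> int) \<Rightarrow> (int \<Rightarrow> 'a) \<Rightarrow> 'a incidence \<Rightarrow> bool" where
  "coordinates m s \<phi> C \<longleftrightarrow> (\<forall>x y. \<phi> x = \<phi> y \<longleftrightarrow> [x = y] (mod m)) \<and>
     fst C = range \<phi> \<and> snd C = range (line s \<phi>)"

text \<open>A path with edge colors \<open>k, i, j\<close> in the incidence graph extends to a closed walk with colors
  \<open>k, i, j, a, b, c\<close>; consecutive colors differ because the walk never turns back.\<close>

definition hexagon :: "int \<Rightarrow> (color \<Rightarrow> int) \<Rightarrow> color \<Rightarrow> color \<Rightarrow> color \<Rightarrow> bool" where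
  "hexagon m s k i j \<longleftrightarrow> (\<exists>a b c. j \<noteq> a \<and> a \<noteq> b \<and> b \<noteq> c \<and> c \<noteq> k \<and>
     [s k - s i + s j - s a + s b - s c = 0] (mod m))"

text \<open>The same condition in terms of incidence only: the path \<open>q, L, p, M\<close> lies on a 6-cycle.\<close>

definition closed_path :: "'a incidence \<Rightarrow> 'a \<Rightarrow> 'a set \<Rightarrow> 'a \<Rightarrow> 'a set \<Rightarrow> bool" where
  "closed_path C q L p M \<longleftrightarrow>
     (\<exists>r\<in>M. \<exists>N\<in>snd C. r \<noteq> p \<and> N \<noteq> L \<and> N \<noteq> M \<and> q \<in> N \<and> r \<in> N)"

text \<open>With \<open>s j = 0\<close> and \<open>s i = d\<close> the relation gives
  \<open>s k = 3 * d\<close>: the base line is \<open>d\<close> times {0, 1, 3}.\<close>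

definition doubling :: "int \<Rightarrow> (color \<Rightarrow> int) \<Rightarrow> bool" where
  "doubling m s \<longleftrightarrow> (\<exists>i j k. i \<noteq> j \<and> j \<noteq> k \<and> i \<noteq> k \<and> [2 * (s i - s j) = s k - s i] (mod m))"

lemma sidonD:
  "sidon m s \<Longrightarrow> i \<noteq> k \<Longrightarrow> j \<noteq> l \<Longrightarrow> [s i - s k = s j - s l] (mod m) \<Longrightarrow> i = j \<and> k = l"
  unfolding sidon_def by blast

lemma sidon_distinct: 
  assumes "sidon m s" "[s i = s j] (mod m)" shows "i = j"
proof (rule ccontr)
  assume "i \<noteq> j"
  moreover have "[s i - s j = s j - s i] (mod m)"
    using assms(2) unfolding cong_iff_dvd_diff by Groebner_Basis.algebra
  ultimately show False using sidonD[OF assms(1), of i j j i] by auto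
qed

text \<open>Bezout writes every integer as a combination of \<open>m\<close> and two differences,
  and a set closed under subtraction is a subgroup. Typically \<open>H\<close> consists of the
  shifts that preserve some property, so it suffices to check the steps \<open>s i - s j\<close>
  between points of one line.\<close>

lemma primitive_induct:
  assumes prim: "primitive m s"
    and m: "m \<in> H" and s: "\<And>i j. s i - s j \<in> H"
    and diff: "\<And>x y. x \<in> H \<Longrightarrow> y \<in> H \<Longrightarrow> x - y \<in> (H :: int set)"
  shows "x \<in> H"
proof -
  have zero: "0 \<in> H" using diff[OF m m] by simp
  have neg: "- x \<in> H" if "x \<in> H" for x using diff[OF zero that] by simp
  have add: "x + y \<in> H" if "x \<in> H" "y \<in> H" for x y
    using diff[OF that(1) neg[OF that(2)]] by simp
  have nmul: "int n * x \<in> H" if "x \<in> H" for n x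
    by (induction n) (use zero add that in \<open>auto simp: algebra_simps\<close>)
  have mul: "k * x \<in> H" if "x \<in> H" for k x
    using nmul[OF that, of "nat k"] neg[OF nmul[OF that, of "nat (- k)"]]
    by (cases "k \<ge> 0") auto
  define a b where "a = s Green - s Red" and "b = s Blue - s Red"
  have "gcd (gcd a b) m dvd s i - s j" for i j
  proof -
    have ga: "gcd (gcd a b) m dvd a" and gb: "gcd (gcd a b) m dvd b"
      by (meson dvd_trans gcd_dvd1 gcd_dvd2)+
    have "\<exists>x\<in>{0, a, b}. \<exists>y\<in>{0, a, b}. s i - s j = x - y"
      by (cases i; cases j) (auto simp: a_def b_def)
    then show ?thesis
      using ga gb by (auto intro: dvd_diff)
  qed
  then have "gcd (gcd a b) m = 1"
    using prim unfolding primitive_def by (metis gcd_dvd2 gcd_pos_int abs_gcd_int zdvd1_eq)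
  then obtain u w where "u * gcd a b + w * m = 1" using bezout_int[of "gcd a b" m] by auto
  moreover obtain u' w' where "u' * a + w' * b = gcd a b" using bezout_int[of a b] by auto
  ultimately have "u * (u' * a + w' * b) + w * m = 1" by simp
  then have "x = (x * u * u') * a + (x * u * w') * b + (x * w) * m"
    by Groebner_Basis.algebra
  moreover have "\<dots> \<in> H"
    by (intro add mul m) (use s in \<open>auto simp: a_def b_def\<close>)
  ultimately show ?thesis by simp
qed

text \<open>Running twice through the three colors closes the walk identically in \<open>s\<close>:
  these are the faces of the hexagonal lattice.\<close>

lemma hexagon_distinct: "k \<noteq> i \<Longrightarrow> i \<noteq> j \<Longrightarrow> k \<noteq> j \<Longrightarrow> hexagon m s k i j"
  unfolding hexagon_def by (intro exI[of _ k] exI[of _ i] exI[of _ j]) auto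

text \<open>After \<open>k, i, k\<close> only six continuations avoid turning back. One yields
  \<open>3 * (s k - s i) = 0\<close>, four yield a doubling, and the last needs a difference of
  order two, which the Sidon condition forbids.\<close>

lemma hexagon_same:
  assumes sid: "sidon m s" and ki: "k \<noteq> i"
  shows "hexagon m s k i k \<longrightarrow> [3 * (s k - s i) = 0] (mod m) \<or> doubling m s"
proof
  assume "hexagon m s k i k"
  then obtain a b c where abc: "k \<noteq> a" "a \<noteq> b" "b \<noteq> c" "c \<noteq> k"
    and e: "m dvd s k - s i + s k - s a + s b - s c"
    unfolding hexagon_def cong_iff_dvd_diff by auto
  obtain h where h: "h \<noteq> k" "h \<noteq> i" by (cases k; cases i) auto
  have exh: "x = k \<or> x = i \<or> x = h" for x
    using h ki by (cases k; cases i; cases h; cases x) auto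
  consider "a = i" "b = k" "c = i" | "a = i" "b = k" "c = h" | "a = h" "b = k" "c = i" | "a = h" "b = k" "c = h"
    | "a = i" "b = h" "c = i" | "a = h" "b = i" "c = h"
    using abc exh by metis
  then show "[3 * (s k - s i) = 0] (mod m) \<or> doubling m s"
  proof cases
    case 1
    then show ?thesis using e unfolding cong_iff_dvd_diff by (auto simp: algebra_simps)
  next
    case 2
    have "[2 * (s k - s i) = s h - s k] (mod m)"
      using e[unfolded 2] unfolding cong_iff_dvd_diff by Groebner_Basis.algebra
    then show ?thesis unfolding doubling_def using ki h by metis
  next
    case 3
    have "[2 * (s k - s i) = s h - s k] (mod m)"
      using e[unfolded 3] unfolding cong_iff_dvd_diff by Groebner_Basis.algebra
    then show ?thesis unfolding doubling_def using ki h by metis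
  next
    case 4
    have "[2 * (s k - s h) = s i - s k] (mod m)"
      using e[unfolded 4] unfolding cong_iff_dvd_diff by Groebner_Basis.algebra
    then show ?thesis unfolding doubling_def using ki h by metis
  next
    case 5
    have "[2 * (s i - s k) = s h - s i] (mod m)"
      using e[unfolded 5] unfolding cong_iff_dvd_diff by Groebner_Basis.algebra
    then show ?thesis unfolding doubling_def using ki h by metis
  next
    case 6
    have "[s k - s h = s h - s k] (mod m)"
      using e[unfolded 6] unfolding cong_iff_dvd_diff by Groebner_Basis.algebra
    then show ?thesis using sidonD[OF sid, of k h h k] h by auto
  qed
qed

lemma hexagon_triple:
  assumes "k \<noteq> i" "[3 * (s k - s i) = 0] (mod m)"
  shows "hexagon m s k i k"
proof -
  have "[s k - s i + s k - s i + s k - s i = 0] (mod m)"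
    using assms(2) unfolding cong_iff_dvd_diff by (simp add: algebra_simps)
  then show ?thesis unfolding hexagon_def using assms(1) by metis
qed

text \<open>The relation reads \<open>3 * s a = 2 * s b + s c\<close>, a closed walk in which
  \<open>a\<close> alternates with \<open>b\<close>, \<open>b\<close>, \<open>c\<close>. Placing its
  start suitably, or swapping the signs, makes any given color \<open>i\<close> the middle of a path
  \<open>k, i, k\<close>.\<close>

lemma hexagon_doubling:
  assumes "doubling m s"
  shows "\<exists>k. k \<noteq> i \<and> hexagon m s k i k"
proof -
  obtain a b c where abc: "a \<noteq> b" "b \<noteq> c" "a \<noteq> c" and e: "[2 * (s a - s b) = s c - s a] (mod m)"
    using assms unfolding doubling_def by blast
  consider "i = a" | "i = b" | "i = c"
    using abc by (cases a; cases b; cases c; cases i) auto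
  then show ?thesis
  proof cases
    case 1
    have "[s b - s a + s b - s a + s c - s a = 0] (mod m)"
      using e unfolding cong_iff_dvd_diff by Groebner_Basis.algebra
    then show ?thesis unfolding hexagon_def using abc 1 by metis
  next
    case 2
    have "[s a - s b + s a - s b + s a - s c = 0] (mod m)"
      using e unfolding cong_iff_dvd_diff by Groebner_Basis.algebra
    then show ?thesis unfolding hexagon_def using abc 2 by metis
  next
    case 3
    have "[s a - s c + s a - s b + s a - s b = 0] (mod m)"
      using e unfolding cong_iff_dvd_diff by Groebner_Basis.algebra
    then show ?thesis unfolding hexagon_def using abc 3 by metis
  qed
qed

section \<open>Incidence expressed through coordinates\<close>

locale coordinatized =
  fixes m :: int and s :: "color \<Rightarrow> int" and \<phi> :: "int \<Rightarrow> 'a" and C :: "'a incidence"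
  assumes coords: "coordinates m s \<phi> C" and sid: "sidon m s" and prim: "primitive m s"
begin

lemma point_eq_iff: "\<phi> x = \<phi> y \<longleftrightarrow> [x = y] (mod m)"
  using coords unfolding coordinates_def by blast

lemma point_in_line_iff: "\<phi> x \<in> line s \<phi> y \<longleftrightarrow> (\<exists>i. [x = y + s i] (mod m))"
  unfolding line_def by (auto simp: point_eq_iff)

lemma point_in_line: "\<phi> (y + s i) \<in> line s \<phi> y"
  unfolding line_def by blast

lemma line_in_lines: "line s \<phi> y \<in> snd C"
  using coords unfolding coordinates_def by blast

lemma line_cong: "[y = z] (mod m) \<Longrightarrow> line s \<phi> y = line s \<phi> z"
  unfolding line_def by (intro image_cong refl) (simp add: point_eq_iff cong_add)

lemma offset_eq: "\<phi> (y + s i) = \<phi> (y + s j) \<Longrightarrow> i = j"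
  using sidon_distinct[OF sid] by (auto simp: point_eq_iff cong_add_lcancel)

text \<open>Two points of the common line show one difference in both parametrizations; the Sidon
  condition identifies the colors, and with them the base points. So no translate has a nontrivial
  stabilizer.\<close>

lemma line_eq_iff: "line s \<phi> y = line s \<phi> z \<longleftrightarrow> [y = z] (mod m)"
proof
  assume eq: "line s \<phi> y = line s \<phi> z"
  obtain i where i: "[y + s Red = z + s i] (mod m)"
    using point_in_line[of y Red] unfolding eq point_in_line_iff by blast
  obtain j where j: "[y + s Green = z + s j] (mod m)"
    using point_in_line[of y Green] unfolding eq point_in_line_iff by blast
  have "i \<noteq> j"
  proof
    assume "i = j"
    then have "[y + s Red = y + s Green] (mod m)" using i j by (metis cong_sym cong_trans)
    then show False using offset_eq[of y Red Green] by (simp add: point_eq_iff)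
  qed
  moreover have "[s Red - s Green = s i - s j] (mod m)"
    using i j unfolding cong_iff_dvd_diff by Groebner_Basis.algebra
  ultimately have "i = Red" using sidonD[OF sid, of Red Green i j] by auto
  then show "[y = z] (mod m)" using i by (simp add: cong_add_rcancel)
qed (rule line_cong)

lemma line_through_point:
  assumes "M \<in> snd C" "\<phi> x \<in> M"
  obtains k where "M = line s \<phi> (x - s k)"
proof -
  obtain z where z: "M = line s \<phi> z" using assms(1) coords unfolding coordinates_def by auto
  then obtain k where "[x = z + s k] (mod m)" using assms(2) point_in_line_iff by auto
  then have "[z = x - s k] (mod m)" unfolding cong_iff_dvd_diff by Groebner_Basis.algebra
  then show ?thesis using that line_eq_iff z by blast
qed

text \<open>In the closing walk \<open>a\<close> is the color of \<open>q\<close> in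
  \<open>N\<close>, while \<open>b\<close> and \<open>c\<close> are the colors of \<open>r\<close>
  in \<open>N\<close> and in \<open>M\<close>. The inequalities in \<open>closed_path\<close> say
  that the walk does not turn back at \<open>q\<close>, at \<open>M\<close> or at \<open>r\<close>,
  up to what the Sidon condition supplies.\<close>

lemma closed_path_iff:
  assumes "j \<noteq> i" "k \<noteq> i"
  shows "closed_path C (\<phi> (y + s j)) (line s \<phi> y) (\<phi> (y + s i)) (line s \<phi> (y + s i - s k))
    \<longleftrightarrow> hexagon m s k i j"
proof
  assume "closed_path C (\<phi> (y + s j)) (line s \<phi> y) (\<phi> (y + s i)) (line s \<phi> (y + s i - s k))"
  then obtain r N where r: "r \<in> line s \<phi> (y + s i - s k)" "r \<noteq> \<phi> (y + s i)"
    and N: "N \<in> snd C" "N \<noteq> line s \<phi> y" "N \<noteq> line s \<phi> (y + s i - s k)"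
      "\<phi> (y + s j) \<in> N" "r \<in> N"
    unfolding closed_path_def by blast
  obtain c where c: "r = \<phi> (y + s i - s k + s c)" using r(1) unfolding line_def by blast
  then have ck: "c \<noteq> k" using r(2) by auto
  obtain a where a: "N = line s \<phi> (y + s j - s a)" using line_through_point N(1,4) by blast
  then have aj: "a \<noteq> j" using N(2) by auto
  obtain b where b: "[y + s i - s k + s c = y + s j - s a + s b] (mod m)"
    using N(5) unfolding a c point_in_line_iff by blast
  have e: "[s k - s i + s j - s a + s b - s c = 0] (mod m)"
    using b unfolding cong_iff_dvd_diff by Groebner_Basis.algebra
  have "b \<noteq> c"
  proof
    assume "b = c"
    have "[y + s j - s a = y + s i - s k] (mod m)"
      using e[unfolded \<open>b = c\<close>] unfolding cong_iff_dvd_diff by Groebner_Basis.algebra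
    then show False using N(3) a line_eq_iff by blast
  qed
  \<comment> \<open>\<open>a = b\<close> means that \<open>r\<close> equals the starting point,
    which would be a second common point of the lines \<open>y\<close> and
    \<open>y + s i - s k\<close>: a 4-cycle, excluded by the Sidon condition.\<close>
  moreover have "a \<noteq> b"
  proof
    assume "a = b"
    have "[s k - s i = s c - s j] (mod m)"
      using e[unfolded \<open>a = b\<close>] unfolding cong_iff_dvd_diff by Groebner_Basis.algebra
    then have "c = j \<Longrightarrow> [s k = s i] (mod m)" "c \<noteq> j \<Longrightarrow> k = c"
      using sidonD[OF sid, of k i c j] assms by (auto simp: cong_iff_dvd_diff)
    then show False using ck assms sidon_distinct[OF sid] by blast
  qed
  ultimately show "hexagon m s k i j"
    unfolding hexagon_def using e ck aj by metis
next
  assume "hexagon m s k i j"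
  then obtain a b c where abc: "j \<noteq> a" "a \<noteq> b" "b \<noteq> c" "c \<noteq> k"
    and e: "[s k - s i + s j - s a + s b - s c = 0] (mod m)"
    unfolding hexagon_def by blast
  let ?r = "\<phi> (y + s i - s k + s c)" and ?N = "line s \<phi> (y + s j - s a)"
  have "?r \<noteq> \<phi> (y + s i)"
    using offset_eq[of "y + s i - s k" c k] abc(4) by auto
  moreover have "?N \<noteq> line s \<phi> y"
  proof
    assume "?N = line s \<phi> y"
    then have "[s j = s a] (mod m)"
      unfolding line_eq_iff cong_iff_dvd_diff by Groebner_Basis.algebra
    then show False using abc(1) sidon_distinct[OF sid] by blast
  qed
  moreover have "?N \<noteq> line s \<phi> (y + s i - s k)"
  proof
    assume "?N = line s \<phi> (y + s i - s k)"
    then have "[s b = s c] (mod m)"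
      using e unfolding line_eq_iff cong_iff_dvd_diff by Groebner_Basis.algebra
    then show False using abc(3) sidon_distinct[OF sid] by blast
  qed
  moreover have "?r \<in> ?N"
  proof -
    have "[y + s i - s k + s c = y + s j - s a + s b] (mod m)"
      using e unfolding cong_iff_dvd_diff by Groebner_Basis.algebra
    then show ?thesis unfolding point_in_line_iff by blast
  qed
  moreover have "\<phi> (y + s j) \<in> ?N" using point_in_line[of "y + s j - s a" a] by simp
  ultimately show "closed_path C (\<phi> (y + s j)) (line s \<phi> y) (\<phi> (y + s i)) (line s \<phi> (y + s i - s k))"
    unfolding closed_path_def using line_in_lines point_in_line by blast
qed

end

text \<open>The paths colored \<open>k, i, j\<close> with distinct colors bound the two hexagonal faces at an edge
  of color \<open>i\<close>; a rich color has edges on additional 6-cycles.\<close>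

definition rich :: "int \<Rightarrow> (color \<Rightarrow> int) \<Rightarrow> color \<Rightarrow> bool" where
  "rich m s i \<longleftrightarrow> (\<exists>j. j \<noteq> i \<and> hexagon m s j i j)"

text \<open>The definition compares the colors at the two ends of a path. The right-hand side
  compares each of them only with \<open>i\<close>, so it survives when the colors at the point and
  at the line are permuted independently with the same image of \<open>i\<close>. At first an
  isomorphism grants no more than that.\<close>

lemma rich_iff: "rich m s i \<longleftrightarrow> (\<exists>j. j \<noteq> i \<and> (\<forall>k. k \<noteq> i \<longrightarrow> hexagon m s k i j))"
  unfolding rich_def using hexagon_distinct by metis

lemma rich_not_doubling:
  assumes "sidon m s" "\<not> doubling m s"
  shows "rich m s i \<longleftrightarrow> (\<exists>j. j \<noteq> i \<and> [3 * (s j - s i) = 0] (mod m))"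
  unfolding rich_def using hexagon_same hexagon_triple assms by blast

text \<open>Otherwise 3 would kill all differences; since they generate, 3 itself would vanish
  modulo \<open>m\<close>.\<close>

lemma triple_zero_unique:
  assumes prim: "primitive m s" and m3: "\<not> m dvd 3"
    and ij: "[3 * (s i - s j) = 0] (mod m)" and ik: "[3 * (s i - s k) = 0] (mod m)"
    and ne: "i \<noteq> j" "i \<noteq> k"
  shows "j = k"
proof (rule ccontr)
  assume "j \<noteq> k"
  with ne have exh: "x = i \<or> x = j \<or> x = k" for x
    by (cases x; cases i; cases j; cases k) auto
  have jk: "[3 * (s j - s k) = 0] (mod m)"
    using ij ik unfolding cong_iff_dvd_diff by Groebner_Basis.algebra
  have "m dvd 3 * (s a - s b)" for a b
    using exh[of a] exh[of b] ij ik jk unfolding cong_iff_dvd_diff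
    by (auto simp: right_diff_distrib) (simp_all add: dvd_diff_commute)
  then have diff: "s a - s b \<in> {x. m dvd 3 * x}" for a b by simp
  have "1 \<in> {x. m dvd 3 * x}"
    by (rule primitive_induct[OF prim _ diff]) (auto simp: right_diff_distrib dvd_diff)
  then show False using m3 by simp
qed

text \<open>Without a doubling, a rich color has a 3-torsion difference to another color. Three rich
  colors would need two such pairs, which share a color, against \<open>triple_zero_unique\<close>.
  This is how a doubling is seen in the incidence graph.\<close>

lemma doubling_iff:
  assumes "sidon m s" "primitive m s" "\<not> m dvd 3"
  shows "doubling m s \<longleftrightarrow> (\<forall>i. rich m s i)"
proof
  assume "doubling m s"
  then show "\<forall>i. rich m s i" unfolding rich_def using hexagon_doubling by blast
next
  assume *: "\<forall>i. rich m s i"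
  show "doubling m s"
  proof (rule ccontr)
    assume nd: "\<not> doubling m s"
    obtain j where j: "j \<noteq> Red" "[3 * (s j - s Red) = 0] (mod m)"
      using * rich_not_doubling[OF assms(1) nd] by blast
    obtain h where h: "h \<noteq> Red" "h \<noteq> j" by (cases j) auto
    obtain k where k: "k \<noteq> h" "[3 * (s k - s h) = 0] (mod m)"
      using * rich_not_doubling[OF assms(1) nd] by blast
    have sym: "[3 * (s b - s a) = 0] (mod m)" if "[3 * (s a - s b) = 0] (mod m)" for a b
      using that unfolding cong_iff_dvd_diff by Groebner_Basis.algebra
    have "k = j \<or> k = Red" using j h k by (cases j; cases k; cases h) auto
    then show False
      using triple_zero_unique[OF assms(2,3), of j Red h] triple_zero_unique[OF assms(2,3), of Red j h]
        sym j k h by metis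
  qed
qed

lemma bij_color_agree:
  fixes f g :: "color \<Rightarrow> color"
  assumes "inj f" "inj g" "f i = g i" "f h = g h" "i \<noteq> h"
  shows "f = g"
proof
  fix k
  show "f k = g k"
  proof (cases "k = i \<or> k = h")
    case False
    then have "f k \<noteq> f i" "f k \<noteq> f h" "g k \<noteq> f i" "g k \<noteq> f h" "f i \<noteq> f h"
      using assms by (metis injD)+
    then show ?thesis by (cases "f k"; cases "g k"; cases "f i"; cases "f h") auto
  qed (use assms in auto)
qed

section \<open>Uniqueness of coordinates up to affine maps\<close>

text \<open>Comparing differences removes the translation part. That \<open>u\<close> is a unit will
  follow from primitivity of \<open>t\<close>.\<close>

definition affinely_equivalent :: "int \<Rightarrow> (color \<Rightarrow> int) \<Rightarrow> (color \<Rightarrow> int) \<Rightarrow> bool" where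
  "affinely_equivalent m s t \<longleftrightarrow>
     (\<exists>u \<pi>. bij \<pi> \<and> (\<forall>i j. [t (\<pi> i) - t (\<pi> j) = u * (s i - s j)] (mod m)))"

text \<open>Up to translation both base lines are multiples of {0, 1, 3}. Common divisors of the
  step \<open>s a - s b\<close> and \<open>m\<close> divide all differences of \<open>s\<close>, so
  the step is a unit and can be scaled to the step of \<open>t\<close>.\<close>

lemma doubling_affinely_equivalent:
  assumes "primitive m s" "doubling m s" "doubling m t"
  shows "affinely_equivalent m s t"
proof -
  obtain a b c where abc: "a \<noteq> b" "b \<noteq> c" "a \<noteq> c" and e: "[2 * (s a - s b) = s c - s a] (mod m)"
    using assms unfolding doubling_def by blast
  obtain a' b' c' where abc': "a' \<noteq> b'" "b' \<noteq> c'" "a' \<noteq> c'"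
    and e': "[2 * (t a' - t b') = t c' - t a'] (mod m)"
    using assms unfolding doubling_def by blast
  have exh: "x = a \<or> x = b \<or> x = c" for x
    using abc by (cases a; cases b; cases c; cases x) auto
  have exh': "x = a' \<or> x = b' \<or> x = c'" for x
    using abc' by (cases a'; cases b'; cases c'; cases x) auto
  have "coprime (s a - s b) m"
  proof (rule coprimeI)
    fix g assume g: "g dvd s a - s b" "g dvd m"
    have "g dvd 2 * (s a - s b) - (s c - s a)"
      using e g(2) unfolding cong_iff_dvd_diff by (rule dvd_trans[rotated])
    then have g': "g dvd s c - s a" using g(1) by (metis dvd_diff_commute dvd_mult zdvd_zdiffD)
    have "g dvd s i - s a" for i
      using exh[of i] g(1) g' by (auto simp: dvd_diff_commute)
    then have "g dvd s i - s j" for i j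
      using dvd_diff[of g "s i - s a" "s j - s a"] by simp
    then show "g dvd 1" using assms(1) g(2) unfolding primitive_def by blast
  qed
  then obtain w where w: "[(s a - s b) * w = 1] (mod m)" using cong_solve_coprime_int by blast
  define u where "u = (t a' - t b') * w"
  define \<pi> where "\<pi> = (\<lambda>x. if x = a then a' else if x = b then b' else c')"
  have "inj \<pi>" "surj \<pi>"
    using abc abc' exh exh' unfolding inj_def surj_def \<pi>_def by metis+
  moreover have "[t (\<pi> i) - t (\<pi> j) = u * (s i - s j)] (mod m)" for i j
  proof -
    have pi: "\<pi> a = a'" "\<pi> b = b'" "\<pi> c = c'" using abc by (auto simp: \<pi>_def)
    have ab: "m dvd t a' - t b' - u * (s a - s b)"
      using w unfolding u_def cong_iff_dvd_diff by Groebner_Basis.algebra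
    have ca: "m dvd t c' - t a' - u * (s c - s a)"
      using e e' ab unfolding cong_iff_dvd_diff by Groebner_Basis.algebra
    have ba: "m dvd t b' - t a' - u * (s b - s a)" using ab by Groebner_Basis.algebra
    have "m dvd t (\<pi> k) - t a' - u * (s k - s a)" for k
      using exh[of k] ba ca by (auto simp: pi)
    from this[of i] this[of j] show ?thesis
      unfolding cong_iff_dvd_diff by Groebner_Basis.algebra
  qed
  ultimately show ?thesis unfolding affinely_equivalent_def bij_def by blast
qed

text \<open>Because the recoloring \<open>\<pi>\<close> is the same at every line, a step
  \<open>s i - s j\<close> moves \<open>h\<close> by an amount independent of the starting point.
  The shifts with this additivity form a subgroup, hence contain everything, and \<open>h\<close> is
  affine with slope \<open>h 1 - h 0\<close>.\<close>

lemma affinely_equivalentI: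
  assumes prim: "primitive m s"
    and bij: "bij \<pi>"
    and g: "\<And>y i. [h (y + s i) = g y + t (\<pi> i)] (mod m)"
    and h: "\<And>x y. [x = y] (mod m) \<Longrightarrow> [h x = h y] (mod m)"
  shows "affinely_equivalent m s t"
proof -
  have step: "[h (x + (s i - s j)) = h x + (t (\<pi> i) - t (\<pi> j))] (mod m)" for x i j
    using g[of "x - s j" i] g[of "x - s j" j] unfolding cong_iff_dvd_diff
    by (simp add: algebra_simps) Groebner_Basis.algebra
  define u where "u = h 1 - h 0"
  have "d \<in> {d. \<forall>x. [h (x + d) = h x + h d - h 0] (mod m)}" for d
  proof (rule primitive_induct[OF prim])
    show "m \<in> {d. \<forall>x. [h (x + d) = h x + h d - h 0] (mod m)}"
    proof safe
      fix x
      have "[h (x + m) = h x] (mod m)" "[h m = h 0] (mod m)"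
        by (rule h; simp add: cong_def)+
      then show "[h (x + m) = h x + h m - h 0] (mod m)"
        unfolding cong_iff_dvd_diff by Groebner_Basis.algebra
    qed
    show "s i - s j \<in> {d. \<forall>x. [h (x + d) = h x + h d - h 0] (mod m)}" for i j
    proof safe
      fix x show "[h (x + (s i - s j)) = h x + h (s i - s j) - h 0] (mod m)"
        using step[of x i j] step[of 0 i j] unfolding cong_iff_dvd_diff
        by (simp add: algebra_simps) Groebner_Basis.algebra
    qed
    fix d e
    assume d: "d \<in> {d. \<forall>x. [h (x + d) = h x + h d - h 0] (mod m)}"
      and e: "e \<in> {d. \<forall>x. [h (x + d) = h x + h d - h 0] (mod m)}"
    show "d - e \<in> {d. \<forall>x. [h (x + d) = h x + h d - h 0] (mod m)}"
    proof safe
      fix x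
      have "[h (x + d) = h x + h d - h 0] (mod m)" using d by blast
      moreover have "[h (x - e + d + e) = h (x - e + d) + h e - h 0] (mod m)" 
         "[h (d - e + e) = h (d - e) + h e - h 0] (mod m)" using e by blast+
      ultimately show "[h (x + (d - e)) = h x + h (d - e) - h 0] (mod m)"
        unfolding cong_iff_dvd_diff by (simp add: algebra_simps) Groebner_Basis.algebra
    qed
  qed
  then have add: "[h (x + d) = h x + h d - h 0] (mod m)" for x d by blast
  have nat: "[h (int n) = h 0 + u * int n] (mod m)" for n
  proof (induction n)
    case (Suc n)
    have "[h (int n + 1) = h (int n) + h 1 - h 0] (mod m)" by (rule add)
    then show ?case using Suc unfolding u_def cong_iff_dvd_diff
      by (simp add: algebra_simps) Groebner_Basis.algebra
  qed simp
  have lin: "[h x = h 0 + u * x] (mod m)" for x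
  proof (cases "x \<ge> 0")
    case True
    then show ?thesis using nat[of "nat x"] by simp
  next
    case False
    have "[h (x + int (nat (- x))) = h x + h (int (nat (- x))) - h 0] (mod m)" by (rule add)
    then show ?thesis using False nat[of "nat (- x)"] unfolding cong_iff_dvd_diff
      by simp Groebner_Basis.algebra
  qed
  have "[t (\<pi> i) - t (\<pi> j) = u * (s i - s j)] (mod m)" for i j
    using step[of 0 i j] lin[of "s i - s j"] unfolding cong_iff_dvd_diff
    by simp Groebner_Basis.algebra
  then show ?thesis using bij unfolding affinely_equivalent_def by blast
qed

theorem coordinates_affinely_equivalent:
  assumes "coordinatized m s \<phi> C" "coordinatized m t \<psi> C" and m3: "\<not> m dvd 3"
  shows "affinely_equivalent m s t"
proof -
  interpret S: coordinatized m s \<phi> C by fact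
  interpret T: coordinatized m t \<psi> C by fact
  have "\<exists>w. line s \<phi> y = line t \<psi> w" for y
    using S.line_in_lines[of y] T.coords unfolding coordinates_def by blast
  then obtain g where g: "\<And>y. line s \<phi> y = line t \<psi> (g y)" by metis
  have "\<exists>k. \<phi> (y + s i) = \<psi> (g y + t k)" for y i
    using S.point_in_line[of y i] unfolding g by (auto simp: line_def)
  then obtain \<rho> where \<rho>: "\<And>y i. \<phi> (y + s i) = \<psi> (g y + t (\<rho> y i))" by metis
  \<comment> \<open>\<open>\<rho> y\<close> recolors the edges at line \<open>y\<close>;
    \<open>P x\<close> recolors the edges at the point \<open>x\<close>. So far the recolorings at
    different vertices are related only by the fact that both ends of an edge give it the same new
    color.\<close>
  define P where "P x k = \<rho> (x - s k) k" for x k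
  have P_line: "line s \<phi> (x - s k) = line t \<psi> (z - t (P x k))" if z: "\<phi> x = \<psi> z" for x z k
  proof -
    have "\<psi> z = \<psi> (g (x - s k) + t (P x k))" using \<rho>[of "x - s k" k] z by (simp add: P_def)
    then have "[g (x - s k) = z - t (P x k)] (mod m)"
      unfolding T.point_eq_iff cong_iff_dvd_diff by Groebner_Basis.algebra
    then show ?thesis using g T.line_eq_iff by metis
  qed
  have inj_\<rho>: "inj (\<rho> y)" for y
    by (rule injI) (metis S.offset_eq \<rho>)
  have inj_P: "inj (P x)" for x
  proof (rule injI)
    fix i j assume eq: "P x i = P x j"
    obtain z where "\<phi> x = \<psi> z"
      using S.coords T.coords unfolding coordinates_def by (metis rangeE rangeI)
    then have "line s \<phi> (x - s i) = line s \<phi> (x - s j)" using P_line eq by metis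
    then have "[s i = s j] (mod m)" unfolding S.line_eq_iff cong_iff_dvd_diff by Groebner_Basis.algebra
    then show "i = j" by (rule sidon_distinct[OF S.sid])
  qed
  have surj: "surj f" if "inj f" for f :: "color \<Rightarrow> color"
    using that by (simp add: finite_UNIV_inj_surj)
  have P_same: "P (y + s i) i = \<rho> y i" for y i by (simp add: P_def)
  \<comment> \<open>The path leaves the edge of color \<open>i\<close> by \<open>k\<close> at its
    point and by \<open>j\<close> at its line, so two a priori different recolorings enter.\<close>
  have trans: "hexagon m s k i j \<longleftrightarrow> hexagon m t (P (y + s i) k) (\<rho> y i) (\<rho> y j)"
    if "k \<noteq> i" "j \<noteq> i" for k i j y
  proof -
    have "line s \<phi> (y + s i - s k) = line t \<psi> (g y + t (\<rho> y i) - t (P (y + s i) k))"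
      using P_line[OF \<rho>[of y i]] .
    moreover have "\<rho> y j \<noteq> \<rho> y i" using that inj_\<rho> by (metis injD)
    moreover have "P (y + s i) k \<noteq> \<rho> y i" using that inj_P P_same by (metis injD)
    ultimately show ?thesis
      using S.closed_path_iff[OF that(2,1), of y] T.closed_path_iff[of "\<rho> y j" "\<rho> y i" "P (y + s i) k" "g y"]
      by (simp add: g \<rho>)
  qed
  have rich: "rich m s i \<longleftrightarrow> rich m t (\<rho> y i)" for y i
  proof -
    have eqs: "(\<forall>k. k \<noteq> \<rho> y i \<longrightarrow> Q k) \<longleftrightarrow> (\<forall>k. k \<noteq> i \<longrightarrow> Q (P (y + s i) k))" for Q
      using surj[OF inj_P[of "y + s i"]] inj_P[of "y + s i"] P_same[of y i]
      by (metis injD surjD)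
    have eqr: "(\<exists>k. k \<noteq> \<rho> y i \<and> Q k) \<longleftrightarrow> (\<exists>k. k \<noteq> i \<and> Q (\<rho> y k))" for Q
      using surj[OF inj_\<rho>[of "y"]] inj_\<rho>[of "y"]
      by (metis injD surjD)
    show ?thesis
      unfolding rich_iff eqs eqr using trans by blast
  qed
  have doub: "doubling m s \<longleftrightarrow> doubling m t"
    unfolding doubling_iff[OF S.sid S.prim m3] doubling_iff[OF T.sid T.prim m3]
    using rich[of _ 0] surj[OF inj_\<rho>[of 0]] by (metis surjD)
  show ?thesis
  proof (cases "doubling m s")
    case True
    then show ?thesis using doubling_affinely_equivalent S.prim doub by blast
  next
    case nd: False
    \<comment> \<open>Both ends of an edge see the same permutation. If its color is not rich, the
      path \<open>k, i, j\<close> lies on a 6-cycle exactly when \<open>k\<close> and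
      \<open>j\<close> differ, so equality of the outer colors is visible in the graph.\<close>
    have P_\<rho>: "P (y + s i) = \<rho> y" for y i
    proof (cases "rich m s i")
      case False
      have "P (y + s i) k = \<rho> y k" for k
      proof (cases "k = i")
        case ki: False
        have "\<not> hexagon m s k i k" using False ki unfolding rich_def by blast
        then have "\<not> hexagon m t (P (y + s i) k) (\<rho> y i) (\<rho> y k)" using trans ki by blast
        moreover have "\<rho> y k \<noteq> \<rho> y i" using ki inj_\<rho> by (metis injD)
        moreover have "P (y + s i) k \<noteq> \<rho> y i" using ki inj_P P_same by (metis injD)
        ultimately show ?thesis using hexagon_distinct by metis
      qed (simp add: P_same)
      then show ?thesis by blast
    next
      case True
      have nd': "\<not> doubling m t" using nd doub by blast
      \<comment> \<open>Richness caused by 3-torsion comes in pairs, and not all three colors are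
        rich, so exactly one is not. Both recolorings send it to its counterpart for
        \<open>t\<close>; they also agree on \<open>i\<close>, hence everywhere.\<close>
      have one: "\<exists>h. \<not> rich m s' h \<and> (\<forall>k. \<not> rich m s' k \<longrightarrow> k = h)"
        if hyps: "rich m s' i'" "sidon m s'" "primitive m s'" "\<not> doubling m s'" for s' i'
      proof -
        obtain j where j: "j \<noteq> i'" "[3 * (s' j - s' i') = 0] (mod m)"
          using hyps rich_not_doubling by blast
        have "[3 * (s' i' - s' j) = 0] (mod m)" using j(2) unfolding cong_iff_dvd_diff by Groebner_Basis.algebra
        then have "rich m s' j" using j hyps rich_not_doubling by metis
        moreover obtain h where "\<not> rich m s' h" using hyps doubling_iff m3 by blast
        ultimately have "\<not> rich m s' k \<Longrightarrow> k = h" for k using hyps(1) j(1)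
          by (cases k; cases h; cases j; cases i') auto
        then show ?thesis using \<open>\<not> rich m s' h\<close> by blast
      qed
      obtain h where h: "\<not> rich m s h" using one[OF True S.sid S.prim nd] by blast
      obtain h' where "\<And>k. \<not> rich m t k \<Longrightarrow> k = h'"
        using one[OF _ T.sid T.prim nd', of "\<rho> y i"] rich True by blast
      then have "\<rho> y h = h'" "P (y + s i) h = h'" using rich h unfolding P_def by blast+
      then show ?thesis
        using bij_color_agree[OF inj_P inj_\<rho>, of "y + s i" i y h] P_same h True by auto
    qed
    define \<pi> where "\<pi> = \<rho> 0"
    have cong: "\<rho> y = \<rho> z" if "[y = z] (mod m)" for y z
    proof
      fix i
      have "line t \<psi> (g y) = line t \<psi> (g z)" using S.line_cong[OF that] g by metis
      then have gg: "[g y = g z] (mod m)" by (simp add: T.line_eq_iff)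
      have "\<phi> (y + s i) = \<phi> (z + s i)" using that by (simp add: S.point_eq_iff cong_add)
      then have "[g y + t (\<rho> y i) = g z + t (\<rho> z i)] (mod m)" by (simp add: \<rho> T.point_eq_iff)
      then have "[t (\<rho> y i) = t (\<rho> z i)] (mod m)"
        using gg unfolding cong_iff_dvd_diff by Groebner_Basis.algebra
      then show "\<rho> y i = \<rho> z i" by (rule sidon_distinct[OF T.sid])
    qed
    \<comment> \<open>The lines \<open>y\<close> and \<open>y + (s i - s j)\<close> meet in the
      point \<open>y + s i\<close>, which passes the recoloring from one to the other. Since these
      steps generate, the recoloring is constant.\<close>
    have "d \<in> {d. \<forall>y. \<rho> (y + d) = \<rho> y}" for d
    proof (rule primitive_induct[OF S.prim])
      show "m \<in> {d. \<forall>y. \<rho> (y + d) = \<rho> y}" 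
      proof safe
        show "\<rho> (y + m) = \<rho> y" for y by (rule cong) (simp add: cong_def)
      qed
      show "s i - s j \<in> {d. \<forall>y. \<rho> (y + d) = \<rho> y}" for i j
      proof safe
        fix y
        have "y + (s i - s j) + s j = y + s i" by simp
        then show "\<rho> (y + (s i - s j)) = \<rho> y" using P_\<rho> by metis
      qed
      show "d - e \<in> {d. \<forall>y. \<rho> (y + d) = \<rho> y}"
        if "d \<in> {d. \<forall>y. \<rho> (y + d) = \<rho> y}" "e \<in> {d. \<forall>y. \<rho> (y + d) = \<rho> y}" for d e
      proof safe
        fix y
        have "\<forall>y. \<rho> (y + d) = \<rho> y" and e: "\<forall>y. \<rho> (y + e) = \<rho> y" using that by blast+
        moreover from e[rule_format, of "y + (d - e)"]
        have "\<rho> (y + (d - e)) = \<rho> (y + d)" by (simp add: algebra_simps)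
        ultimately have "\<rho> (y + (d - e)) = \<rho> y" by simp
        then show "\<rho> (y + (d - e)) = \<rho> y" .
      qed
    qed
    then have const: "\<rho> y = \<pi>" for y 
      unfolding \<pi>_def using add_0[of y] by (metis (mono_tags, lifting) mem_Collect_eq)
    have "\<exists>z. \<phi> x = \<psi> z" for x
      using S.coords T.coords unfolding coordinates_def by (metis rangeE rangeI)
    then obtain h where h: "\<And>x. \<phi> x = \<psi> (h x)" by metis
    show ?thesis
    proof (rule affinely_equivalentI[OF S.prim])
      show "bij \<pi>" using inj_\<rho>[of 0] surj unfolding bij_def \<pi>_def by blast
      show "[h (y + s i) = g y + t (\<pi> i)] (mod m)" for y i
        using \<rho>[of y i] by (simp add: h const T.point_eq_iff)
      show "[h x = h y] (mod m)" if "[x = y] (mod m)" for x y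
        using that h S.point_eq_iff T.point_eq_iff by metis
    qed
  qed
qed

section \<open>Cyclic configurations and coordinates\<close>

lemma range_mod:
  fixes \<phi> :: "int \<Rightarrow> 'a"
  assumes "m > 0" and iff: "\<And>x y. \<phi> x = \<phi> y \<longleftrightarrow> [x = y] (mod m)"
  shows "range \<phi> = \<phi> ` {0..<m}" "inj_on \<phi> {0..<m}" "card (range \<phi>) = nat m"
proof -
  have "\<phi> x = \<phi> (x mod m)" for x by (simp add: iff)
  moreover have "x mod m \<in> {0..<m}" for x using assms(1) by simp
  ultimately show eq: "range \<phi> = \<phi> ` {0..<m}" by blast
  show inj: "inj_on \<phi> {0..<m}"
    by (auto simp: inj_on_def iff cong_def)
  show "card (range \<phi>) = nat m" unfolding eq by (simp add: card_image[OF inj])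
qed

context coordinatized
begin

lemma card_line: "card (line s \<phi> y) = 3"
proof -
  have "inj (\<lambda>i. \<phi> (y + s i))" by (rule injI) (rule offset_eq)
  then show ?thesis unfolding line_def by (simp add: card_image card_UNIV_color)
qed

lemma lines_meet:
  assumes "B1 \<in> snd C" "B2 \<in> snd C" "B1 \<noteq> B2"
  shows "card (B1 \<inter> B2) \<le> 1"
proof -
  obtain y z where yz: "B1 = line s \<phi> y" "B2 = line s \<phi> z"
    using assms coords unfolding coordinates_def by auto
  have "p = q" if p: "p \<in> B1 \<inter> B2" and q: "q \<in> B1 \<inter> B2" for p q
  proof (rule ccontr)
    assume "p \<noteq> q"
    obtain i j where ij: "p = \<phi> (y + s i)" "p = \<phi> (z + s j)" using p[unfolded yz line_def] by blast
    obtain k l where kl: "q = \<phi> (y + s k)" "q = \<phi> (z + s l)" using q[unfolded yz line_def] by blast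
    have ne: "i \<noteq> k" "j \<noteq> l" using ij kl \<open>p \<noteq> q\<close> by auto
    have e: "[y + s i = z + s j] (mod m)" "[y + s k = z + s l] (mod m)"
      using ij kl point_eq_iff by metis+
    then have "[s i - s k = s j - s l] (mod m)" unfolding cong_iff_dvd_diff by Groebner_Basis.algebra
    then have "i = j" using sidonD[OF sid ne] by blast
    then have "[y = z] (mod m)" using e(1) by (simp add: cong_add_rcancel)
    then show False using yz assms(3) line_cong by blast
  qed
  moreover have "finite (B1 \<inter> B2)" using yz by (simp add: line_def)
  ultimately show ?thesis by (simp add: card_le_Suc0_iff_eq)
qed

lemma card_lines_through: "card {B \<in> snd C. \<phi> x \<in> B} = 3"
proof -
  have "{B \<in> snd C. \<phi> x \<in> B} = range (\<lambda>k. line s \<phi> (x - s k))"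
  proof (intro equalityI subsetI)
    fix B assume "B \<in> {B \<in> snd C. \<phi> x \<in> B}"
    then show "B \<in> range (\<lambda>k. line s \<phi> (x - s k))" using line_through_point by blast
  next
    fix B assume "B \<in> range (\<lambda>k. line s \<phi> (x - s k))"
    then obtain k where "B = line s \<phi> (x - s k)" by blast
    then show "B \<in> {B \<in> snd C. \<phi> x \<in> B}" using line_in_lines point_in_line[of "x - s k" k] by auto
  qed
  moreover have "inj (\<lambda>k. line s \<phi> (x - s k))"
  proof (rule injI)
    fix i j assume "line s \<phi> (x - s i) = line s \<phi> (x - s j)"
    then have "[s i = s j] (mod m)" unfolding line_eq_iff cong_iff_dvd_diff by Groebner_Basis.algebra
    then show "i = j" by (rule sidon_distinct[OF sid])
  qed
  ultimately show ?thesis by (simp add: card_image card_UNIV_color)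
qed

lemma configuration:
  assumes "m > 0"
  shows "balanced_configuration (nat m) 3 C"
proof -
  obtain P \<B> where C: "C = (P, \<B>)" by fastforce
  have P: "P = range \<phi>" and B: "\<B> = range (line s \<phi>)"
    using coords C unfolding coordinates_def by auto
  have "finite P" "card P = nat m"
    using range_mod[OF assms point_eq_iff] P by (simp_all)
  moreover have "card \<B> = nat m"
    using range_mod(3)[OF assms line_eq_iff] B by simp
  moreover have "\<B> \<subseteq> Pow P" unfolding B P line_def by auto
  moreover have "\<forall>B1\<in>\<B>. \<forall>B2\<in>\<B>. B1 \<noteq> B2 \<longrightarrow> card (B1 \<inter> B2) \<le> 1"
    using lines_meet C by simp
  moreover have "\<forall>x\<in>P. card {B \<in> \<B>. x \<in> B} = 3"
    using card_lines_through C P by auto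
  moreover have "\<forall>B\<in>\<B>. card B = 3" using card_line B by auto
  ultimately show ?thesis
    unfolding balanced_configuration_def configuration_def C using P by simp
qed

text \<open>The shifts that preserve membership in \<open>P1\<close> form a subgroup, and it
  contains every \<open>s i - s j\<close> because a line lies wholly in \<open>P1\<close> or wholly
  in \<open>P2\<close>. So one point of \<open>P1\<close> draws all points into it.\<close>

lemma connected: "connected_configuration C"
  unfolding connected_configuration_def decomposable_def
proof (intro notI, elim exE conjE)
  fix P1 \<B>1 P2 \<B>2 v r b k v' r' b' k'
  assume c1: "configuration v r b k (P1, \<B>1)" and c2: "configuration v' r' b' k' (P2, \<B>2)"
    and disj: "P1 \<inter> P2 = {}" and C: "C = (P1 \<union> P2, \<B>1 \<union> \<B>2)"
  have P: "P1 \<union> P2 = range \<phi>" using coords C unfolding coordinates_def by auto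
  have sub: "L \<subseteq> P1 \<or> L \<subseteq> P2" if "L \<in> snd C" for L
    using that C configuration_lines[OF c1] configuration_lines[OF c2] by auto
  have ne: "P1 \<noteq> {}" "P2 \<noteq> {}" using c1 c2 unfolding configuration_def by auto
  then obtain p where p: "p \<in> P1" by blast
  then have "p \<in> range \<phi>" unfolding P[symmetric] by simp
  then obtain x where x: "\<phi> x \<in> P1" using p by auto
  define H where "H = {d. \<forall>x. \<phi> x \<in> P1 \<longleftrightarrow> \<phi> (x + d) \<in> P1}"
  have H: "d \<in> H" for d
  proof (rule primitive_induct[OF prim])
    have "\<phi> (x + m) = \<phi> x" for x by (simp add: point_eq_iff cong_def)
    then show "m \<in> H" by (simp add: H_def)
    show "s i - s j \<in> H" for i j
      unfolding H_def
    proof safe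
      fix x
      have "\<phi> x \<in> line s \<phi> (x - s j)" "\<phi> (x + (s i - s j)) \<in> line s \<phi> (x - s j)"
        using point_in_line[of "x - s j" j] point_in_line[of "x - s j" i] by (simp_all add: algebra_simps)
      then show "\<phi> x \<in> P1 \<Longrightarrow> \<phi> (x + (s i - s j)) \<in> P1" "\<phi> (x + (s i - s j)) \<in> P1 \<Longrightarrow> \<phi> x \<in> P1"
        using sub[OF line_in_lines[of "x - s j"]] disj by auto
    qed
    fix d e assume d: "d \<in> H" and e: "e \<in> H"
    show "d - e \<in> H" unfolding H_def
    proof (intro CollectI allI)
      fix x
      have "\<phi> (x + (d - e)) \<in> P1 \<longleftrightarrow> \<phi> (x + (d - e) + e) \<in> P1" using e unfolding H_def by blast
      also have "\<dots> \<longleftrightarrow> \<phi> x \<in> P1" using d unfolding H_def by simp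
      finally show "\<phi> x \<in> P1 \<longleftrightarrow> \<phi> (x + (d - e)) \<in> P1" by blast
    qed
  qed
  have "\<phi> y \<in> P1" for y
  proof -
    have "\<forall>x. \<phi> x \<in> P1 \<longleftrightarrow> \<phi> (x + (y - x')) \<in> P1" for x' using H[of "y - x'"] unfolding H_def by blast
    from this[of x, rule_format, of x] x show ?thesis by simp
  qed
  then have "range \<phi> \<subseteq> P1" by blast
  then show False using ne(2) P[symmetric] disj by auto
qed

lemma shift:
  obtains f where "\<And>x. f (\<phi> x) = \<phi> (x + 1)" "automorphism f C"
proof -
  define f where "f p = \<phi> ((SOME x. \<phi> x = p) + 1)" for p
  have f: "f (\<phi> x) = \<phi> (x + 1)" for x
  proof -
    have "\<phi> (SOME z. \<phi> z = \<phi> x) = \<phi> x" by (rule someI) simp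
    then show ?thesis unfolding f_def by (simp add: point_eq_iff cong_add_rcancel)
  qed
  have P: "fst C = range \<phi>" and B: "snd C = range (line s \<phi>)"
    using coords unfolding coordinates_def by auto
  have "bij_betw f (range \<phi>) (range \<phi>)"
  proof (rule bij_betw_imageI)
    show "inj_on f (range \<phi>)" by (auto simp: inj_on_def f point_eq_iff cong_add_rcancel)
    have "\<phi> x \<in> f ` range \<phi>" for x using f[of "x - 1"] by (metis diff_add_cancel image_eqI rangeI)
    then show "f ` range \<phi> = range \<phi>" using f by auto
  qed
  moreover have fl: "f ` line s \<phi> y = line s \<phi> (y + 1)" for y
    unfolding line_def by (simp add: image_image f algebra_simps)
  have "(`) f ` range (line s \<phi>) = range (line s \<phi>)"
  proof (intro equalityI subsetI)
    fix L assume "L \<in> range (line s \<phi>)"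
    then obtain y where "L = line s \<phi> y" by blast
    then have "L = f ` line s \<phi> (y - 1)" using fl[of "y - 1"] by simp
    then show "L \<in> (`) f ` range (line s \<phi>)" by blast
  qed (auto simp: fl)
  ultimately have "automorphism f C" unfolding automorphism_def isomorphism_def P B by blast
  then show ?thesis using that f by blast
qed

lemma cyclic:
  assumes "m > 0"
  shows "cyclic_configuration C"
proof -
  obtain f where f: "\<And>x. f (\<phi> x) = \<phi> (x + 1)" and aut: "automorphism f C" using shift by blast
  have pow: "(f ^^ n) (\<phi> 0) = \<phi> (int n)" for n
    by (induction n) (simp_all add: f add.commute)
  have P: "fst C = range \<phi>" using coords unfolding coordinates_def by auto
  have "fst C = orbit f (\<phi> 0)"
    unfolding orbit_altdef pow P
  proof (intro equalityI subsetI)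
    fix p assume "p \<in> range \<phi>"
    then obtain x where "p = \<phi> x" by blast
    \<comment> \<open>An orbit consists of positive iterates; adding \<open>m\<close> makes the
      exponent positive for the residue 0 as well.\<close>
    then have "p = \<phi> (int (nat (x mod m + m)))"
      using assms by (simp add: point_eq_iff cong_def)
    moreover have "0 < nat (x mod m + m)" using assms
      by (simp add: add_nonneg_pos)
    ultimately show "p \<in> {\<phi> (int n) |n. 0 < n}" by blast
  qed auto
  then have "cyclic_on f (fst C)" unfolding cyclic_on_def using P by blast
  then show ?thesis unfolding cyclic_configuration_def using aut by blast
qed

end

section \<open>Transport of coordinates along isomorphisms and affine maps\<close>

lemma coordinates_isomorphic:
  assumes C: "coordinates m s \<phi> C" and D: "coordinates m s \<psi> D"
  shows "\<exists>f. isomorphism f C D"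
proof -
  define f where "f p = \<psi> (SOME x. \<phi> x = p)" for p
  have C': "\<And>x y. \<phi> x = \<phi> y \<longleftrightarrow> [x = y] (mod m)" "fst C = range \<phi>" "snd C = range (line s \<phi>)"
    using C unfolding coordinates_def by blast+
  have D': "\<And>x y. \<psi> x = \<psi> y \<longleftrightarrow> [x = y] (mod m)" "fst D = range \<psi>" "snd D = range (line s \<psi>)"
    using D unfolding coordinates_def by blast+
  have f: "f (\<phi> x) = \<psi> x" for x
  proof -
    have "\<phi> (SOME z. \<phi> z = \<phi> x) = \<phi> x" by (rule someI) simp
    then show ?thesis unfolding f_def using C'(1) D'(1) by blast
  qed
  have "f ` line s \<phi> y = line s \<psi> y" for y
    unfolding line_def by (simp add: image_image f)
  then have "(`) f ` snd C = snd D" unfolding C'(3) D'(3) by (simp add: image_image)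
  moreover have "bij_betw f (fst C) (fst D)"
    unfolding C'(2) D'(2) by (rule bij_betw_imageI) (auto simp: inj_on_def f C'(1) D'(1) image_image)
  ultimately show ?thesis unfolding isomorphism_def by blast
qed

lemma coordinates_transfer:
  assumes C: "coordinates m s \<phi> C" and f: "isomorphism f C D"
  shows "coordinates m s (f \<circ> \<phi>) D"
proof -
  have C': "\<And>x y. \<phi> x = \<phi> y \<longleftrightarrow> [x = y] (mod m)" "fst C = range \<phi>" "snd C = range (line s \<phi>)"
    using C unfolding coordinates_def by blast+
  have inj: "inj_on f (range \<phi>)" and P: "f ` range \<phi> = fst D" and B: "(`) f ` range (line s \<phi>) = snd D"
    using f unfolding isomorphism_def C' bij_betw_def by auto
  have "f ` line s \<phi> y = line s (f \<circ> \<phi>) y" for y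
    unfolding line_def by (simp add: image_image)
  then have "snd D = range (line s (f \<circ> \<phi>))" using B by (auto simp: image_image)
  moreover have "(f \<circ> \<phi>) x = (f \<circ> \<phi>) y \<longleftrightarrow> [x = y] (mod m)" for x y
    using inj_on_eq_iff[OF inj rangeI rangeI] C'(1) by simp
  moreover have "fst D = range (f \<circ> \<phi>)" using P by (auto simp: image_image)
  ultimately show ?thesis unfolding coordinates_def by blast
qed

text \<open>A common divisor of \<open>u\<close> and \<open>m\<close> divides all differences of
  \<open>t\<close>, so \<open>u\<close> has an inverse \<open>w\<close>. Precomposing
  \<open>\<phi>\<close> with multiplication by \<open>w\<close> turns the translates of
  \<open>s\<close> into translates of \<open>t\<close>; following the color \<open>Red\<close> gives
  the new base points.\<close>

lemma coordinates_affine_change: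
  assumes C: "coordinates m s \<phi> C" and eq: "affinely_equivalent m s t" and prim: "primitive m t"
  shows "\<exists>\<psi>. coordinates m t \<psi> C"
proof -
  have C': "\<And>x y. \<phi> x = \<phi> y \<longleftrightarrow> [x = y] (mod m)" "fst C = range \<phi>" "snd C = range (line s \<phi>)"
    using C unfolding coordinates_def by blast+
  obtain u \<pi> where bij: "bij \<pi>" and u: "\<And>i j. [t (\<pi> i) - t (\<pi> j) = u * (s i - s j)] (mod m)"
    using eq unfolding affinely_equivalent_def by blast
  have "coprime u m"
  proof (rule coprimeI)
    fix g assume g: "g dvd u" "g dvd m"
    have "g dvd t i - t j" for i j
    proof -
      obtain i' j' where "i = \<pi> i'" "j = \<pi> j'" using bij by (metis bij_pointE)
      then have "[t i - t j = u * (s i' - s j')] (mod g)" using u g(2) cong_dvd_modulus by blast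
      then show ?thesis using g(1) by (meson cong_dvd_iff dvd_mult2)
    qed
    then show "g dvd 1" using prim g(2) unfolding primitive_def by blast
  qed
  then obtain w where w: "[u * w = 1] (mod m)" using cong_solve_coprime_int by blast
  define \<psi> where "\<psi> x = \<phi> (w * x)" for x
  have \<psi>: "\<psi> x = \<psi> y \<longleftrightarrow> [x = y] (mod m)" for x y
  proof
    assume "\<psi> x = \<psi> y"
    then show "[x = y] (mod m)"
      using w unfolding \<psi>_def C'(1) cong_iff_dvd_diff by Groebner_Basis.algebra
  next
    assume "[x = y] (mod m)"
    then show "\<psi> x = \<psi> y" unfolding \<psi>_def C'(1) by (rule cong_scalar_left)
  qed
  have \<phi>\<psi>: "\<phi> x = \<psi> (u * x)" for x
    unfolding \<psi>_def C'(1) using w unfolding cong_iff_dvd_diff by Groebner_Basis.algebra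
  have ln: "line s \<phi> y = line t \<psi> (u * (y + s Red) - t (\<pi> Red))" for y
  proof -
    have "\<phi> (y + s i) = \<psi> (u * (y + s Red) - t (\<pi> Red) + t (\<pi> i))" for i
      using u[of i Red] unfolding \<phi>\<psi> \<psi> cong_iff_dvd_diff by Groebner_Basis.algebra
    then have "line s \<phi> y = (\<lambda>i. \<psi> (u * (y + s Red) - t (\<pi> Red) + t i)) ` range \<pi>"
      unfolding line_def by (simp add: image_image)
    also have "range \<pi> = UNIV" using bij by (simp add: bij_def)
    finally show ?thesis unfolding line_def .
  qed
  have "snd C = range (line t \<psi>)"
    unfolding C'(3)
  proof (intro equalityI subsetI)
    fix L assume "L \<in> range (line t \<psi>)"
    then obtain y where y: "L = line t \<psi> y" by blast
    let ?z = "w * (y + t (\<pi> Red)) - s Red"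
    have "[u * (?z + s Red) - t (\<pi> Red) = y] (mod m)"
      using w unfolding cong_iff_dvd_diff by Groebner_Basis.algebra
    then have "\<psi> (u * (?z + s Red) - t (\<pi> Red) + t i) = \<psi> (y + t i)" for i
      by (simp add: \<psi> cong_add)
    then have "L = line s \<phi> ?z" unfolding ln y unfolding line_def by simp
    then show "L \<in> range (line s \<phi>)" by blast
  qed (use ln in auto)
  moreover have "range \<psi> = range \<phi>"
  proof
    show "range \<psi> \<subseteq> range \<phi>" by (auto simp: \<psi>_def)
    show "range \<phi> \<subseteq> range \<psi>" using \<phi>\<psi> by (auto intro: range_eqI)
  qed
  ultimately have "coordinates m t \<psi> C" using \<psi> C'(2) unfolding coordinates_def by simp
  then show ?thesis by blast
qed

lemma coordinates_exist:
  assumes "v > 0"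
  shows "\<exists>C :: nat incidence. \<exists>\<phi>. coordinates (int v) s \<phi> C"
proof -
  let ?\<phi> = "\<lambda>x. nat (x mod int v)"
  have "?\<phi> x = ?\<phi> y \<longleftrightarrow> [x = y] (mod int v)" for x y
    using assms by (simp add: cong_def eq_nat_nat_iff)
  then have "coordinates (int v) s ?\<phi> (range ?\<phi>, range (line s ?\<phi>))"
    unfolding coordinates_def by simp
  then show ?thesis by blast
qed

section \<open>Coordinates from a cyclic automorphism\<close>

lemma cyclic_parametrization:
  assumes cyc: "cyclic_on f P" and card: "card P = v" and "v > 0"
  obtains \<phi> where "\<And>x y. \<phi> x = \<phi> y \<longleftrightarrow> [x = y] (mod int v)" "range \<phi> = P"
    "\<And>x. f (\<phi> x) = \<phi> (x + 1)"
proof -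
  obtain p where p: "p \<in> P" "P = orbit f p" using cyc unfolding cyclic_on_def by blast
  \<comment> \<open>The first return time of \<open>p\<close>. It is the length of the orbit, hence
    \<open>v\<close>, so \<open>f ^^ v\<close> fixes \<open>p\<close> and exponents matter only
    modulo \<open>v\<close>.\<close>
  define n where "n = funpow_dist1 f p p"
  have inj: "inj_on (\<lambda>k. (f ^^ k) p) {0..<n}"
    unfolding n_def using inj_on_funpow_dist1[of p f p] p by blast
  have P: "P = (\<lambda>k. (f ^^ k) p) ` {0..<n}"
    unfolding n_def using orbit_conv_funpow_dist1 p by metis
  have "card P = n" unfolding P card_image[OF inj] by simp
  then have nv: "n = v" using card by simp
  have ret: "(f ^^ v) p = p"
    unfolding nv[symmetric] n_def using funpow_dist1_prop p by metis
  define \<phi> where "\<phi> x = (f ^^ nat (x mod int v)) p" for x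
  have red: "(f ^^ k) p = \<phi> (int k)" for k
    unfolding \<phi>_def using funpow_mod_eq[OF ret, of k] by (simp add: nat_mod_distrib)
  have 1: "\<phi> x = \<phi> y \<longleftrightarrow> [x = y] (mod int v)" for x y
  proof
    assume "\<phi> x = \<phi> y"
    moreover have "nat (z mod int v) \<in> {0..<n}" for z
      using \<open>v > 0\<close> by (simp add: nv nat_less_iff)
    ultimately have "nat (x mod int v) = nat (y mod int v)"
      unfolding \<phi>_def using inj by (meson inj_onD)
    then show "[x = y] (mod int v)" using \<open>v > 0\<close> by (simp add: cong_def eq_nat_nat_iff)
  qed (simp add: \<phi>_def cong_def)
  have 2: "range \<phi> = P"
  proof
    show "range \<phi> \<subseteq> P"
      unfolding P \<phi>_def using \<open>v > 0\<close> by (auto simp: nv nat_less_iff)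
    show "P \<subseteq> range \<phi>" unfolding P using red by auto
  qed
  have 3: "f (\<phi> x) = \<phi> (x + 1)" for x
  proof -
    have "f (\<phi> x) = (f ^^ Suc (nat (x mod int v))) p" by (simp add: \<phi>_def)
    also have "\<dots> = \<phi> (int (Suc (nat (x mod int v))))" by (rule red)
    also have "\<dots> = \<phi> (x + 1)"
      unfolding 1 using \<open>v > 0\<close> by (simp add: cong_def mod_simps add.commute)
    finally show ?thesis .
  qed
  show ?thesis using that 1 2 3 by blast
qed

text \<open>The translation by \<open>d\<close> permutes the three residues without fixed point,
  hence in a 3-cycle. Going round once gives \<open>3 * d = 0\<close>, and every difference is a
  multiple of \<open>d\<close>.\<close>

lemma stabilized_triple:
  fixes m d :: int and s :: "color \<Rightarrow> int"
  assumes dist: "\<And>i j. [s i = s j] (mod m) \<Longrightarrow> i = j"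
    and \<tau>: "\<And>i. [s i + d = s (\<tau> i)] (mod m)" and d: "\<not> [d = 0] (mod m)"
  shows "[3 * (s i - s j) = 0] (mod m)"
proof -
  have nofix: "\<tau> i \<noteq> i" for i
  proof
    assume eq: "\<tau> i = i"
    have "[d = 0] (mod m)" using \<tau>[of i, unfolded eq] unfolding cong_iff_dvd_diff by Groebner_Basis.algebra
    then show False using d by blast
  qed
  have inj: "i = j" if eq: "\<tau> i = \<tau> j" for i j
  proof (rule dist)
    show "[s i = s j] (mod m)"
      using \<tau>[of i] \<tau>[of j, folded eq] unfolding cong_iff_dvd_diff by Groebner_Basis.algebra
  qed
  have "\<tau> Red = Green \<and> \<tau> Green = Blue \<and> \<tau> Blue = Red \<or> \<tau> Red = Blue \<and> \<tau> Blue = Green \<and> \<tau> Green = Red"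
    using nofix[of Red] nofix[of Green] nofix[of Blue]
      inj[of Red Green] inj[of Red Blue] inj[of Green Blue]
    by (cases "\<tau> Red"; cases "\<tau> Green"; cases "\<tau> Blue") auto
  then have rg: "[3 * (s Red - s Green) = 0] (mod m) \<and> [3 * (s Red - s Blue) = 0] (mod m)"
  proof
    assume *: "\<tau> Red = Green \<and> \<tau> Green = Blue \<and> \<tau> Blue = Red"
    have "m dvd s Red + d - s Green" "m dvd s Green + d - s Blue" "m dvd s Blue + d - s Red"
      using \<tau>[of Red] \<tau>[of Green] \<tau>[of Blue] * by (auto simp: cong_iff_dvd_diff)
    then have "m dvd 3 * (s Red - s Green) - 0" "m dvd 3 * (s Red - s Blue) - 0" by Groebner_Basis.algebra+
    then show ?thesis unfolding cong_iff_dvd_diff by blast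
  next
    assume *: "\<tau> Red = Blue \<and> \<tau> Blue = Green \<and> \<tau> Green = Red"
    have "m dvd s Red + d - s Blue" "m dvd s Blue + d - s Green" "m dvd s Green + d - s Red"
      using \<tau>[of Red] \<tau>[of Green] \<tau>[of Blue] * by (auto simp: cong_iff_dvd_diff)
    then have "m dvd 3 * (s Red - s Green) - 0" "m dvd 3 * (s Red - s Blue) - 0" by Groebner_Basis.algebra+
    then show ?thesis unfolding cong_iff_dvd_diff by blast
  qed
  have k: "[3 * (s Red - s k) = 0] (mod m)" for k
    using rg by (cases k) auto
  show ?thesis using k[of i] k[of j] unfolding cong_iff_dvd_diff by Groebner_Basis.algebra
qed

lemma card_triple_torsion:
  assumes "m > 0"
  shows "card {x \<in> {0..<m}. m dvd 3 * x} \<le> 3" "finite {x \<in> {0..<m}. m dvd 3 * (x::int)}"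
proof -
  have "{x \<in> {0..<m}. m dvd 3 * x} \<subseteq> {0, m div 3, (2 * m) div 3}"
  proof
    fix x assume "x \<in> {x \<in> {0..<m}. m dvd 3 * x}"
    then obtain k where x: "0 \<le> x" "x < m" and k: "3 * x = m * k" by (auto elim: dvdE)
    have "0 \<le> m * k" "m * k < m * 3" using x k by linarith+
    then have "0 \<le> k" "k < 3" using assms by (auto simp: zero_le_mult_iff)
    then have "k = 0 \<or> k = 1 \<or> k = 2" by auto
    then show "x \<in> {0, m div 3, (2 * m) div 3}" using k by auto
  qed
  then have "card {x \<in> {0..<m}. m dvd 3 * x} \<le> card {0, m div 3, (2 * m) div 3}"
    by (intro card_mono) auto
  also have "\<dots> \<le> 3" by (simp add: card_insert_if)
  finally show "card {x \<in> {0..<m}. m dvd 3 * x} \<le> 3" .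
  show "finite {x \<in> {0..<m}. m dvd 3 * (x::int)}" by (rule finite_subset[of _ "{0..<m}"]) auto
qed

text \<open>If \<open>g\<close> divides \<open>m\<close> and all differences, the coordinates along
  a line are congruent modulo \<open>g\<close>. So the points with coordinate divisible by
  \<open>g\<close> and the other points split the configuration, with 0 and 1 in different
  parts.\<close>

lemma connected_imp_primitive:
  assumes C: "coordinates m s \<phi> C" and conf: "configuration v 3 b 3 C"
    and conn: "connected_configuration C"
  shows "primitive m s"
proof (rule ccontr)
  assume "\<not> primitive m s"
  then obtain g where g: "g dvd m" "\<And>i j. g dvd s i - s j" "\<not> g dvd 1" unfolding primitive_def by blast
  have C': "\<And>x y. \<phi> x = \<phi> y \<longleftrightarrow> [x = y] (mod m)" "fst C = range \<phi>" "snd C = range (line s \<phi>)"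
    using C unfolding coordinates_def by blast+
  define P1 where "P1 = {\<phi> x |x. g dvd x}"
  define P2 where "P2 = range \<phi> - P1"
  have P1: "\<phi> x \<in> P1 \<longleftrightarrow> g dvd x" for x
  proof
    assume "\<phi> x \<in> P1"
    then obtain y where "\<phi> x = \<phi> y" "g dvd y" unfolding P1_def by blast
    then have "m dvd x - y" by (simp add: C'(1) cong_iff_dvd_diff)
    then have "g dvd x - y" using g(1) dvd_trans by blast
    then show "g dvd x" using \<open>g dvd y\<close> by (metis diff_add_cancel dvd_add)
  qed (auto simp: P1_def)
  define \<B>1 where "\<B>1 = {B \<in> snd C. B \<subseteq> P1}"
  define \<B>2 where "\<B>2 = {B \<in> snd C. B \<subseteq> P2}"
  have split: "B \<subseteq> P1 \<or> B \<subseteq> P2" if B: "B \<in> snd C" for B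
  proof -
    obtain y where y: "B = line s \<phi> y" using B C' by auto
    have "g dvd y + s i \<longleftrightarrow> g dvd y + s Red" for i
      using dvd_add_right_iff[OF g(2)[of i Red], of "y + s Red"] by (simp add: algebra_simps)
    then have "(\<forall>i. g dvd y + s i) \<or> (\<forall>i. \<not> g dvd y + s i)" by blast
    then show ?thesis unfolding y line_def P2_def by (auto simp: P1)
  qed
  have part: "P1 \<union> P2 = fst C" "P1 \<inter> P2 = {}" unfolding P2_def C'(2) by (auto simp: P1_def)
  have conf': "finite (fst C)" "snd C \<subseteq> Pow (fst C)"
      "\<And>B1 B2. B1 \<in> snd C \<Longrightarrow> B2 \<in> snd C \<Longrightarrow> B1 \<noteq> B2 \<Longrightarrow> card (B1 \<inter> B2) \<le> 1"
      "\<And>x. x \<in> fst C \<Longrightarrow> card {B \<in> snd C. x \<in> B} = 3" "\<And>B. B \<in> snd C \<Longrightarrow> card B = 3"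
    using conf unfolding configuration_def by (auto split: prod.splits)
  have sub: "configuration (card Q) 3 (card {B \<in> snd C. B \<subseteq> Q}) 3 (Q, {B \<in> snd C. B \<subseteq> Q})"
    if Q: "Q \<noteq> {}" "Q \<subseteq> fst C" and QB: "\<And>B x. B \<in> snd C \<Longrightarrow> x \<in> B \<Longrightarrow> x \<in> Q \<Longrightarrow> B \<subseteq> Q" for Q
  proof -
    have "card {B \<in> {B \<in> snd C. B \<subseteq> Q}. x \<in> B} = 3" if "x \<in> Q" for x
    proof -
      have "{B \<in> {B \<in> snd C. B \<subseteq> Q}. x \<in> B} = {B \<in> snd C. x \<in> B}" using QB that by blast
      moreover have "x \<in> fst C" using that Q(2) by blast
      ultimately show ?thesis using conf'(4) by simp
    qed
    moreover have "finite Q" using Q(2) conf'(1) finite_subset by blast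
    ultimately show ?thesis unfolding configuration_def using Q conf'(3,5) by auto
  qed
  have "\<phi> 0 \<in> P1" by (simp add: P1)
  moreover have "\<phi> 1 \<in> P2" unfolding P2_def using g(3) by (simp add: P1)
  moreover have "snd C = \<B>1 \<union> \<B>2" using split unfolding \<B>1_def \<B>2_def by blast
  then have "C = (P1 \<union> P2, \<B>1 \<union> \<B>2)" using part by (metis prod.collapse)
  moreover have "configuration (card P1) 3 (card \<B>1) 3 (P1, \<B>1)"
    unfolding \<B>1_def using \<open>\<phi> 0 \<in> P1\<close> part split by (intro sub) blast+
  moreover have "configuration (card P2) 3 (card \<B>2) 3 (P2, \<B>2)"
    unfolding \<B>2_def using \<open>\<phi> 1 \<in> P2\<close> part split by (intro sub) blast+
  ultimately have "decomposable C" unfolding decomposable_def using part(2) by blast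
  then show False using conn unfolding connected_configuration_def by blast
qed

theorem connected_cyclic_coordinatized:
  assumes "v > 0" and conf: "configuration v 3 v 3 C" and conn: "connected_configuration C"
    and cyc: "cyclic_configuration C"
  shows "\<exists>s \<phi>. coordinatized (int v) s \<phi> C"
proof -
  let ?m = "int v"
  have conf': "finite (fst C)" "card (fst C) = v" "snd C \<subseteq> Pow (fst C)" "card (snd C) = v"
      "\<And>B1 B2. B1 \<in> snd C \<Longrightarrow> B2 \<in> snd C \<Longrightarrow> B1 \<noteq> B2 \<Longrightarrow> card (B1 \<inter> B2) \<le> 1"
      "\<And>x. x \<in> fst C \<Longrightarrow> card {B \<in> snd C. x \<in> B} = 3" "\<And>B. B \<in> snd C \<Longrightarrow> card B = 3"
    using conf unfolding configuration_def by (auto split: prod.splits)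
  obtain f where aut: "automorphism f C" and cycf: "cyclic_on f (fst C)"
    using cyc unfolding cyclic_configuration_def by blast
  have fB: "f ` B \<in> snd C" if "B \<in> snd C" for B
    using aut that unfolding automorphism_def isomorphism_def by blast
  obtain \<phi> where \<phi>: "\<And>x y. \<phi> x = \<phi> y \<longleftrightarrow> [x = y] (mod ?m)" and P: "range \<phi> = fst C"
    and f: "\<And>x. f (\<phi> x) = \<phi> (x + 1)"
    using cyclic_parametrization[OF cycf conf'(2) \<open>v > 0\<close>] by blast
  have translate: "line s \<phi> y \<in> snd C" if L: "line s \<phi> 0 \<in> snd C" for s y
  proof -
    have "line s \<phi> (int n) \<in> snd C" for n
    proof (induction n)
      case (Suc n)
      have "f ` line s \<phi> (int n) = line s \<phi> (int (Suc n))"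
        unfolding line_def by (simp add: image_image f algebra_simps)
      then show ?case using fB[OF Suc] by simp
    qed (use L in simp)
    moreover have "line s \<phi> y = line s \<phi> (int (nat (y mod ?m)))"
      unfolding line_def using \<open>v > 0\<close>
      by (intro image_cong refl) (simp add: \<phi> cong_def mod_simps)
    ultimately show ?thesis by metis
  qed
  have param: "\<exists>s. B = line s \<phi> 0" if B: "B \<in> snd C" for B
  proof -
    have "finite B" "card B = card (UNIV :: color set)"
      using conf'(7)[OF B] card_UNIV_color card.infinite by force+
    then obtain h where h: "bij_betw h (UNIV :: color set) B"
      using finite_same_card_bij by (metis finite_color)
    have "B \<subseteq> range \<phi>" using B conf'(3) P by blast
    then have "\<exists>x. h i = \<phi> x" for i using h by (metis bij_betw_apply UNIV_I rangeE subsetD)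
    then obtain s where "\<And>i. h i = \<phi> (s i)" by metis
    then have "B = line s \<phi> 0" using h unfolding line_def bij_betw_def by auto
    then show ?thesis by blast
  qed
  have dist: "i = j" if L: "line s \<phi> 0 \<in> snd C" and ij: "[s i = s j] (mod ?m)" for s i j
  proof -
    have "card (range (\<lambda>i. \<phi> (s i))) = card (UNIV :: color set)"
      using conf'(7)[OF L] by (simp add: line_def card_UNIV_color)
    then have "inj (\<lambda>i. \<phi> (s i))" by (intro eq_card_imp_inj_on) auto
    then show ?thesis using ij \<phi> by (meson injD)
  qed
  have "\<exists>s. line s \<phi> 0 \<in> snd C \<and> (\<forall>y z. line s \<phi> y = line s \<phi> z \<longrightarrow> [y = z] (mod ?m))"
  proof (rule ccontr)
    assume contra: "\<not> ?thesis"
    \<comment> \<open>The 3-torsion points. There are at most three, which leaves no choice for a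
      stabilized line through \<open>\<phi> 0\<close>.\<close>
    define Z where "Z = \<phi> ` {x \<in> {0..<?m}. ?m dvd 3 * x}"
    have Z: "finite Z" "card Z \<le> 3"
    proof -
      show "finite Z" unfolding Z_def using card_triple_torsion(2)[of ?m] \<open>v > 0\<close> by simp
      have "card Z \<le> card {x \<in> {0..<?m}. ?m dvd 3 * x}" unfolding Z_def
        using card_triple_torsion(2)[of ?m] \<open>v > 0\<close> by (intro card_image_le) simp
      then show "card Z \<le> 3" using card_triple_torsion[of ?m] \<open>v > 0\<close> by simp
    qed
    have "B = Z" if B: "B \<in> snd C" "\<phi> 0 \<in> B" for B
    proof -
      obtain s where s: "B = line s \<phi> 0" using param B by blast
      then obtain y z where yz: "line s \<phi> y = line s \<phi> z" "\<not> [y = z] (mod ?m)"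
        using contra B by blast
      have "\<exists>j. [s i + (y - z) = s j] (mod ?m)" for i
      proof -
        have "\<phi> (y + s i) \<in> line s \<phi> z" unfolding yz(1)[symmetric] unfolding line_def by blast
        then obtain j where "[y + s i = z + s j] (mod ?m)" unfolding line_def by (auto simp: \<phi>)
        then have "[s i + (y - z) = s j] (mod ?m)" unfolding cong_iff_dvd_diff by Groebner_Basis.algebra
        then show ?thesis by blast
      qed
      then obtain \<tau> where \<tau>: "\<And>i. [s i + (y - z) = s (\<tau> i)] (mod ?m)" by metis
      have nz: "\<not> [y - z = 0] (mod ?m)" using yz(2) by (simp add: cong_iff_dvd_diff)
      have tors: "[3 * (s i - s j) = 0] (mod ?m)" for i j
      proof (rule stabilized_triple[where \<tau> = \<tau>])
        show "i = j" if "[s i = s j] (mod ?m)" for i j using dist[of s] B(1) s that by blast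
      qed (fact \<tau> nz)+
      obtain i0 where i0: "[s i0 = 0] (mod ?m)"
        using B(2) unfolding s line_def by (auto simp: \<phi> cong_sym_eq)
      have "B \<subseteq> Z"
      proof
        fix p assume "p \<in> B"
        then obtain j where p: "p = \<phi> (s j)" unfolding s line_def by auto
        have "?m dvd 3 * s j" using tors[of j i0] i0 unfolding cong_iff_dvd_diff by Groebner_Basis.algebra
        then have "?m dvd 3 * (s j mod ?m)" by (simp add: mod_simps dvd_eq_mod_eq_0)
        moreover have "p = \<phi> (s j mod ?m)" unfolding p \<phi> by (simp add: cong_def)
        ultimately show "p \<in> Z" unfolding Z_def using \<open>v > 0\<close> by auto
      qed
      then show ?thesis using Z conf'(7)[OF B(1)] by (intro card_seteq) auto
    qed
    then have "{B \<in> snd C. \<phi> 0 \<in> B} \<subseteq> {Z}" by blast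
    then have "card {B \<in> snd C. \<phi> 0 \<in> B} \<le> card {Z}" by (intro card_mono) auto
    then show False using conf'(6)[of "\<phi> 0"] P by auto
  qed
  then obtain s where L: "line s \<phi> 0 \<in> snd C"
    and free: "\<And>y z. line s \<phi> y = line s \<phi> z \<Longrightarrow> [y = z] (mod ?m)" by blast
  have cg: "line s \<phi> y = line s \<phi> z" if "[y = z] (mod ?m)" for y z
    unfolding line_def using that by (intro image_cong refl) (simp add: \<phi> cong_add)
  have "line s \<phi> y = line s \<phi> z \<longleftrightarrow> [y = z] (mod ?m)" for y z
    using free cg by blast
  then have "card (range (line s \<phi>)) = nat ?m"
    using \<open>v > 0\<close> by (intro range_mod(3)) auto
  moreover have "finite (snd C)" using conf'(1,3) finite_subset by blast
  \<comment> \<open>The configuration is balanced: the translates are \<open>v\<close> distinct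
    lines, and there are only \<open>v\<close> lines.\<close>
  ultimately have lines: "range (line s \<phi>) = snd C"
    using translate[OF L] conf'(4) by (intro card_seteq) (auto simp del: card_image)
  have coords: "coordinates ?m s \<phi> C" unfolding coordinates_def using \<phi> P lines by simp
  have "sidon ?m s" unfolding sidon_def
  proof (intro allI impI)
    fix i j k l assume ik: "i \<noteq> k" and jl: "j \<noteq> l" and e: "[s i - s k = s j - s l] (mod ?m)"
    \<comment> \<open>Translation by \<open>?z\<close> carries the pair \<open>j\<close>,
      \<open>l\<close> to the pair \<open>i\<close>, \<open>k\<close>, so this translate shares two
      points with the base line and must equal it.\<close>
    let ?z = "s i - s j"
    have p: "\<phi> (0 + s i) = \<phi> (?z + s j)" by simp
    have q: "\<phi> (0 + s k) = \<phi> (?z + s l)"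
      unfolding \<phi> using e unfolding cong_iff_dvd_diff by Groebner_Basis.algebra
    have "\<phi> (0 + s i) \<noteq> \<phi> (0 + s k)" using ik dist[OF L] by (auto simp: \<phi>)
    moreover have "{\<phi> (0 + s i), \<phi> (0 + s k)} \<subseteq> line s \<phi> 0 \<inter> line s \<phi> ?z"
      unfolding line_def using p q by (metis (no_types, lifting) IntI empty_subsetI insert_subset rangeI)
    then have "card {\<phi> (0 + s i), \<phi> (0 + s k)} \<le> card (line s \<phi> 0 \<inter> line s \<phi> ?z)"
      by (intro card_mono) (simp_all add: line_def)
    ultimately have "card (line s \<phi> 0 \<inter> line s \<phi> ?z) > 1" by simp
    then have "line s \<phi> 0 = line s \<phi> ?z"
      using conf'(5)[OF L translate[OF L, of ?z]] by linarith
    then have z: "[0 = ?z] (mod ?m)" by (rule free)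
    then have "[s i = s j] (mod ?m)" unfolding cong_iff_dvd_diff by Groebner_Basis.algebra
    moreover have "[s k = s l] (mod ?m)" using z e unfolding cong_iff_dvd_diff by Groebner_Basis.algebra
    ultimately show "i = j \<and> k = l" using dist[OF L] by blast
  qed
  moreover have "primitive ?m s" using connected_imp_primitive[OF coords conf conn] .
  ultimately show ?thesis unfolding coordinatized_def using coords by blast
qed

section \<open>Roots of quadratic congruences\<close>

definition roots_mod :: "(int \<Rightarrow> int) \<Rightarrow> int \<Rightarrow> int set" where
  "roots_mod f m = {x \<in> {0..<m}. m dvd f x}"

lemma finite_roots_mod [simp]: "finite (roots_mod f m)"
  unfolding roots_mod_def by (rule finite_subset[of _ "{0..<m}"]) auto

text \<open>Chinese remainder theorem. What is asked of \<open>f\<close> is compatibility with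
  congruences to every modulus, as any integer polynomial has it.\<close>

lemma card_roots_mod_mult:
  assumes f: "\<And>x y n. [x = y] (mod n) \<Longrightarrow> [f x = f y] (mod n)"
    and "a > 0" "b > 0" "coprime a b"
  shows "card (roots_mod f (a * b)) = card (roots_mod f a) * card (roots_mod f b)"
proof -
  have f_dvd: "n dvd f x \<longleftrightarrow> n dvd f y" if "[x = y] (mod n)" for x y n
    using f[OF that] by (rule cong_dvd_iff)
  have modc: "[x mod n = x] (mod n)" for x n :: int by simp
  have "bij_betw (\<lambda>x. (x mod a, x mod b)) (roots_mod f (a * b)) (roots_mod f a \<times> roots_mod f b)"
  proof (rule bij_betw_imageI)
    show "inj_on (\<lambda>x. (x mod a, x mod b)) (roots_mod f (a * b))"
    proof (rule inj_onI)
      fix x y assume x: "x \<in> roots_mod f (a * b)" and y: "y \<in> roots_mod f (a * b)"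
        and "(x mod a, x mod b) = (y mod a, y mod b)"
      then have "[x = y] (mod a)" "[x = y] (mod b)" by (auto simp: cong_def)
      then have "[x = y] (mod a * b)" using \<open>coprime a b\<close> by (rule coprime_cong_mult)
      then show "x = y" using x y by (auto simp: roots_mod_def cong_def)
    qed
    show "(\<lambda>x. (x mod a, x mod b)) ` roots_mod f (a * b) = roots_mod f a \<times> roots_mod f b"
    proof (intro equalityI subsetI)
      fix z assume "z \<in> (\<lambda>x. (x mod a, x mod b)) ` roots_mod f (a * b)"
      then obtain x where x: "x \<in> roots_mod f (a * b)" and z: "z = (x mod a, x mod b)" by blast
      have "a dvd f x" "b dvd f x" using x by (auto simp: roots_mod_def dest: dvd_mult_left dvd_mult_right)
      then have "a dvd f (x mod a)" "b dvd f (x mod b)" using f_dvd[OF modc] by blast+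
      then show "z \<in> roots_mod f a \<times> roots_mod f b"
        using \<open>a > 0\<close> \<open>b > 0\<close> by (simp add: z roots_mod_def)
    next
      fix z assume "z \<in> roots_mod f a \<times> roots_mod f b"
      then obtain y w where z: "z = (y, w)" and y: "y \<in> roots_mod f a" and w: "w \<in> roots_mod f b" by blast
      obtain x where x: "[x = y] (mod a)" "[x = w] (mod b)"
        using binary_chinese_remainder_int[OF \<open>coprime a b\<close>] by blast
      let ?x = "x mod (a * b)"
      have x': "[?x = y] (mod a)" "[?x = w] (mod b)"
        using x by (auto simp: cong_def mod_mod_cancel)
      have "a dvd f ?x" "b dvd f ?x"
        using f_dvd[OF x'(1)] f_dvd[OF x'(2)] y w by (auto simp: roots_mod_def)
      then have "a * b dvd f ?x" using \<open>coprime a b\<close> by (rule divides_mult)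
      then have "?x \<in> roots_mod f (a * b)" using \<open>a > 0\<close> \<open>b > 0\<close> by (simp add: roots_mod_def)
      moreover have "z = (?x mod a, ?x mod b)"
        using x' y w by (auto simp: z roots_mod_def cong_def)
      ultimately show "z \<in> (\<lambda>x. (x mod a, x mod b)) ` roots_mod f (a * b)" by blast
    qed
  qed
  then show ?thesis by (simp add: bij_betw_same_card card_cartesian_product)
qed

lemma card_roots_mod_prime_factors:
  assumes f: "\<And>x y n. [x = y] (mod n) \<Longrightarrow> [f x = f y] (mod n)" and "v > 0"
  shows "card (roots_mod f (int v)) = (\<Prod>p\<in>prime_factors v. card (roots_mod f (int p ^ multiplicity p v)))"
proof -
  have "card (roots_mod f (int (\<Prod>p\<in>S. p ^ multiplicity p v)))
      = (\<Prod>p\<in>S. card (roots_mod f (int p ^ multiplicity p v)))"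
    if "finite S" "S \<subseteq> prime_factors v" for S
    using that
  proof (induction S rule: finite_induct)
    case empty
    have "roots_mod f 1 = {0}" by (auto simp: roots_mod_def)
    then show ?case by simp
  next
    case (insert p S)
    have p: "prime p" using insert.prems by (auto dest: in_prime_factors_imp_prime)
    have "coprime p (\<Prod>q\<in>S. q ^ multiplicity q v)"
    proof (rule prod_coprime_right)
      fix q assume "q \<in> S"
      then have "prime q" "p \<noteq> q" using insert by (auto dest: in_prime_factors_imp_prime)
      then show "coprime p (q ^ multiplicity q v)" using p by (simp add: primes_coprime)
    qed
    then have cop: "coprime (int p ^ multiplicity p v) (int (\<Prod>q\<in>S. q ^ multiplicity q v))"
      by (simp del: of_nat_prod)
    have pos: "(\<Prod>q\<in>S. q ^ multiplicity q v) > 0"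
      using insert.prems by (intro prod_pos) (auto dest: in_prime_factors_imp_prime prime_gt_0_nat)
    have "card (roots_mod f (int (\<Prod>q\<in>insert p S. q ^ multiplicity q v)))
        = card (roots_mod f (int p ^ multiplicity p v * int (\<Prod>q\<in>S. q ^ multiplicity q v)))"
      using insert.hyps by simp
    also have "\<dots> = card (roots_mod f (int p ^ multiplicity p v)) * card (roots_mod f (int (\<Prod>q\<in>S. q ^ multiplicity q v)))"
      using p pos by (intro card_roots_mod_mult f cop) (auto simp: prime_gt_0_nat simp del: of_nat_prod)
    also have "\<dots> = (\<Prod>q\<in>insert p S. card (roots_mod f (int q ^ multiplicity q v)))"
      using insert by simp
    finally show ?case .
  qed
  from this[of "prime_factors v"] show ?thesis
    using prime_factorization_nat[OF \<open>v > 0\<close>] by simp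
qed

lemma card_roots_mod_two:
  assumes "m > 0" "m dvd f a" "m dvd f b" "\<not> [a = b] (mod m)"
    and f: "\<And>x y n. [x = y] (mod n) \<Longrightarrow> [f x = f y] (mod n)"
    and all: "\<And>x. m dvd f x \<Longrightarrow> [x = a] (mod m) \<or> [x = b] (mod m)"
  shows "card (roots_mod f m) = 2"
proof -
  have "m dvd f (x mod m) \<longleftrightarrow> m dvd f x" for x
    by (rule cong_dvd_iff[OF f]) simp
  then have "roots_mod f m = {a mod m, b mod m}"
    unfolding roots_mod_def using assms(1-3) all by (auto simp: cong_def) (metis mod_pos_pos_trivial)
  then show ?thesis using assms(4) by (simp add: cong_def)
qed

section \<open>The two quadratics modulo prime powers\<close>

abbreviation square_minus_one :: "int \<Rightarrow> int" where "square_minus_one \<equiv> \<lambda>x. x\<^sup>2 - 1"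
abbreviation cyclotomic3 :: "int \<Rightarrow> int" where "cyclotomic3 \<equiv> \<lambda>x. x\<^sup>2 + x + 1"

lemma cong_square_minus_one: "[x = y] (mod n) \<Longrightarrow> [square_minus_one x = square_minus_one y] (mod n)"
  by (intro cong_diff cong_pow cong_refl)

lemma cong_cyclotomic3: "[x = y] (mod n) \<Longrightarrow> [cyclotomic3 x = cyclotomic3 y] (mod n)"
  by (intro cong_add cong_pow cong_refl)

text \<open>One factor is prime to \<open>p\<close>, so the other absorbs the whole power. For both
  quadratics this takes the place of Hensel lifting.\<close>

lemma prime_power_dvd_one_factor:
  fixes p :: int
  assumes "prime p" "p ^ e dvd a * b" "\<not> (p dvd a \<and> p dvd b)"
  shows "p ^ e dvd a \<or> p ^ e dvd b"
proof -
  have "coprime (p ^ e) a \<or> coprime (p ^ e) b"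
    using assms(1,3) prime_imp_coprime[of p] by (auto intro!: coprime_power_left_iff[THEN iffD2])
  then show ?thesis using assms(2) by (auto simp: coprime_dvd_mult_left_iff coprime_dvd_mult_right_iff)
qed

lemma card_square_minus_one_odd:
  fixes p :: nat
  assumes "prime p" "odd p" "e > 0"
  shows "card (roots_mod square_minus_one (int p ^ e)) = 2"
proof (rule card_roots_mod_two[of _ _ 1 "-1"])
  have p: "prime (int p)" using assms by simp
  have p2: "int p > 2" using assms prime_ge_2_nat[of p] by (cases "p = 2") auto
  then have n2: "\<not> int p dvd 2" by (auto dest: zdvd_imp_le)
  show "int p ^ e > 0" using p2 by simp
  have "int p dvd int p ^ e" using \<open>e > 0\<close> by (simp add: dvd_power)
  then show "\<not> [1 = - 1] (mod int p ^ e)"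
    using n2 dvd_trans by (fastforce simp: cong_iff_dvd_diff)
  fix x assume "int p ^ e dvd x\<^sup>2 - 1"
  then have d: "int p ^ e dvd (x - 1) * (x + 1)" by (simp add: algebra_simps power2_eq_square)
  have "\<not> (int p dvd x - 1 \<and> int p dvd x + 1)"
    using n2 dvd_diff[of "int p" "x + 1" "x - 1"] by auto
  from prime_power_dvd_one_factor[OF p d this]
  show "[x = 1] (mod int p ^ e) \<or> [x = - 1] (mod int p ^ e)"
    by (simp add: cong_iff_dvd_diff)
qed (auto intro: cong_square_minus_one)

lemma card_square_minus_one_2: "card (roots_mod square_minus_one 2) = 1"
proof -
  have "{0..<2} = {0, 1::int}" by auto
  then have "roots_mod square_minus_one 2 = {1}" unfolding roots_mod_def by auto
  then show ?thesis by simp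
qed

lemma card_square_minus_one_4: "card (roots_mod square_minus_one 4) = 2"
proof -
  have "{0..<4} = {0, 1, 2, 3::int}" by auto
  then have "roots_mod square_minus_one 4 = {1, 3}" unfolding roots_mod_def by auto
  then show ?thesis by simp
qed

text \<open>Let \<open>h\<close> be half the modulus. For \<open>x = 2 * y + 1\<close> the product
  of \<open>x - 1\<close> and \<open>x + 1\<close> is \<open>4 * y * (y + 1)\<close>, where one of
  \<open>y\<close>, \<open>y + 1\<close> is odd, so \<open>h\<close> divides \<open>x - 1\<close> or
  \<open>x + 1\<close>. This leaves 1, \<open>h + 1\<close>, \<open>h - 1\<close> and
  \<open>2 * h - 1\<close>.\<close>

lemma card_square_minus_one_power_2:
  assumes "e \<ge> 3"
  shows "card (roots_mod square_minus_one (2 ^ e)) = 4"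
proof -
  define h :: int where "h = 2 ^ (e - 1)"
  have m: "2 ^ e = 2 * h" using assms unfolding h_def by (simp flip: power_Suc)
  have "(2::int) ^ 2 \<le> 2 ^ (e - 1)" using assms by (intro power_increasing) auto
  then have h4: "h \<ge> 4" by (simp add: h_def)
  have "even h" using assms by (simp add: h_def)
  have root: "2 * h dvd (h * k + c)\<^sup>2 - 1" if "c = 1 \<or> c = -1" for k c
  proof -
    obtain g where g: "h = 2 * g" using \<open>even h\<close> by blast
    \<comment> \<open>\<open>h * h\<close> equals \<open>2 * h * g\<close>, and
      \<open>c * c - 1\<close> vanishes.\<close>
    have "(h * k + c)\<^sup>2 - 1 = 2 * h * (g * k\<^sup>2 + k * c)"
      using that g by (auto simp: power2_eq_square algebra_simps)
    then show ?thesis by simp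
  qed
  have "roots_mod square_minus_one (2 * h) = {1, h + 1, h - 1, 2 * h - 1}"
  proof (intro equalityI subsetI)
    fix x assume "x \<in> {1, h + 1, h - 1, 2 * h - 1}"
    then show "x \<in> roots_mod square_minus_one (2 * h)"
      using root[of 1 0] root[of 1 1] root[of "-1" 1] root[of "-1" 2] h4
      by (auto simp: roots_mod_def mult.commute)
  next
    fix x assume "x \<in> roots_mod square_minus_one (2 * h)"
    then have x: "0 \<le> x" "x < 2 * h" and d: "2 * h dvd (x - 1) * (x + 1)"
      by (auto simp: roots_mod_def algebra_simps power2_eq_square)
    have "even ((x - 1) * (x + 1))" using d dvd_mult_left by blast
    then have "odd x" by auto
    then obtain y where y: "x = 2 * y + 1" by (rule oddE)
    have "(x - 1) * (x + 1) = 2 * (2 * y * (y + 1))" by (simp add: y algebra_simps)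
    then have d1: "h dvd 2 * y * (y + 1)" using d by (metis dvd_times_left_cancel_iff zero_neq_numeral)
    have odd_dvd: "h dvd c" if "odd a" "h dvd c * a" for a c
      using that unfolding h_def by (metis coprime_dvd_mult_left_iff coprime_left_2_iff_odd coprime_power_left_iff)
    have "h dvd x - 1 \<or> h dvd x + 1"
    proof (cases "odd y")
      case True
      then have "h dvd 2 * (y + 1)" using odd_dvd[of y "2 * (y + 1)"] d1 by (simp add: algebra_simps)
      then show ?thesis by (simp add: y algebra_simps)
    next
      case False
      then have "h dvd 2 * y" using odd_dvd[of "y + 1" "2 * y"] d1 by simp
      then show ?thesis by (simp add: y)
    qed
    then show "x \<in> {1, h + 1, h - 1, 2 * h - 1}"
    proof
      assume "h dvd x - 1"
      then obtain k where k: "x = h * k + 1" by (metis dvdE diff_add_cancel)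
      have "h * k < h * 2" "h * (-1) < h * k" using x k h4 by linarith+
      then have "k < 2" "-1 < k" using h4 by (simp_all only: mult_less_cancel_left_pos)
      then have "k = 0 \<or> k = 1" by auto
      then show ?thesis using k by auto
    next
      assume "h dvd x + 1"
      then obtain k where k: "x = h * k - 1" by (metis dvdE add_diff_cancel_right')
      have "h * k < h * 3" "h * 0 < h * k" using x k h4 by linarith+
      then have "k < 3" "0 < k" using h4 by (simp_all only: mult_less_cancel_left_pos)
      then have "k = 1 \<or> k = 2" by auto
      then show ?thesis using k by auto
    qed
  qed
  moreover have "card {1, h + 1, h - 1, 2 * h - 1} = 4" using h4 by auto
  ultimately show ?thesis by (simp add: m)
qed

lemma prime3: "prime (3::nat)"
  by simp

lemma card_cyclotomic3_3: "card (roots_mod cyclotomic3 3) = 1"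
proof -
  have "{0..<3} = {0, 1, 2::int}" by auto
  then have "roots_mod cyclotomic3 3 = {1}" unfolding roots_mod_def by auto
  then show ?thesis by simp
qed

text \<open>There is no root even modulo 9: a root would be 1 modulo 3, and then the value is 3
  modulo 9.\<close>

lemma card_cyclotomic3_power_3:
  assumes "e \<ge> 2"
  shows "card (roots_mod cyclotomic3 (3 ^ e)) = 0"
proof -
  have "\<not> 3 ^ e dvd x\<^sup>2 + x + 1" for x :: int
  proof
    assume "3 ^ e dvd x\<^sup>2 + x + 1"
    moreover have "(3::int) ^ 2 dvd 3 ^ e" using assms by (rule le_imp_power_dvd)
    ultimately have d9: "9 dvd x\<^sup>2 + x + 1" using dvd_trans by fastforce
    define y r where "y = x div 3" and "r = x mod 3"
    have x: "x = 3 * y + r" and r: "r = 0 \<or> r = 1 \<or> r = 2" unfolding y_def r_def by auto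
    from r show False
    proof (elim disjE)
      assume "r = 0"
      then have "x\<^sup>2 + x + 1 = 3 * (3 * y\<^sup>2 + y) + 1" by (simp add: x power2_eq_square)
      then show False using d9 by presburger
    next
      assume "r = 1"
      then have "x\<^sup>2 + x + 1 = 9 * (y\<^sup>2 + y) + 3" by (simp add: x power2_eq_square algebra_simps)
      then show False using d9 by presburger
    next
      assume "r = 2"
      then have "x\<^sup>2 + x + 1 = 3 * (3 * y\<^sup>2 + 5 * y + 2) + 1" by (simp add: x power2_eq_square algebra_simps)
      then show False using d9 by presburger
    qed
  qed
  then show ?thesis by (simp add: roots_mod_def)
qed

text \<open>A root satisfies \<open>x ^ 3 = 1\<close>. As \<open>p - 1\<close> is 1 modulo 3,
  Fermat's theorem turns this into \<open>x = 1\<close> modulo \<open>p\<close>, where the value of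
  the quadratic is 3; but \<open>p\<close> is not 3.\<close>

lemma card_cyclotomic3_prime_2_mod_3:
  fixes p :: nat
  assumes "prime p" "[p = 2] (mod 3)" "e > 0"
  shows "card (roots_mod cyclotomic3 (int p ^ e)) = 0"
proof -
  have "\<not> int p ^ e dvd x\<^sup>2 + x + 1" if "x \<ge> 0" for x
  proof
    assume "int p ^ e dvd x\<^sup>2 + x + 1"
    moreover have "int p dvd int p ^ e" using assms by (simp add: dvd_power)
    ultimately have d: "int p dvd x\<^sup>2 + x + 1" using dvd_trans by blast
    obtain n where n: "x = int n" using \<open>x \<ge> 0\<close> zero_le_imp_eq_int by blast
    obtain q where q: "p = 3 * q + 2" using assms(2)
      by (metis cong_def mod_div_decomp mod_less numeral_2_eq_2 numeral_3_eq_3 lessI mult.commute)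
    have "x ^ 3 - 1 = (x\<^sup>2 + x + 1) * (x - 1)"
      by (simp add: power2_eq_square power3_eq_cube algebra_simps)
    then have "int p dvd x ^ 3 - 1" using d by simp
    then have c3: "[x ^ 3 = 1] (mod int p)" by (simp add: cong_iff_dvd_diff)
    then have "[(x ^ 3) ^ q * x = 1 ^ q * x] (mod int p)" by (intro cong_mult cong_pow cong_refl)
    moreover have "x ^ (p - 1) = (x ^ 3) ^ q * x" unfolding q power_mult[symmetric] by simp
    ultimately have e1: "[x ^ (p - 1) = x] (mod int p)" by simp
    have "\<not> p dvd n"
    proof
      assume "p dvd n"
      then have "int p dvd x" by (simp add: n)
      then have "int p dvd (x\<^sup>2 + x + 1) - (x + 1) * x" using d by (intro dvd_diff dvd_mult)
      then have "int p dvd 1" by (simp add: power2_eq_square algebra_simps)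
      then show False using assms(1) by simp
    qed
    then have "[n ^ (p - 1) = 1] (mod p)" using assms(1) by (intro fermat_theorem)
    then have "[x ^ (p - 1) = 1] (mod int p)" unfolding n by (metis cong_int_iff of_nat_1 of_nat_power)
    then have "[x = 1] (mod int p)" using e1 cong_sym cong_trans by blast
    then have "int p dvd x - 1" by (simp add: cong_iff_dvd_diff)
    then have "int p dvd (x\<^sup>2 + x + 1) - (x + 2) * (x - 1)"
      using d by (metis dvd_diff dvd_mult)
    then have "int p dvd 3" by (simp add: power2_eq_square algebra_simps)
    then have "p dvd 3" by (metis int_dvd_int_iff of_nat_numeral)
    then have "p = 3" using assms(1) by (metis primes_dvd_imp_eq prime3)
    then show False using q by presburger
  qed
  then have "roots_mod cyclotomic3 (int p ^ e) = {}" by (auto simp: roots_mod_def)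
  then show ?thesis by simp
qed

text \<open>A power \<open>z\<close> of a primitive root, with exponent a third of the group order,
  satisfies \<open>z ^ 3 = 1\<close> but is not 1. Since \<open>z - 1\<close> and
  \<open>z^2 + z + 1\<close> have no common factor except possibly 3, the latter takes all of
  \<open>p ^ e\<close>. The sum of the two roots is -1, so the other is
  \<open>- 1 - z\<close>.\<close>

lemma card_cyclotomic3_prime_1_mod_3:
  fixes p :: nat
  assumes "prime p" "[p = 1] (mod 3)" "e > 0"
  shows "card (roots_mod cyclotomic3 (int p ^ e)) = 2"
proof -
  have p: "prime (int p)" using assms by simp
  have "p \<noteq> 2" "p \<noteq> 3" using assms(2) by (auto simp: cong_def)
  then have "odd p" using assms(1) primes_dvd_imp_eq two_is_prime_nat by blast
  have n3: "\<not> int p dvd 3"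
  proof
    assume "int p dvd 3"
    then have "p dvd 3" by (metis int_dvd_int_iff of_nat_numeral)
    then show False using assms(1) \<open>p \<noteq> 3\<close> by (metis primes_dvd_imp_eq prime3)
  qed
  have pe: "int p dvd int p ^ e" using assms by (simp add: dvd_power)
  have "\<exists>z. int p ^ e dvd z\<^sup>2 + z + 1"
  proof -
    obtain g where "\<forall>k>0. residue_primroot (p ^ k) g"
      using residue_primroot_odd_prime_power_exists[OF assms(1) \<open>odd p\<close>] by blast
    then have g: "ord (p ^ e) g = totient (p ^ e)" using \<open>e > 0\<close> by (simp add: residue_primroot_def)
    have tot: "totient (p ^ e) = p ^ (e - 1) * (p - 1)"
      using assms by (simp add: totient_prime_power)
    have "3 dvd p - 1" using assms(2) prime_gt_0_nat[OF assms(1)]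
      by (metis cong_altdef_nat cong_sym less_eq_Suc_le One_nat_def cong_to_1_nat)
    then obtain t where t: "totient (p ^ e) = 3 * t" unfolding tot by (metis dvdE dvd_mult)
    have "totient (p ^ e) > 0" using assms(1) by (simp add: prime_gt_0_nat)
    then have "0 < t" "t < totient (p ^ e)" using t by auto
    define z where "z = int (g ^ t)"
    have "[(g ^ t) ^ 3 = 1] (mod p ^ e)"
      unfolding power_mult[symmetric] ord_divides using g t by (simp add: mult.commute)
    then have z3: "int p ^ e dvd (z - 1) * (z\<^sup>2 + z + 1)"
    proof -
      assume "[(g ^ t) ^ 3 = 1] (mod p ^ e)"
      then have "[z ^ 3 = 1] (mod int p ^ e)" unfolding z_def
        by (metis cong_int_iff of_nat_1 of_nat_power)
      moreover have "z ^ 3 - 1 = (z - 1) * (z\<^sup>2 + z + 1)"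
        by (simp add: power2_eq_square power3_eq_cube algebra_simps)
      ultimately show ?thesis by (simp add: cong_iff_dvd_diff)
    qed
    have "\<not> [g ^ t = 1] (mod p ^ e)"
      unfolding ord_divides g using \<open>0 < t\<close> \<open>t < totient (p ^ e)\<close> by (auto dest: dvd_imp_le)
    then have z1: "\<not> int p ^ e dvd z - 1"
      unfolding z_def cong_iff_dvd_diff[symmetric] by (metis cong_int_iff of_nat_1 of_nat_power)
    have "\<not> (int p dvd z - 1 \<and> int p dvd z\<^sup>2 + z + 1)"
    proof
      assume *: "int p dvd z - 1 \<and> int p dvd z\<^sup>2 + z + 1"
      then have "int p dvd (z\<^sup>2 + z + 1) - (z + 2) * (z - 1)" by (metis dvd_diff dvd_mult)
      then have "int p dvd 3" by (simp add: power2_eq_square algebra_simps)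
      then show False using n3 by blast
    qed
    from prime_power_dvd_one_factor[OF p z3 this] z1 show ?thesis by blast
  qed
  then obtain z where z: "int p ^ e dvd z\<^sup>2 + z + 1" by blast
  have pz: "int p dvd z * z + z + 1" using z pe dvd_trans by (metis power2_eq_square)
  \<comment> \<open>The discriminant of the quadratic is -3, so \<open>z\<close> and
    \<open>- 1 - z\<close> differ already modulo \<open>p\<close>.\<close>
  have n2z: "\<not> int p dvd 2 * z + 1"
  proof
    assume "int p dvd 2 * z + 1"
    then have "int p dvd 4 * (z * z + z + 1) - (2 * z + 1) * (2 * z + 1)"
      using pz by (intro dvd_diff dvd_mult)
    then have "int p dvd 3" by (simp add: algebra_simps)
    then show False using n3 by blast
  qed
  show ?thesis
  proof (rule card_roots_mod_two[of _ _ z "- 1 - z"])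
    show "int p ^ e > 0" using assms(1) by (simp add: prime_gt_0_nat)
    show "int p ^ e dvd z\<^sup>2 + z + 1" by fact
    show "int p ^ e dvd (- 1 - z)\<^sup>2 + (- 1 - z) + 1" using z by (simp add: power2_eq_square algebra_simps)
    show "\<not> [z = - 1 - z] (mod int p ^ e)"
    proof
      assume "[z = - 1 - z] (mod int p ^ e)"
      then have "int p dvd z - (- 1 - z)" using pe dvd_trans by (auto simp: cong_iff_dvd_diff)
      then show False using n2z by (simp add: algebra_simps)
    qed
    fix x assume x: "int p ^ e dvd x\<^sup>2 + x + 1"
    have "(x\<^sup>2 + x + 1) - (z\<^sup>2 + z + 1) = (x - z) * (x - (- 1 - z))"
      by (simp add: power2_eq_square algebra_simps)
    then have d: "int p ^ e dvd (x - z) * (x - (- 1 - z))" using x z by (metis dvd_diff)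
    have "\<not> (int p dvd x - z \<and> int p dvd x - (- 1 - z))"
    proof
      assume "int p dvd x - z \<and> int p dvd x - (- 1 - z)"
      then have "int p dvd (x - (- 1 - z)) - (x - z)" by (metis dvd_diff)
      then show False using n2z by (simp add: algebra_simps)
    qed
    from prime_power_dvd_one_factor[OF p d this]
    show "[x = z] (mod int p ^ e) \<or> [x = - 1 - z] (mod int p ^ e)" by (simp add: cong_iff_dvd_diff)
  qed (rule cong_cyclotomic3)
qed

section \<open>Counting unimodular pairs\<close>

definition primitive_pairs :: "nat set \<Rightarrow> nat \<Rightarrow> (int \<times> int) set" where
  "primitive_pairs Q n = {(a, b). a \<in> {0..<int n} \<and> b \<in> {0..<int n} \<and>
     (\<forall>q\<in>Q. \<not> (int q dvd a \<and> int q dvd b))}"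

lemma finite_primitive_pairs [simp]: "finite (primitive_pairs Q n)"
  by (rule finite_subset[of _ "{0..<int n} \<times> {0..<int n}"]) (auto simp: primitive_pairs_def)

text \<open>For \<open>Q\<close> the set of all primes dividing \<open>n\<close> this is Jordan's
  totient \<open>J_2\<close>. The primes are added one at a time: the pairs spoiled by a new prime
  \<open>q\<close> are \<open>q\<close> times the pairs already primitive for \<open>Q\<close> below
  \<open>n div q\<close>, so the induction has to run over all \<open>n\<close>.\<close>

lemma card_primitive_pairs:
  assumes "finite Q" "\<And>q. q \<in> Q \<Longrightarrow> prime q" "\<And>q. q \<in> Q \<Longrightarrow> q dvd n"
  shows "real (card (primitive_pairs Q n)) = (real n)\<^sup>2 * (\<Prod>q\<in>Q. 1 - 1 / (real q)\<^sup>2)"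
  using assms
proof (induction Q arbitrary: n rule: finite_induct)
  case empty
  have "primitive_pairs {} n = {0..<int n} \<times> {0..<int n}" by (auto simp: primitive_pairs_def)
  then show ?case by (simp add: card_cartesian_product power2_eq_square)
next
  case (insert q Q)
  have q: "prime q" using insert.prems by simp
  then have q0: "q > 0" by (rule prime_gt_0_nat)
  obtain k where n: "n = q * k" using insert.prems(2) by (auto elim: dvdE)
  have cop: "coprime r q" if "r \<in> Q" for r
    using that insert q by (intro primes_coprime) auto
  have rk: "r dvd k" if "r \<in> Q" for r
    using insert.prems(2)[of r] that cop[OF that] n by (simp add: coprime_dvd_mult_right_iff)
  have rdvd: "int r dvd int q * a \<longleftrightarrow> int r dvd a" if "r \<in> Q" for r a
    using cop[OF that] by (intro coprime_dvd_mult_right_iff) simp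
  let ?B = "{(a, b) \<in> primitive_pairs Q n. int q dvd a \<and> int q dvd b}"
  have "?B = (\<lambda>(a, b). (int q * a, int q * b)) ` primitive_pairs Q k"
  proof (intro equalityI subsetI)
    fix z assume "z \<in> ?B"
    then obtain a b where z: "z = (int q * a, int q * b)" and "z \<in> primitive_pairs Q n"
      by (auto elim!: dvdE)
    then have "(a, b) \<in> primitive_pairs Q k"
      using q0 n rdvd by (auto simp: primitive_pairs_def zero_le_mult_iff)
    then show "z \<in> (\<lambda>(a, b). (int q * a, int q * b)) ` primitive_pairs Q k"
      using z by (intro image_eqI[of _ _ "(a, b)"]) auto
  next
    fix z assume "z \<in> (\<lambda>(a, b). (int q * a, int q * b)) ` primitive_pairs Q k"
    then show "z \<in> ?B" using q0 n rdvd by (auto simp: primitive_pairs_def)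
  qed
  moreover have "inj_on (\<lambda>(a, b). (int q * a, int q * b)) (primitive_pairs Q k)"
    using q0 by (auto simp: inj_on_def)
  ultimately have cB: "card ?B = card (primitive_pairs Q k)" by (simp add: card_image)
  have "primitive_pairs (insert q Q) n = primitive_pairs Q n - ?B"
    by (auto simp: primitive_pairs_def)
  moreover have "?B \<subseteq> primitive_pairs Q n" by auto
  ultimately have "real (card (primitive_pairs (insert q Q) n)) = real (card (primitive_pairs Q n)) - real (card ?B)"
    by (simp add: card_Diff_subset card_mono of_nat_diff finite_subset[OF _ finite_primitive_pairs])
  also have "\<dots> = (real n)\<^sup>2 * (\<Prod>q\<in>Q. 1 - 1 / (real q)\<^sup>2) - (real k)\<^sup>2 * (\<Prod>q\<in>Q. 1 - 1 / (real q)\<^sup>2)"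
    using insert.IH[of n] insert.IH[of k] insert.prems rk cB by simp
  also have "\<dots> = (real n)\<^sup>2 * (1 - 1 / (real q)\<^sup>2) * (\<Prod>q\<in>Q. 1 - 1 / (real q)\<^sup>2)"
    using q0 n by (simp add: field_simps power_mult_distrib)
  finally show ?case using insert.hyps by (simp add: mult.assoc)
qed

section \<open>Counting orbits of difference triples\<close>

text \<open>Burnside's lemma from closure, injectivity of left multiplication and the possibility of
  undoing each element on \<open>X\<close>. Left multiplication embeds the set \<open>N x y\<close>
  of elements taking \<open>x\<close> to \<open>y\<close> into \<open>N x (act h y)\<close>; this
  compares their sizes without cosets of stabilizers.\<close>

lemma orbit_counting:
  fixes act :: "'g \<Rightarrow> 'x \<Rightarrow> 'x" and mul :: "'g \<Rightarrow> 'g \<Rightarrow> 'g"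
  assumes fin: "finite G" "finite X" and ne: "G \<noteq> {}"
    and act: "\<And>g x. g \<in> G \<Longrightarrow> x \<in> X \<Longrightarrow> act g x \<in> X"
    and mul: "\<And>g h. g \<in> G \<Longrightarrow> h \<in> G \<Longrightarrow> mul g h \<in> G"
    and act_mul: "\<And>g h x. g \<in> G \<Longrightarrow> h \<in> G \<Longrightarrow> x \<in> X \<Longrightarrow> act (mul g h) x = act g (act h x)"
    and inj: "\<And>g. g \<in> G \<Longrightarrow> inj_on (mul g) G"
    and inv: "\<And>g. g \<in> G \<Longrightarrow> \<exists>h\<in>G. \<forall>x\<in>X. act h (act g x) = x"
  defines "R \<equiv> {(x, y). x \<in> X \<and> (\<exists>g\<in>G. y = act g x)}"
  shows "equiv X R" "card G * card (X // R) = (\<Sum>g\<in>G. card {x \<in> X. act g x = x})"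
proof -
  show eq: "equiv X R"
  proof (rule equivI)
    show "R \<subseteq> X \<times> X" unfolding R_def using act by auto
    show "refl_on X R"
    proof (rule refl_onI)
      fix x assume "x \<in> X"
      obtain g where g: "g \<in> G" using ne by blast
      obtain h where h: "h \<in> G" "act h (act g x) = x" using inv[OF g] \<open>x \<in> X\<close> by blast
      then have "x = act (mul h g) x" using act_mul g \<open>x \<in> X\<close> by simp
      then show "(x, x) \<in> R" unfolding R_def using mul h g \<open>x \<in> X\<close> by blast
    qed
    show "sym R"
    proof (rule symI)
      fix x y assume "(x, y) \<in> R"
      then obtain g where g: "g \<in> G" "y = act g x" "x \<in> X" unfolding R_def by blast
      then obtain h where "h \<in> G" "act h y = x" using inv by blast
      moreover have "y \<in> X" using act g by simp
      ultimately show "(y, x) \<in> R" unfolding R_def by auto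
    qed
    show "trans R"
    proof (rule transI)
      fix x y z assume "(x, y) \<in> R" "(y, z) \<in> R"
      then obtain g h where "x \<in> X" "g \<in> G" "y = act g x" "h \<in> G" "z = act h y" unfolding R_def by blast
      then have "z = act (mul h g) x" "mul h g \<in> G" using act_mul mul by auto
      then show "(x, z) \<in> R" unfolding R_def using \<open>x \<in> X\<close> by blast
    qed
  qed
  define N where "N x y = {g \<in> G. act g x = y}" for x y
  have finN: "finite (N x y)" for x y unfolding N_def using fin by simp
  have N_le: "card (N x y) \<le> card (N x z)" if "x \<in> X" "y \<in> X" "h \<in> G" "z = act h y" for x y z h
  proof (rule card_inj_on_le[of "mul h"])
    show "inj_on (mul h) (N x y)" using inj[OF that(3)] by (rule inj_on_subset) (auto simp: N_def)
    show "mul h ` N x y \<subseteq> N x z" unfolding N_def using mul act_mul that by auto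
  qed (rule finN)
  have stab: "card (N x x) = card (N x y)" if xh: "x \<in> X" "h \<in> G" "y = act h x" for x y h
  proof (rule antisym)
    show "card (N x x) \<le> card (N x y)" using N_le xh by blast
    obtain k where k: "k \<in> G" "x = act k y" using inv[OF xh(2)] xh by metis
    have "y \<in> X" using act[OF xh(2,1)] xh(3) by simp
    then show "card (N x y) \<le> card (N x x)" by (rule N_le[OF xh(1) _ k])
  qed
  \<comment> \<open>Each orbit contributes \<open>card G\<close>: for fixed \<open>x\<close> the
    sets \<open>N x y\<close>, with \<open>y\<close> in the orbit, partition \<open>G\<close> and
    have the size of the stabilizer.\<close>
  have orbit: "(\<Sum>x\<in>Y. card (N x x)) = card G" if Y: "Y \<in> X // R" for Y
  proof -
    have OX: "Y \<subseteq> X" using Y eq in_quotient_imp_subset by blast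
    then have finO: "finite Y" using fin finite_subset by blast
    have one: "card Y * card (N x x) = card G" if x: "x \<in> Y" for x
    proof -
      have "x \<in> X" using x OX by blast
      have Ox: "y \<in> Y \<longleftrightarrow> (x, y) \<in> R" for y using in_quotient_imp_in_rel[OF eq Y] x
        by (meson Y eq in_quotient_imp_closed insert_subset empty_subsetI)
      have "card G = card (\<Union>y\<in>Y. N x y)"
      proof -
        have "G = (\<Union>y\<in>Y. N x y)" using Ox \<open>x \<in> X\<close> unfolding N_def R_def by auto
        then show ?thesis by simp
      qed
      also have "\<dots> = (\<Sum>y\<in>Y. card (N x y))"
        using finO finN by (intro card_UN_disjoint) (auto simp: N_def)
      also have "\<dots> = (\<Sum>y\<in>Y. card (N x x))"
      proof (rule sum.cong[OF refl])
        fix y assume "y \<in> Y"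
        then obtain h where "h \<in> G" "y = act h x" using Ox unfolding R_def by blast
        then show "card (N x y) = card (N x x)" using stab[OF \<open>x \<in> X\<close>] by simp
      qed
      finally show ?thesis by simp
    qed
    obtain x0 where x0: "x0 \<in> Y" using Y eq in_quotient_imp_non_empty by blast
    have "card Y > 0" using x0 finO card_gt_0_iff by blast
    then have "card (N x x) = card (N x0 x0)" if "x \<in> Y" for x
      using one[OF that] one[OF x0] by (metis mult_cancel1 less_irrefl)
    then have "(\<Sum>x\<in>Y. card (N x x)) = card Y * card (N x0 x0)" by simp
    then show ?thesis using one[OF x0] by simp
  qed
  have "(\<Sum>g\<in>G. card {x \<in> X. act g x = x}) = (\<Sum>g\<in>G. \<Sum>x\<in>X. if act g x = x then 1 else 0)"
    using fin by (simp add: sum.If_cases Int_def)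
  also have "\<dots> = (\<Sum>x\<in>X. \<Sum>g\<in>G. if act g x = x then 1 else 0)" by (rule sum.swap)
  also have "\<dots> = (\<Sum>x\<in>X. card (N x x))"
    using fin by (simp add: sum.If_cases Int_def N_def)
  also have "\<dots> = (\<Sum>x\<in>\<Union>(X // R). card (N x x))" using Union_quotient[OF eq] by simp
  also have "\<dots> = (\<Sum>Y\<in>X // R. \<Sum>x\<in>Y. card (N x x))"
  proof (subst sum.Union_disjoint)
    show "\<forall>Y\<in>X // R. finite Y" using fin finite_subset in_quotient_imp_subset[OF eq] by blast
    show "\<forall>A\<in>X // R. \<forall>B\<in>X // R. A \<noteq> B \<longrightarrow> A \<inter> B = {}" using quotient_disj[OF eq] by blast
  qed simp
  also have "\<dots> = card G * card (X // R)" using orbit by simp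
  finally show "card G * card (X // R) = (\<Sum>g\<in>G. card {x \<in> X. act g x = x})" by simp
qed

text \<open>Reduced entries make congruent triples equal. By the last clause the entries generate
  the integers modulo \<open>m\<close>; as the sum vanishes, such a triple is a pair of residues
  that is unimodular modulo \<open>m\<close>.\<close>

definition difference_triples :: "int \<Rightarrow> (color \<Rightarrow> int) set" where
  "difference_triples m = {d. (\<forall>i. 0 \<le> d i \<and> d i < m) \<and> m dvd (\<Sum>i\<in>UNIV. d i) \<and>
     (\<forall>g. g dvd m \<longrightarrow> (\<forall>i. g dvd d i) \<longrightarrow> g dvd 1)}"

definition units_mod :: "int \<Rightarrow> int set" where
  "units_mod m = {u \<in> {0..<m}. coprime u m}"

fun symmetry :: "int \<Rightarrow> (color \<Rightarrow> color) \<times> int \<Rightarrow> (color \<Rightarrow> int) \<Rightarrow> color \<Rightarrow> int" where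
  "symmetry m (\<pi>, u) d = (\<lambda>i. (u * d (\<pi> i)) mod m)"

definition symmetry_group :: "int \<Rightarrow> ((color \<Rightarrow> color) \<times> int) set" where
  "symmetry_group m = {\<pi>. bij \<pi>} \<times> units_mod m"

definition triple_rel :: "int \<Rightarrow> ((color \<Rightarrow> int) \<times> (color \<Rightarrow> int)) set" where
  "triple_rel m = {(d, d'). d \<in> difference_triples m \<and> (\<exists>g\<in>symmetry_group m. d' = symmetry m g d)}"

lemma sum_color: "(\<Sum>i\<in>UNIV. f i) = f Red + f Green + f Blue"
  by (simp add: UNIV_color add.assoc)

lemma sum_color_distinct:
  fixes f :: "color \<Rightarrow> int"
  assumes "i \<noteq> j" "j \<noteq> k" "i \<noteq> k"
  shows "(\<Sum>i\<in>UNIV. f i) = f i + f j + f k"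
  using assms by (cases i; cases j; cases k) (auto simp: sum_color)

lemma color_exhaust_distinct:
  fixes i j k x :: color
  assumes "i \<noteq> j" "j \<noteq> k" "i \<noteq> k"
  shows "x = i \<or> x = j \<or> x = k"
  using assms by (cases i; cases j; cases k; cases x) auto

lemma finite_units_mod [simp]: "finite (units_mod m)"
  unfolding units_mod_def by (rule finite_subset[of _ "{0..<m}"]) auto

lemma coprime_cong_iff: "[a = b] (mod m) \<Longrightarrow> coprime a m \<longleftrightarrow> coprime b (m::int)"
  by (metis cong_imp_coprime cong_sym)

lemma units_mod_mod: "m > 0 \<Longrightarrow> coprime u m \<Longrightarrow> u mod m \<in> units_mod m"
  unfolding units_mod_def by (auto simp: coprime_cong_iff[of "u mod m" u m])

lemma card_units_mod:
  assumes "v > 1"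
  shows "card (units_mod (int v)) = totient v"
proof -
  have "units_mod (int v) = int ` totatives v"
  proof (intro equalityI subsetI)
    fix u assume u: "u \<in> units_mod (int v)"
    then obtain n where n: "u = int n" "n < v" "coprime n v"
      unfolding units_mod_def by (auto dest: zero_le_imp_eq_int)
    then have "n \<noteq> 0" using assms by (intro notI) auto
    then show "u \<in> int ` totatives v" using n by (auto simp: in_totatives_iff)
  next
    fix u assume "u \<in> int ` totatives v"
    then show "u \<in> units_mod (int v)"
      using totatives_less[OF _ assms] by (auto simp: units_mod_def in_totatives_iff)
  qed
  then show ?thesis by (simp add: card_image totient_def)
qed

lemma unit_mod_inverse:
  assumes "m > 0" "coprime u m"
  obtains w where "w \<in> units_mod m" "[u * w = 1] (mod m)"
proof -
  obtain w where w: "[u * w = 1] (mod m)" using cong_solve_coprime_int[OF assms(2)] by blast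
  have "coprime (u * w) m" using coprime_cong_iff[OF w] by simp
  then have "coprime w m" by simp
  moreover have "[u * (w mod m) = 1] (mod m)" using w by (simp add: cong_def mod_simps)
  ultimately show ?thesis using that units_mod_mod[OF assms(1)] by blast
qed

lemma coprime_dvd_cancel: "coprime u m \<Longrightarrow> m dvd u * x \<longleftrightarrow> m dvd (x::int)"
  by (simp add: coprime_commute coprime_dvd_mult_right_iff)

lemma dvd_mult_gcd:
  fixes a b c m :: int
  assumes "m dvd c * a" "m dvd c * b"
  shows "m dvd c * gcd a b"
proof -
  obtain x y where "x * a + y * b = gcd a b" using bezout_int by blast
  then have "c * gcd a b = x * (c * a) + y * (c * b)" by (metis distrib_left mult.left_commute)
  then show ?thesis using assms by simp
qed

context
  fixes m :: int
  assumes m_pos: "m > 0"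
begin

lemma finite_difference_triples: "finite (difference_triples m)"
proof -
  have "inj_on (\<lambda>d. (d Red, d Green, d Blue)) (difference_triples m)"
    by (auto simp: inj_on_def fun_eq_iff all_color)
  moreover have "(\<lambda>d. (d Red, d Green, d Blue)) ` difference_triples m \<subseteq> {0..<m} \<times> {0..<m} \<times> {0..<m}"
    by (auto simp: difference_triples_def)
  moreover have "finite ({0..<m} \<times> {0..<m} \<times> {0..<m})" by simp
  ultimately show ?thesis by (rule inj_on_finite)
qed

lemma triples_eq_iff:
  assumes "d \<in> difference_triples m" "d' \<in> difference_triples m"
  shows "d = d' \<longleftrightarrow> (\<forall>i. [d i = d' i] (mod m))"
  using assms by (auto simp: difference_triples_def cong_def fun_eq_iff)

text \<open>A primitive triple has trivial annihilator modulo \<open>m\<close>; in particular the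
  units act freely on triples.\<close>

lemma triple_cancel:
  assumes d: "d \<in> difference_triples m" and c: "\<And>i. m dvd c * d i"
  shows "m dvd c"
proof -
  let ?g = "gcd (gcd (gcd (d Red) (d Green)) (d Blue)) m"
  have "?g dvd d i" for i
    by (cases i) (meson dvd_trans gcd_dvd1 gcd_dvd2)+
  moreover have "?g dvd m" by simp
  ultimately have "?g dvd 1" using d unfolding difference_triples_def by blast
  then have "?g = 1" by simp
  moreover have "m dvd c * ?g" by (intro dvd_mult_gcd c) simp
  ultimately show ?thesis by simp
qed

lemma symmetry_closed:
  assumes g: "g \<in> symmetry_group m" and d: "d \<in> difference_triples m"
  shows "symmetry m g d \<in> difference_triples m"
proof -
  obtain \<pi> u where [simp]: "g = (\<pi>, u)" and \<pi>: "bij \<pi>" and u: "coprime u m"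
    using g unfolding symmetry_group_def units_mod_def by auto
  have "(\<Sum>i\<in>UNIV. u * d (\<pi> i)) = u * (\<Sum>i\<in>UNIV. d i)"
    using \<pi> by (simp add: sum_distrib_left[symmetric] sum.reindex_bij_betw)
  then have "m dvd (\<Sum>i\<in>UNIV. u * d (\<pi> i))" using d unfolding difference_triples_def by simp
  then have "m dvd (\<Sum>i\<in>UNIV. (u * d (\<pi> i)) mod m)" by (simp add: dvd_eq_mod_eq_0 mod_sum_eq)
  moreover have "h dvd 1" if h: "h dvd m" "\<And>i. h dvd (u * d (\<pi> i)) mod m" for h
  proof -
    have "coprime u h" using u h(1) coprime_divisors dvd_refl by blast
    moreover have "h dvd u * d (\<pi> i)" for i using h by (simp add: dvd_mod_iff)
    ultimately have "h dvd d (\<pi> i)" for i using coprime_dvd_cancel by blast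
    then have "h dvd d i" for i using \<pi> by (metis bij_pointE)
    then show ?thesis using d h(1) unfolding difference_triples_def by blast
  qed
  ultimately show ?thesis using m_pos unfolding difference_triples_def by simp
qed

lemma symmetry_orbits:
  "equiv (difference_triples m) (triple_rel m)"
  "card (symmetry_group m) * card (difference_triples m // triple_rel m) =
    (\<Sum>g\<in>symmetry_group m. card {d \<in> difference_triples m. symmetry m g d = d})"
proof -
  \<comment> \<open>Permutations act by precomposition, so they compose in reverse order
    here.\<close>
  define mul where "mul g h = (fst h \<circ> fst g, (snd g * snd h) mod m)"
    for g h :: "(color \<Rightarrow> color) \<times> int"
  have fin: "finite (symmetry_group m)"
  proof -
    have "finite {\<pi> :: color \<Rightarrow> color. bij \<pi>}"
      using finite_permutations[of "UNIV :: color set"] by (simp add: permutes_univ bij_iff)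
    then show ?thesis unfolding symmetry_group_def by simp
  qed
  have "1 mod m \<in> units_mod m" using m_pos by (intro units_mod_mod) auto
  then have ne: "symmetry_group m \<noteq> {}" unfolding symmetry_group_def using bij_id by blast
  have mulG: "mul g h \<in> symmetry_group m" if "g \<in> symmetry_group m" "h \<in> symmetry_group m" for g h
    using that m_pos unfolding symmetry_group_def mul_def
    by (auto intro!: bij_comp units_mod_mod simp: units_mod_def)
  have act_mul: "symmetry m (mul g h) d = symmetry m g (symmetry m h d)" for g h d
    by (cases g; cases h) (simp add: mul_def mod_simps mult_ac)
  have inj: "inj_on (mul g) (symmetry_group m)" if g: "g \<in> symmetry_group m" for g
  proof (rule inj_onI)
    fix h k assume h: "h \<in> symmetry_group m" and k: "k \<in> symmetry_group m" and eq: "mul g h = mul g k"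
    have "surj (fst g)" using g unfolding symmetry_group_def bij_def by auto
    then have "fst h = fst k" using eq unfolding mul_def
      by (metis fun.map_comp fst_conv o_inv_distrib surj_iff comp_assoc comp_id)
    moreover have "[snd g * snd h = snd g * snd k] (mod m)" using eq by (simp add: mul_def cong_def)
    then have "[snd h = snd k] (mod m)"
      using g unfolding symmetry_group_def units_mod_def by (simp add: cong_mult_lcancel mem_Times_iff)
    then have "snd h = snd k"
      using h k unfolding symmetry_group_def units_mod_def by (auto simp: cong_def)
    ultimately show "h = k" by (simp add: prod_eq_iff)
  qed
  have inv: "\<exists>h\<in>symmetry_group m. \<forall>d\<in>difference_triples m. symmetry m h (symmetry m g d) = d"
    if g: "g \<in> symmetry_group m" for g
  proof -
    obtain \<pi> u where gp: "g = (\<pi>, u)" and \<pi>: "bij \<pi>" and u: "coprime u m"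
      using g unfolding symmetry_group_def units_mod_def by auto
    obtain w where w: "w \<in> units_mod m" "[u * w = 1] (mod m)" using unit_mod_inverse[OF m_pos u] by blast
    have h: "(inv_into UNIV \<pi>, w) \<in> symmetry_group m" using w \<pi> by (simp add: symmetry_group_def bij_imp_bij_inv)
    have "symmetry m (inv_into UNIV \<pi>, w) (symmetry m g d) = d" if d: "d \<in> difference_triples m" for d
    proof -
      have "[w * (u * d i mod m) mod m = d i] (mod m)" for i
      proof -
        have "[w * (u * d i mod m) mod m = u * w * d i] (mod m)" by (simp add: cong_def mod_simps mult_ac)
        also have "[u * w * d i = 1 * d i] (mod m)" using w(2) by (rule cong_scalar_right)
        finally show ?thesis by simp
      qed
      moreover have "\<pi> (inv_into UNIV \<pi> i) = i" for i using \<pi> by (simp add: bij_is_surj surj_f_inv_f)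
      ultimately show ?thesis
        using triples_eq_iff[OF symmetry_closed[OF h symmetry_closed[OF g d]] d] by (simp add: gp)
    qed
    then show ?thesis using h by blast
  qed
  show "equiv (difference_triples m) (triple_rel m)"
    "card (symmetry_group m) * card (difference_triples m // triple_rel m) =
    (\<Sum>g\<in>symmetry_group m. card {d \<in> difference_triples m. symmetry m g d = d})"
    unfolding triple_rel_def
    using orbit_counting[of "symmetry_group m" "difference_triples m" "symmetry m" mul,
        OF fin finite_difference_triples ne symmetry_closed mulG act_mul inj inv] by blast+
qed

end

section \<open>Fixed points of the six color permutations\<close>

lemma bijective_colorings:
  "{\<pi> :: color \<Rightarrow> color. bij \<pi>} =
     {case_color Red Green Blue, case_color Green Red Blue, case_color Blue Green Red,
      case_color Red Blue Green, case_color Green Blue Red, case_color Blue Red Green}"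
proof (intro equalityI subsetI)
  fix \<pi> :: "color \<Rightarrow> color" assume "\<pi> \<in> {\<pi>. bij \<pi>}"
  then have inj: "inj \<pi>" by (simp add: bij_def)
  have eq: "\<pi> = case_color (\<pi> Red) (\<pi> Green) (\<pi> Blue)"
    by (rule ext) (simp split: color.split)
  have "\<pi> Red \<noteq> \<pi> Green" "\<pi> Red \<noteq> \<pi> Blue" "\<pi> Green \<noteq> \<pi> Blue"
    using injD[OF inj] by blast+
  then show "\<pi> \<in> {case_color Red Green Blue, case_color Green Red Blue, case_color Blue Green Red,
      case_color Red Blue Green, case_color Green Blue Red, case_color Blue Red Green}"
    by (subst eq, cases "\<pi> Red"; cases "\<pi> Green"; cases "\<pi> Blue") auto
next
  fix \<pi> :: "color \<Rightarrow> color"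
  assume "\<pi> \<in> {case_color Red Green Blue, case_color Green Red Blue, case_color Blue Green Red,
      case_color Red Blue Green, case_color Green Blue Red, case_color Blue Red Green}"
  then have "inj \<pi>" unfolding inj_def all_color by auto
  then show "\<pi> \<in> {\<pi>. bij \<pi>}" using finite_UNIV_inj_surj[of \<pi>] by (simp add: bij_def)
qed

lemma sum_bijective_colorings:
  fixes F :: "(color \<Rightarrow> color) \<Rightarrow> nat"
  shows "(\<Sum>\<pi> | bij \<pi>. F \<pi>) =
     F (case_color Red Green Blue) + F (case_color Green Red Blue) + F (case_color Blue Green Red) +
     F (case_color Red Blue Green) + F (case_color Green Blue Red) + F (case_color Blue Red Green)"
  unfolding bijective_colorings by (simp add: fun_eq_iff all_color)

lemma card_bijective_colorings: "card {\<pi> :: color \<Rightarrow> color. bij \<pi>} = 6"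
  unfolding bijective_colorings by (simp add: fun_eq_iff all_color)

context
  fixes m :: int
  assumes m_gt1: "m > 1"
begin

lemma m_pos: "m > 0" using m_gt1 by simp

lemma fixed_iff:
  assumes "d \<in> difference_triples m"
  shows "symmetry m (\<pi>, u) d = d \<longleftrightarrow> (\<forall>i. [u * d (\<pi> i) = d i] (mod m))"
  using assms by (auto simp: difference_triples_def cong_def fun_eq_iff)

lemma triple_unit:
  assumes d: "d \<in> difference_triples m" and i: "\<And>g j. g dvd m \<Longrightarrow> g dvd d i \<Longrightarrow> g dvd d j"
  shows "d i \<in> units_mod m"
proof -
  have "coprime (d i) m"
  proof (rule coprimeI)
    fix g assume "g dvd d i" "g dvd m"
    then show "g dvd 1" using d i unfolding difference_triples_def by blast
  qed
  then show ?thesis using d unfolding units_mod_def difference_triples_def by auto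
qed

lemma triple_from_unit:
  assumes ijk: "i \<noteq> j" "j \<noteq> k" "i \<noteq> k" and a: "a \<in> units_mod m"
  obtains d where "d \<in> difference_triples m" "d i = a" "[d j = b] (mod m)" "[d k = - a - b] (mod m)"
proof -
  define d where "d = (\<lambda>x. if x = i then a else if x = j then b mod m else (- a - b) mod m)"
  have a': "0 \<le> a" "a < m" "coprime a m" using a by (auto simp: units_mod_def)
  have d: "d i = a" "d j = b mod m" "d k = (- a - b) mod m" using ijk by (auto simp: d_def)
  have "[d i + d j + d k = a + b + (- a - b)] (mod m)"
    unfolding d by (intro cong_add) (auto simp: cong_def)
  then have "m dvd (\<Sum>x\<in>UNIV. d x)" unfolding sum_color_distinct[OF ijk] by (simp add: cong_0_iff)
  moreover have "g dvd 1" if "g dvd m" "\<forall>x. g dvd d x" for g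
    using that a'(3) d(1) by (metis coprime_common_divisor)
  moreover have "0 \<le> d x \<and> d x < m" for x using a' m_pos by (simp add: d_def)
  ultimately have "d \<in> difference_triples m" unfolding difference_triples_def by blast
  then show ?thesis using that[of d] d by (simp add: cong_def)
qed

lemma third_entry:
  assumes "d \<in> difference_triples m" "i \<noteq> j" "j \<noteq> k" "i \<noteq> k"
  shows "[d k = - d i - d j] (mod m)"
proof -
  have "m dvd d i + d j + d k"
    using assms(1) sum_color_distinct[OF assms(2-4), of d] unfolding difference_triples_def by simp
  then show ?thesis by (simp add: cong_iff_dvd_diff algebra_simps)
qed

lemma third_entry_dvd:
  assumes "d \<in> difference_triples m" "i \<noteq> j" "j \<noteq> k" "i \<noteq> k" "g dvd m" "g dvd d i" "g dvd d j"
  shows "g dvd d k"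
proof -
  have "[d k = - d i - d j] (mod g)" using third_entry[OF assms(1-4)] assms(5) cong_dvd_modulus by blast
  then show ?thesis using cong_dvd_iff assms(6,7) by (metis dvd_diff dvd_minus_iff)
qed

text \<open>Scaling by units is free, so only \<open>u = 1\<close> has fixed triples.\<close>

lemma fixed_identity:
  "(\<Sum>u\<in>units_mod m. card {d \<in> difference_triples m. symmetry m (case_color Red Green Blue, u) d = d})
     = card (difference_triples m)"
proof -
  have id: "case_color Red Green Blue = (\<lambda>x. x)" by (rule ext) (simp split: color.split)
  have one: "1 \<in> units_mod m" using m_gt1 by (simp add: units_mod_def)
  have "{d \<in> difference_triples m. symmetry m (\<lambda>x. x, u) d = d} = (if u = 1 then difference_triples m else {})"
    if u: "u \<in> units_mod m" for u
  proof (cases "u = 1")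
    case True
    then show ?thesis using fixed_iff[of _ "\<lambda>x. x" 1] by (auto simp del: symmetry.simps)
  next
    case False
    have "u = 1" if d: "d \<in> difference_triples m" and "symmetry m (\<lambda>x. x, u) d = d" for d
    proof -
      have "[u * d i = d i] (mod m)" for i using that fixed_iff[OF d, of "\<lambda>x. x"] by blast
      then have "m dvd (u - 1) * d i" for i by (simp add: cong_iff_dvd_diff algebra_simps)
      then have "m dvd u - 1" using triple_cancel[OF m_pos d] by blast
      then have "[u = 1] (mod m)" by (simp add: cong_iff_dvd_diff)
      then show "u = 1" using u one by (auto simp: units_mod_def cong_def)
    qed
    then show ?thesis using False by auto
  qed
  then have "(\<Sum>u\<in>units_mod m. card {d \<in> difference_triples m. symmetry m (case_color Red Green Blue, u) d = d})
    = (\<Sum>u\<in>units_mod m. if u = 1 then card (difference_triples m) else 0)"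
    unfolding id by (intro sum.cong) auto
  also have "\<dots> = card (difference_triples m)" using one by simp
  finally show ?thesis .
qed

text \<open>Transpositions and 3-cycles behave alike: a fixed triple has a unit entry
  \<open>d i\<close>, which together with \<open>u\<close> determines \<open>d j\<close>, and the
  zero sum determines \<open>d k\<close>. So the pairs of a multiplier and a triple fixed by it are
  parametrized freely by a unit and a root of \<open>f\<close>; the assumption on \<open>f\<close>
  makes every root an admissible multiplier.\<close>

lemma fixed_count:
  assumes ijk: "i \<noteq> j" "j \<noteq> k" "i \<noteq> k"
    and f: "\<And>u. m dvd f u \<Longrightarrow> coprime u m"
    and fixd: "\<And>u d. u \<in> units_mod m \<Longrightarrow> d \<in> difference_triples m \<Longrightarrow>
      (\<forall>x. [u * d (\<pi> x) = d x] (mod m)) \<longleftrightarrow>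
      d i \<in> units_mod m \<and> m dvd f u \<and> [d j = u * d i] (mod m)"
  shows "(\<Sum>u\<in>units_mod m. card {d \<in> difference_triples m. symmetry m (\<pi>, u) d = d})
     = card (units_mod m) * card (roots_mod f m)"
proof -
  let ?F = "\<lambda>u. {d \<in> difference_triples m. symmetry m (\<pi>, u) d = d}"
  have F: "d \<in> ?F u \<longleftrightarrow> d \<in> difference_triples m \<and> d i \<in> units_mod m \<and> m dvd f u \<and> [d j = u * d i] (mod m)"
    if "u \<in> units_mod m" for u d
    using fixd[OF that] fixed_iff by blast
  have "(\<Sum>u\<in>units_mod m. card (?F u)) = card (Sigma (units_mod m) ?F)"
    using finite_difference_triples[OF m_pos] by (simp add: card_SigmaI)
  moreover have "bij_betw (\<lambda>(u, d). (d i, u)) (Sigma (units_mod m) ?F) (units_mod m \<times> roots_mod f m)"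
  proof (rule bij_betw_imageI)
    show "inj_on (\<lambda>(u, d). (d i, u)) (Sigma (units_mod m) ?F)"
    proof (rule inj_onI)
      fix x y assume x: "x \<in> Sigma (units_mod m) ?F" and y: "y \<in> Sigma (units_mod m) ?F"
        and eq: "(case x of (u, d) \<Rightarrow> (d i, u)) = (case y of (u, d) \<Rightarrow> (d i, u))"
      obtain u d where x': "x = (u, d)" by fastforce
      obtain d' where y': "y = (u, d')" and i: "d i = d' i" using eq x' by (cases y) auto
      have u: "u \<in> units_mod m" and du: "d \<in> ?F u" "d' \<in> ?F u" using x y x' y' by auto
      have d: "d \<in> difference_triples m" "[d j = u * d i] (mod m)"
        and d': "d' \<in> difference_triples m" "[d' j = u * d i] (mod m)"
        using du i unfolding F[OF u] by auto
      have j: "[d j = d' j] (mod m)" using d(2) d'(2) cong_sym cong_trans by blast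
      have "[- d i - d j = - d' i - d' j] (mod m)" using i j by (simp add: cong_diff)
      then have "[d k = d' k] (mod m)"
        using third_entry[OF d(1) ijk] third_entry[OF d'(1) ijk] cong_sym cong_trans by blast
      then have "[d z = d' z] (mod m)" for z
        using i j color_exhaust_distinct[OF ijk, of z] by auto
      then have "d = d'" using triples_eq_iff[OF m_pos d(1) d'(1)] by blast
      then show "x = y" using x' y' by simp
    qed
    show "(\<lambda>(u, d). (d i, u)) ` (Sigma (units_mod m) ?F) = units_mod m \<times> roots_mod f m"
    proof (intro equalityI subsetI)
      fix z assume "z \<in> (\<lambda>(u, d). (d i, u)) ` (Sigma (units_mod m) ?F)"
      then obtain u d where z: "z = (d i, u)" and u: "u \<in> units_mod m" and "d \<in> ?F u" by auto
      then have "d i \<in> units_mod m" "m dvd f u" using F by blast+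
      then show "z \<in> units_mod m \<times> roots_mod f m" using u by (simp add: z roots_mod_def units_mod_def)
    next
      fix z assume "z \<in> units_mod m \<times> roots_mod f m"
      then obtain a u where z: "z = (a, u)" and a: "a \<in> units_mod m" and r: "u \<in> roots_mod f m" by blast
      then have u: "u \<in> units_mod m" "m dvd f u" using f by (auto simp: roots_mod_def units_mod_def)
      obtain d where d: "d \<in> difference_triples m" "d i = a" "[d j = u * a] (mod m)"
        using triple_from_unit[OF ijk a, of "u * a"] by blast
      then have "d \<in> ?F u" unfolding F[OF u(1)] using u a by auto
      then show "z \<in> (\<lambda>(u, d). (d i, u)) ` (Sigma (units_mod m) ?F)"
        using u(1) d(2) by (intro image_eqI[of _ _ "(u, d)"]) (auto simp: z)
    qed
  qed
  then have "card (Sigma (units_mod m) ?F) = card (units_mod m) * card (roots_mod f m)"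
    by (simp add: bij_betw_same_card card_cartesian_product)
  ultimately show ?thesis by simp
qed

text \<open>A common divisor of \<open>d i\<close> and \<open>m\<close> passes to
  \<open>d j = u * d i\<close> and by the zero sum to \<open>d k\<close>, so \<open>d i\<close> is a
  unit and applying the swap twice gives \<open>u^2 = 1\<close>. Conversely the equation at the
  fixed color \<open>k\<close> follows from the other two by the zero sum.\<close>

lemma fixed_transposition:
  assumes ijk: "i \<noteq> j" "j \<noteq> k" "i \<noteq> k" and \<pi>: "\<pi> i = j" "\<pi> j = i" "\<pi> k = k"
  shows "(\<Sum>u\<in>units_mod m. card {d \<in> difference_triples m. symmetry m (\<pi>, u) d = d})
     = card (units_mod m) * card (roots_mod square_minus_one m)"
proof (rule fixed_count[OF ijk])
  fix u assume "m dvd u\<^sup>2 - 1"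
  then have "[u * u = 1] (mod m)" by (simp add: cong_iff_dvd_diff power2_eq_square)
  from coprime_cong_iff[OF this] have "coprime (u * u) m" by simp
  then show "coprime u m" by simp
next
  fix u d assume u: "u \<in> units_mod m" and d: "d \<in> difference_triples m"
  have all: "(\<forall>x. P x) \<longleftrightarrow> P i \<and> P j \<and> P k" for P using color_exhaust_distinct[OF ijk] by metis
  have k: "m dvd d k + d i + d j" using third_entry[OF d ijk] by (simp add: cong_iff_dvd_diff algebra_simps)
  show "(\<forall>x. [u * d (\<pi> x) = d x] (mod m)) \<longleftrightarrow>
      d i \<in> units_mod m \<and> m dvd u\<^sup>2 - 1 \<and> [d j = u * d i] (mod m)"
    unfolding all \<pi>
  proof (intro iffI; elim conjE)
    assume e: "[u * d j = d i] (mod m)" "[u * d i = d j] (mod m)"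
    have unit: "d i \<in> units_mod m"
    proof (rule triple_unit[OF d])
      fix g x assume g: "g dvd m" "g dvd d i"
      have "[u * d i = d j] (mod g)" using e(2) g(1) cong_dvd_modulus by blast
      then have "g dvd d j" using g(2) by (metis cong_dvd_iff dvd_mult)
      then show "g dvd d x" using third_entry_dvd[OF d ijk g] g(2) color_exhaust_distinct[OF ijk, of x] by auto
    qed
    moreover have "d i * (u\<^sup>2 - 1) = u * (u * d i - d j) + (u * d j - d i)"
      by (simp add: power2_eq_square algebra_simps)
    then have "m dvd d i * (u\<^sup>2 - 1)"
      using e unfolding cong_iff_dvd_diff by (metis dvd_add dvd_mult)
    then have "m dvd u\<^sup>2 - 1" using unit coprime_dvd_cancel by (simp add: units_mod_def)
    ultimately show "d i \<in> units_mod m \<and> m dvd u\<^sup>2 - 1 \<and> [d j = u * d i] (mod m)"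
      using e cong_sym by blast
  next
    assume e: "m dvd u\<^sup>2 - 1" "[d j = u * d i] (mod m)"
    have e1: "m dvd u * u - 1" using e(1) by (simp add: power2_eq_square)
    have e2: "m dvd d j - u * d i" using e(2) by (simp add: cong_iff_dvd_diff)
    have "u * d j - d i = u * (d j - u * d i) + d i * (u * u - 1)"
      "u * d i - d j = - (d j - u * d i)"
      "u * d k - d k = (u - 1) * (d k + d i + d j) - (u - 1) * (d j - u * d i) - d i * (u * u - 1)"
      by (simp_all add: algebra_simps)
    then have "m dvd u * d j - d i" "m dvd u * d i - d j" "m dvd u * d k - d k"
      using e1 e2 k by (metis dvd_add dvd_diff dvd_mult dvd_minus_iff)+
    then show "[u * d j = d i] (mod m) \<and> [u * d i = d j] (mod m) \<and> [u * d k = d k] (mod m)"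
      by (simp add: cong_iff_dvd_diff)
  qed
qed

text \<open>The triple is \<open>d i\<close> times 1, \<open>u\<close>, \<open>u^2\<close>.
  Primitivity makes \<open>d i\<close> a unit, and the zero sum becomes
  \<open>u^2 + u + 1 = 0\<close>.\<close>

lemma fixed_three_cycle:
  assumes ijk: "i \<noteq> j" "j \<noteq> k" "i \<noteq> k" and \<pi>: "\<pi> j = i" "\<pi> k = j" "\<pi> i = k"
  shows "(\<Sum>u\<in>units_mod m. card {d \<in> difference_triples m. symmetry m (\<pi>, u) d = d})
     = card (units_mod m) * card (roots_mod cyclotomic3 m)"
proof (rule fixed_count[OF ijk])
  fix u assume "m dvd u\<^sup>2 + u + 1"
  \<comment> \<open>Modulo a divisor of \<open>u^2 + u + 1\<close>, the inverse of \<open>u\<close>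
    is \<open>- u - 1\<close>.\<close>
  moreover have "u * (- u - 1) - 1 = - (u\<^sup>2 + u + 1)" by (simp add: power2_eq_square algebra_simps)
  ultimately have "[u * (- u - 1) = 1] (mod m)" unfolding cong_iff_dvd_diff by (metis dvd_minus_iff)
  from coprime_cong_iff[OF this] have "coprime (u * (- u - 1)) m" by simp
  then show "coprime u m" by simp
next
  fix u d assume u: "u \<in> units_mod m" and d: "d \<in> difference_triples m"
  have all: "(\<forall>x. P x) \<longleftrightarrow> P i \<and> P j \<and> P k" for P using color_exhaust_distinct[OF ijk] by metis
  have k: "m dvd d k + d i + d j" using third_entry[OF d ijk] by (simp add: cong_iff_dvd_diff algebra_simps)
  show "(\<forall>x. [u * d (\<pi> x) = d x] (mod m)) \<longleftrightarrow>
      d i \<in> units_mod m \<and> m dvd u\<^sup>2 + u + 1 \<and> [d j = u * d i] (mod m)"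
    unfolding all \<pi>
  proof (intro iffI; elim conjE)
    assume e: "[u * d k = d i] (mod m)" "[u * d i = d j] (mod m)" "[u * d j = d k] (mod m)"
    have unit: "d i \<in> units_mod m"
    proof (rule triple_unit[OF d])
      fix g x assume g: "g dvd m" "g dvd d i"
      have "[u * d i = d j] (mod g)" using e(2) g(1) cong_dvd_modulus by blast
      then have "g dvd d j" using g(2) by (metis cong_dvd_iff dvd_mult)
      then show "g dvd d x" using third_entry_dvd[OF d ijk g] g(2) color_exhaust_distinct[OF ijk, of x] by auto
    qed
    moreover have "d i * (u\<^sup>2 + u + 1) =
        u * (u * d i - d j) + (u * d j - d k) + (u * d i - d j) + (d k + d i + d j)"
      by (simp add: power2_eq_square algebra_simps)
    then have "m dvd d i * (u\<^sup>2 + u + 1)"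
      using e k unfolding cong_iff_dvd_diff by (metis dvd_add dvd_mult)
    then have "m dvd u\<^sup>2 + u + 1" using unit coprime_dvd_cancel by (simp add: units_mod_def)
    ultimately show "d i \<in> units_mod m \<and> m dvd u\<^sup>2 + u + 1 \<and> [d j = u * d i] (mod m)"
      using e cong_sym by blast
  next
    assume e: "m dvd u\<^sup>2 + u + 1" "[d j = u * d i] (mod m)"
    have e1: "m dvd u * u + u + 1" using e(1) by (simp add: power2_eq_square)
    have e2: "m dvd d j - u * d i" using e(2) by (simp add: cong_iff_dvd_diff)
    have "u * d k - d i = u * (d k + d i + d j) - u * (d j - u * d i) - d i * (u * u + u + 1)"
      "u * d i - d j = - (d j - u * d i)"
      "u * d j - d k = (u + 1) * (d j - u * d i) + d i * (u * u + u + 1) - (d k + d i + d j)"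
      by (simp_all add: algebra_simps)
    then have "m dvd u * d k - d i" "m dvd u * d i - d j" "m dvd u * d j - d k"
      using e1 e2 k by (metis dvd_add dvd_diff dvd_mult dvd_minus_iff)+
    then show "[u * d k = d i] (mod m) \<and> [u * d i = d j] (mod m) \<and> [u * d j = d k] (mod m)"
      by (simp add: cong_iff_dvd_diff)
  qed
qed

lemma card_triple_classes:
  "6 * card (units_mod m) * card (difference_triples m // triple_rel m) =
     card (difference_triples m) + 3 * (card (units_mod m) * card (roots_mod square_minus_one m))
       + 2 * (card (units_mod m) * card (roots_mod cyclotomic3 m))"
proof -
  have "6 * card (units_mod m) * card (difference_triples m // triple_rel m) =
      card (symmetry_group m) * card (difference_triples m // triple_rel m)"
    by (simp add: symmetry_group_def card_cartesian_product card_bijective_colorings)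
  also have "\<dots> = (\<Sum>g\<in>symmetry_group m. card {d \<in> difference_triples m. symmetry m g d = d})"
    by (rule symmetry_orbits(2)[OF m_pos])
  also have "\<dots> = (\<Sum>\<pi> | bij \<pi>. \<Sum>u\<in>units_mod m. card {d \<in> difference_triples m. symmetry m (\<pi>, u) d = d})"
    unfolding symmetry_group_def by (simp add: sum.cartesian_product split_def del: symmetry.simps)
  also have "\<dots> = card (difference_triples m) + 3 * (card (units_mod m) * card (roots_mod square_minus_one m))
       + 2 * (card (units_mod m) * card (roots_mod cyclotomic3 m))"
  proof -
    let ?S = "\<lambda>\<pi>. \<Sum>u\<in>units_mod m. card {d \<in> difference_triples m. symmetry m (\<pi>, u) d = d}"
    let ?A = "card (units_mod m) * card (roots_mod square_minus_one m)"
    let ?B = "card (units_mod m) * card (roots_mod cyclotomic3 m)"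
    have "?S (case_color Green Red Blue) = ?A"
      by (rule fixed_transposition[of Red Green Blue]) simp_all
    moreover have "?S (case_color Blue Green Red) = ?A"
      by (rule fixed_transposition[of Red Blue Green]) simp_all
    moreover have "?S (case_color Red Blue Green) = ?A"
      by (rule fixed_transposition[of Green Blue Red]) simp_all
    moreover have "?S (case_color Green Blue Red) = ?B"
      by (rule fixed_three_cycle[of Red Blue Green]) simp_all
    moreover have "?S (case_color Blue Red Green) = ?B"
      by (rule fixed_three_cycle[of Red Green Blue]) simp_all
    ultimately show ?thesis
      unfolding sum_bijective_colorings fixed_identity by presburger
  qed
  finally show ?thesis .
qed

end

section \<open>Evaluation of the fixed-point sums\<close>

lemma card_difference_triples:
  assumes "v > 1"
  shows "real (card (difference_triples (int v))) = (real v)\<^sup>2 * (\<Prod>p\<in>prime_factors v. 1 - 1 / (real p)\<^sup>2)"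
proof -
  let ?m = "int v"
  have v0: "?m > 0" using assms by simp
  \<comment> \<open>The zero sum determines the third entry and passes on to it every common divisor
    of the other two and \<open>m\<close>. A divisor that is not a unit contains a prime, so testing
    primes is enough.\<close>
  have "bij_betw (\<lambda>d. (d Red, d Green)) (difference_triples ?m) (primitive_pairs (prime_factors v) v)"
  proof (rule bij_betw_imageI)
    show "inj_on (\<lambda>d. (d Red, d Green)) (difference_triples ?m)"
    proof (rule inj_onI)
      fix d d' assume d: "d \<in> difference_triples ?m" and d': "d' \<in> difference_triples ?m"
        and "(d Red, d Green) = (d' Red, d' Green)"
      then have eq: "d Red = d' Red" "d Green = d' Green" by auto
      have "[d Blue = d' Blue] (mod ?m)"
        using third_entry[of ?m d Red Green Blue] third_entry[of ?m d' Red Green Blue] assms d d' eq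
        by (simp add: cong_def)
      then show "d = d'" using triples_eq_iff[OF v0 d d'] eq by (simp add: all_color)
    qed
    show "(\<lambda>d. (d Red, d Green)) ` difference_triples ?m = primitive_pairs (prime_factors v) v"
    proof (intro equalityI subsetI)
      fix z assume "z \<in> (\<lambda>d. (d Red, d Green)) ` difference_triples ?m"
      then obtain d where d: "d \<in> difference_triples ?m" and z: "z = (d Red, d Green)" by blast
      have False if q: "q \<in> prime_factors v" and "int q dvd d Red" "int q dvd d Green" for q
      proof -
        have qm: "int q dvd ?m" using q by (simp add: in_prime_factors_imp_dvd)
        then have "int q dvd d Blue" using third_entry_dvd[of ?m d Red Green Blue "int q"] d that assms by simp
        then have "\<forall>i. int q dvd d i" using that by (simp add: all_color)
        then have "int q dvd 1" using d qm unfolding difference_triples_def by blast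
        then show False using q by (auto dest: in_prime_factors_imp_prime)
      qed
      then show "z \<in> primitive_pairs (prime_factors v) v"
        using d unfolding z primitive_pairs_def difference_triples_def by auto
    next
      fix z assume "z \<in> primitive_pairs (prime_factors v) v"
      then obtain a b where z: "z = (a, b)" and ab: "0 \<le> a" "a < ?m" "0 \<le> b" "b < ?m"
        and q: "\<And>q. q \<in> prime_factors v \<Longrightarrow> int q dvd a \<Longrightarrow> int q dvd b \<Longrightarrow> False"
        unfolding primitive_pairs_def by auto
      define d where "d = case_color a b ((- a - b) mod ?m)"
      have "[d Red + d Green + d Blue = a + b + (- a - b)] (mod ?m)"
        unfolding d_def by (simp add: cong_def mod_simps)
      then have "?m dvd (\<Sum>x\<in>UNIV. d x)" by (simp add: sum_color cong_0_iff)
      moreover have "g dvd 1" if g: "g dvd ?m" "\<forall>x. g dvd d x" for g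
      proof (rule ccontr)
        assume "\<not> g dvd 1"
        moreover have "g \<noteq> 0" using g(1) v0 by auto
        ultimately obtain p where p: "prime p" "p dvd g" using prime_divisor_exists[of g] by blast
        obtain n where n: "p = int n" using prime_ge_0_int[OF p(1)] zero_le_imp_eq_int by blast
        then have "prime n" using p(1) by simp
        have "int n dvd ?m" using p(2) g(1) n dvd_trans by blast
        then have "n \<in> prime_factors v" using \<open>prime n\<close> assms by (simp add: prime_factors_dvd)
        moreover have "int n dvd d x" for x using p(2) g(2) n dvd_trans by blast
        from this[of Red] this[of Green] have "int n dvd a" "int n dvd b" by (auto simp: d_def)
        ultimately show False using q by blast
      qed
      moreover have "0 \<le> d x \<and> d x < ?m" for x using ab v0 by (cases x) (auto simp: d_def)
      ultimately have "d \<in> difference_triples ?m" unfolding difference_triples_def by blast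
      moreover have "z = (d Red, d Green)" by (simp add: z d_def)
      ultimately show "z \<in> (\<lambda>d. (d Red, d Green)) ` difference_triples ?m" by blast
    qed
  qed
  then have "card (difference_triples ?m) = card (primitive_pairs (prime_factors v) v)"
    by (rule bij_betw_same_card)
  then show ?thesis
    using card_primitive_pairs[of "prime_factors v" v]
    by (simp add: in_prime_factors_imp_prime in_prime_factors_imp_dvd)
qed

text \<open>\<open>1 - 1 / p^2\<close> factors as \<open>(1 - 1 / p) * (1 + 1 / p)\<close>. The
  first factors make up \<open>totient v\<close>, which then cancels from Burnside's
  equation.\<close>

lemma real_card_triple_classes:
  assumes "v > 1"
  shows "real (card (difference_triples (int v) // triple_rel (int v))) =
    real v / 6 * (\<Prod>p\<in>prime_factors v. 1 + 1 / real p)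
      + real (card (roots_mod square_minus_one (int v))) / 2
      + real (card (roots_mod cyclotomic3 (int v))) / 3"
proof -
  let ?K = "real (card (difference_triples (int v) // triple_rel (int v)))"
  let ?A = "real (card (roots_mod square_minus_one (int v)))"
  let ?B = "real (card (roots_mod cyclotomic3 (int v)))"
  let ?P = "\<Prod>p\<in>prime_factors v. 1 + 1 / real p"
  have t: "totient v > 0" using assms by simp
  have "real (card (difference_triples (int v))) = real (totient v) * (real v * ?P)"
  proof -
    have "(\<Prod>p\<in>prime_factors v. 1 - 1 / (real p)\<^sup>2) = (\<Prod>p\<in>prime_factors v. (1 - 1 / real p) * (1 + 1 / real p))"
      by (intro prod.cong refl) (simp add: algebra_simps power2_eq_square)
    then show ?thesis
      unfolding card_difference_triples[OF assms] totient_formula2 by (simp add: prod.distrib power2_eq_square)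
  qed
  moreover have "6 * real (totient v) * ?K = real (card (difference_triples (int v))) + 3 * (real (totient v) * ?A) + 2 * (real (totient v) * ?B)"
    using arg_cong[OF card_triple_classes[of "int v"], of real] assms
    by (simp add: card_units_mod)
  ultimately have "real (totient v) * (6 * ?K) = real (totient v) * (real v * ?P + 3 * ?A + 2 * ?B)"
    by (simp add: algebra_simps)
  then have "6 * ?K = real v * ?P + 3 * ?A + 2 * ?B" using t by simp
  then show ?thesis by (simp add: field_simps)
qed

text \<open>An odd prime power has the two roots 1 and -1; the 2-part has 1, 2 or 4 roots according
  as it is 2, 4 or larger. Relative to the factor 2 allotted to each prime, and halved, these
  numbers are the values of \<open>beta\<close>.\<close>

lemma card_square_minus_one_roots:
  assumes "v > 1"
  shows "real (card (roots_mod square_minus_one (int v))) / 2 =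
    (if odd v then 1 / 2 else beta v) * 2 ^ card (prime_factors v)"
proof -
  have prod: "card (roots_mod square_minus_one (int v)) =
      (\<Prod>p\<in>prime_factors v. card (roots_mod square_minus_one (int p ^ multiplicity p v)))"
    using assms by (intro card_roots_mod_prime_factors cong_square_minus_one) auto
  have two: "card (roots_mod square_minus_one (int p ^ multiplicity p v)) = 2"
    if "p \<in> prime_factors v" "p \<noteq> 2" for p
  proof (rule card_square_minus_one_odd)
    show "prime p" using that by blast
    then show "odd p" using that(2) primes_dvd_imp_eq two_is_prime_nat by blast
    show "multiplicity p v > 0" using that by (simp add: prime_factors_multiplicity)
  qed
  show ?thesis
  proof (cases "odd v")
    case True
    then have "2 \<notin> prime_factors v" by (auto dest: in_prime_factors_imp_dvd)
    then have "card (roots_mod square_minus_one (int v)) = (\<Prod>p\<in>prime_factors v. 2)"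
      unfolding prod using two by (intro prod.cong) auto
    then show ?thesis using True by simp
  next
    case False
    then have in2: "2 \<in> prime_factors v" using assms by (simp add: prime_factors_dvd)
    define c where "c = card (roots_mod square_minus_one (2 ^ multiplicity 2 v))"
    have "card (roots_mod square_minus_one (int v)) = c *
        (\<Prod>p\<in>prime_factors v - {2}. card (roots_mod square_minus_one (int p ^ multiplicity p v)))"
      unfolding prod c_def using prod.remove[OF _ in2, of "\<lambda>p. card (roots_mod square_minus_one (int p ^ multiplicity p v))"] by simp
    also have "(\<Prod>p\<in>prime_factors v - {2}. card (roots_mod square_minus_one (int p ^ multiplicity p v)))
        = (\<Prod>p\<in>prime_factors v - {2}. 2)"
      using two by (intro prod.cong) auto
    also have "\<dots> = 2 ^ (card (prime_factors v) - 1)" using in2 by simp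
    finally have eq: "card (roots_mod square_minus_one (int v)) = c * 2 ^ (card (prime_factors v) - 1)" .
    have "card (prime_factors v) > 0" using in2 card_gt_0_iff by blast
    then have pow: "(2::real) ^ card (prime_factors v) = 2 * 2 ^ (card (prime_factors v) - 1)"
      by (simp flip: power_Suc)
    have dvd: "2 ^ n dvd v \<longleftrightarrow> n \<le> multiplicity 2 v" for n
      using assms by (intro power_dvd_iff_le_multiplicity) auto
    have d: "2 dvd v" "4 dvd v \<longleftrightarrow> 2 \<le> multiplicity 2 v" "8 dvd v \<longleftrightarrow> 3 \<le> multiplicity 2 v"
      using False dvd[of 2] dvd[of 3] by auto
    have m1: "1 \<le> multiplicity 2 v" using dvd[of 1] d(1) by simp
    have "real c / 4 = beta v"
    proof -
      consider "multiplicity 2 v = 1" | "multiplicity 2 v = 2" | "multiplicity 2 v \<ge> 3" using m1 by linarith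
      then show ?thesis
      proof cases
        case 1
        then have "\<not> 4 dvd v" using d by simp
        then have "v mod 8 = 2 \<or> v mod 8 = 6" using d(1) by presburger
        then show ?thesis using card_square_minus_one_2 1 by (auto simp: c_def beta_def cong_def)
      next
        case 2
        then have "4 dvd v" "\<not> 8 dvd v" using d by auto
        then have "v mod 8 = 4" by presburger
        then show ?thesis using card_square_minus_one_4 2 by (simp add: c_def beta_def cong_def)
      next
        case 3
        then have "8 dvd v" using d by simp
        then have "v mod 8 = 0" by simp
        then show ?thesis using card_square_minus_one_power_2[OF 3] by (simp add: c_def beta_def cong_def)
      qed
    qed
    then show ?thesis using False eq pow by simp
  qed
qed

text \<open>A prime 1 modulo 3 contributes two roots, a 3-part equal to 3 contributes one, and any
  prime 2 modulo 3 or a higher power of 3 leaves none. So the excess of \<open>alpha\<close> over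
  1/2 is 1/3, 1/6 or 0; for even \<open>v\<close> the prime 2 leaves no root.\<close>

lemma card_cyclotomic3_roots:
  assumes "v > 1"
  shows "real (card (roots_mod cyclotomic3 (int v))) / 3 =
    (if odd v then alpha v - 1 / 2 else 0) * 2 ^ card (prime_factors v)"
proof -
  let ?c = "\<lambda>p. card (roots_mod cyclotomic3 (int p ^ multiplicity p v))"
  have prod: "card (roots_mod cyclotomic3 (int v)) = (\<Prod>p\<in>prime_factors v. ?c p)"
    using assms by (intro card_roots_mod_prime_factors cong_cyclotomic3) auto
  have mult: "multiplicity p v > 0" "prime p" if "p \<in> prime_factors v" for p
    using that by (auto simp: prime_factors_multiplicity)
  have one: "?c p = 2" if "p \<in> prime_factors v" "[p = 1] (mod 3)" for p
    using card_cyclotomic3_prime_1_mod_3 mult that by blast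
  have two: "card (roots_mod cyclotomic3 (int v)) = 0" if "p \<in> prime_factors v" "[p = 2] (mod 3)" for p
    unfolding prod using card_cyclotomic3_prime_2_mod_3[of p "multiplicity p v"] mult[OF that(1)] that
    by (intro prod_zero) auto
  have cases3: "p = 3 \<or> [p = 1] (mod 3) \<or> [p = 2] (mod 3)" if "p \<in> prime_factors v" for p
  proof -
    have "p mod 3 = 0 \<or> p mod 3 = 1 \<or> p mod 3 = 2" by presburger
    moreover have "p = 3" if "p mod 3 = 0"
      using that mult(2)[OF \<open>p \<in> prime_factors v\<close>] primes_dvd_imp_eq[OF prime3, of p] by (simp add: dvd_eq_mod_eq_0)
    ultimately show ?thesis by (auto simp: cong_def)
  qed
  have three: "?c 3 = (if 3 ^ multiplicity 3 v = (3::nat) then 1 else 0)" if "3 \<in> prime_factors v"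
  proof (cases "multiplicity 3 v = 1")
    case True
    then show ?thesis using card_cyclotomic3_3 by simp
  next
    case False
    then have m2: "multiplicity 3 v \<ge> 2" using mult[OF that] by linarith
    then have "(3::nat) ^ 2 \<le> 3 ^ multiplicity 3 v" by (intro power_increasing) auto
    then have "3 ^ multiplicity 3 v \<noteq> (3::nat)" by simp
    then show ?thesis using card_cyclotomic3_power_3[OF m2] by simp
  qed
  show ?thesis
  proof (cases "odd v")
    case False
    then have "2 \<in> prime_factors v" using assms by (simp add: prime_factors_dvd)
    then show ?thesis using two[of 2] False by (simp add: cong_def)
  next
    case odd: True
    show ?thesis
    proof (cases "\<forall>p\<in>prime_factors v. [p = 1] (mod 3)")
      case True
      then have "card (roots_mod cyclotomic3 (int v)) = (\<Prod>p\<in>prime_factors v. 2)"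
        unfolding prod using one by (intro prod.cong) auto
      then show ?thesis using True odd by (simp add: alpha_def)
    next
      case not1: False
      show ?thesis
      proof (cases "3 ^ multiplicity 3 v = (3::nat) \<and> (\<forall>p\<in>prime_factors v - {3}. [p = 1] (mod 3))")
        case True
        then have in3: "3 \<in> prime_factors v" using not1 by blast
        have "card (roots_mod cyclotomic3 (int v)) = ?c 3 * (\<Prod>p\<in>prime_factors v - {3}. ?c p)"
          unfolding prod using prod.remove[OF _ in3, of ?c] by simp
        also have "(\<Prod>p\<in>prime_factors v - {3}. ?c p) = (\<Prod>p\<in>prime_factors v - {3}. 2)"
          using one True by (intro prod.cong) auto
        also have "\<dots> = 2 ^ (card (prime_factors v) - 1)" using in3 by simp
        finally have eq: "card (roots_mod cyclotomic3 (int v)) = 2 ^ (card (prime_factors v) - 1)"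
          using three[OF in3] True by simp
        have "card (prime_factors v) > 0" using in3 card_gt_0_iff by blast
        then have pow: "(2::real) ^ card (prime_factors v) = 2 * 2 ^ (card (prime_factors v) - 1)"
          by (simp flip: power_Suc)
        have "alpha v = 2 / 3" unfolding alpha_def using not1 True by simp
        then show ?thesis using odd eq pow by simp
      next
        case False
        have "alpha v = 1 / 2" unfolding alpha_def using not1 False by simp
        moreover have "card (roots_mod cyclotomic3 (int v)) = 0"
        proof (cases "\<exists>p\<in>prime_factors v. [p = 2] (mod 3)")
          case True
          then show ?thesis using two by blast
        next
          case no2: False
          then have rest: "\<forall>p\<in>prime_factors v - {3}. [p = 1] (mod 3)" using cases3 by blast
          then have in3: "3 \<in> prime_factors v" using not1 by blast
          then have "?c 3 = 0" using three False rest by simp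
          then have "\<exists>p\<in>prime_factors v. ?c p = 0" using in3 by (intro bexI[of _ 3]) simp_all
          then show ?thesis unfolding prod by (intro prod_zero) auto
        qed
        ultimately show ?thesis using odd by simp
      qed
    qed
  qed
qed

text \<open>For a zero-sum triple this makes the six residues \<open>d i\<close> and
  \<open>- d i\<close> distinct: \<open>d i = - d j\<close> with different colors forces the third
  entry to be 0, which the first clause excludes.\<close>

definition nondegenerate :: "int \<Rightarrow> (color \<Rightarrow> int) \<Rightarrow> bool" where
  "nondegenerate m d \<longleftrightarrow> (\<forall>i. \<not> m dvd 2 * d i) \<and> (\<forall>i j. i \<noteq> j \<longrightarrow> \<not> [d i = d j] (mod m))"

text \<open>An orbit invariant, evaluated on degenerate triples. There the value 2 stands for an
  entry of order two with no entry 0 and no two entries equal.\<close>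

definition degeneracy :: "(color \<Rightarrow> int) \<Rightarrow> nat" where
  "degeneracy d = (if \<exists>i. d i = 0 then 0 else if \<exists>i j. i \<noteq> j \<and> d i = d j then 1 else 2)"

lemma degeneracy_cases: "degeneracy d = 0 \<or> degeneracy d = 1 \<or> degeneracy d = 2"
  by (simp add: degeneracy_def)

lemma degeneracy_0D: "degeneracy d = 0 \<Longrightarrow> \<exists>i. d i = 0"
  by (simp add: degeneracy_def split: if_splits) blast+

lemma degeneracy_1D: "degeneracy d = 1 \<Longrightarrow> \<exists>i j. i \<noteq> j \<and> d i = d j"
  by (simp add: degeneracy_def split: if_splits) blast+

lemma degeneracy_2D: "degeneracy d = 2 \<Longrightarrow> d i \<noteq> 0 \<and> (i \<noteq> j \<longrightarrow> d i \<noteq> d j)"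
  by (simp add: degeneracy_def split: if_splits) blast+

text \<open>With \<open>f\<close> the map to equivalence classes, this counts a quotient by a
  complete invariant \<open>h\<close>, or by the classes of another relation.\<close>

lemma card_image_eq_of_kernel_eq:
  assumes "\<And>a b. a \<in> A \<Longrightarrow> b \<in> A \<Longrightarrow> f a = f b \<longleftrightarrow> h a = h b"
  shows "card (f ` A) = card (h ` A)"
proof (rule bij_betw_same_card)
  have inv: "inv_into A f y \<in> A" "f (inv_into A f y) = y" if "y \<in> f ` A" for y
    using that by (auto simp: inv_into_into f_inv_into_f)
  show "bij_betw (\<lambda>y. h (inv_into A f y)) (f ` A) (h ` A)"
  proof (rule bij_betw_imageI)
    show "inj_on (\<lambda>y. h (inv_into A f y)) (f ` A)"
    proof (rule inj_onI)
      fix y z assume yz: "y \<in> f ` A" "z \<in> f ` A" "h (inv_into A f y) = h (inv_into A f z)"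
      then have "f (inv_into A f y) = f (inv_into A f z)" using assms inv by blast
      then show "y = z" using inv yz by simp
    qed
    show "(\<lambda>y. h (inv_into A f y)) ` f ` A = h ` A"
    proof (intro equalityI subsetI)
      fix w assume "w \<in> h ` A"
      then obtain a where a: "a \<in> A" "w = h a" by blast
      then have "h (inv_into A f (f a)) = h a" using assms inv by blast
      then show "w \<in> (\<lambda>y. h (inv_into A f y)) ` f ` A" using a by force
    qed (use inv in auto)
  qed
qed

lemma quotient_image: "A // r = (\<lambda>x. r `` {x}) ` A"
  unfolding quotient_def by blast

section \<open>Classification of the degenerate orbits\<close>

context
  fixes m :: int
  assumes m_gt1: "m > 1"
begin

lemma triple_range: "d \<in> difference_triples m \<Longrightarrow> 0 \<le> d i \<and> d i < m"
  by (simp add: difference_triples_def)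

lemma triple_cong_iff: "d \<in> difference_triples m \<Longrightarrow> [d i = d j] (mod m) \<longleftrightarrow> d i = d j"
  using triple_range[of d i] triple_range[of d j] by (auto simp: cong_def)

lemma triple_dvd_iff: "d \<in> difference_triples m \<Longrightarrow> m dvd d i \<longleftrightarrow> d i = 0"
  using triple_range[of d i] by (auto dest: zdvd_imp_le)

lemma triple_rel_iff:
  assumes d: "d \<in> difference_triples m" and d': "d' \<in> difference_triples m"
  shows "(d, d') \<in> triple_rel m \<longleftrightarrow> (\<exists>u \<pi>. bij \<pi> \<and> (\<forall>i. [d' i = u * d (\<pi> i)] (mod m)))"
proof
  assume "(d, d') \<in> triple_rel m"
  then obtain \<pi> u where "bij \<pi>" "d' = symmetry m (\<pi>, u) d"
    unfolding triple_rel_def symmetry_group_def by auto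
  then show "\<exists>u \<pi>. bij \<pi> \<and> (\<forall>i. [d' i = u * d (\<pi> i)] (mod m))" by (auto simp: cong_def)
next
  assume "\<exists>u \<pi>. bij \<pi> \<and> (\<forall>i. [d' i = u * d (\<pi> i)] (mod m))"
  then obtain u \<pi> where \<pi>: "bij \<pi>" and u: "\<And>i. [d' i = u * d (\<pi> i)] (mod m)" by blast
  have "coprime u m"
  proof (rule coprimeI)
    fix g assume g: "g dvd u" "g dvd m"
    have "g dvd d' i" for i
      using cong_dvd_modulus[OF u[of i] g(2)] g(1) by (meson cong_dvd_iff dvd_mult2)
    then show "g dvd 1" using d' g(2) unfolding difference_triples_def by blast
  qed
  then have g: "(\<pi>, u mod m) \<in> symmetry_group m"
    unfolding symmetry_group_def using \<pi> units_mod_mod m_gt1 by simp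
  have "d' i = symmetry m (\<pi>, u mod m) d i" for i
    using u[of i] triple_range[OF d', of i] by (simp add: cong_def mod_simps)
  then have "d' = symmetry m (\<pi>, u mod m) d" by blast
  then show "(d, d') \<in> triple_rel m" unfolding triple_rel_def using d g by blast
qed

text \<open>Matching two entries suffices, since both third entries are determined by the zero
  sum.\<close>

lemma triple_relI:
  assumes d: "d \<in> difference_triples m" and d': "d' \<in> difference_triples m"
    and ijk: "i \<noteq> j" "j \<noteq> k" "i \<noteq> k" and ijk': "i' \<noteq> j'" "j' \<noteq> k'" "i' \<noteq> k'"
    and e: "[d' i' = u * d i] (mod m)" "[d' j' = u * d j] (mod m)"
  shows "(d, d') \<in> triple_rel m"
proof -
  define \<pi> where "\<pi> = (\<lambda>x. if x = i' then i else if x = j' then j else k)"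
  have \<pi>: "\<pi> i' = i" "\<pi> j' = j" "\<pi> k' = k" using ijk' by (auto simp: \<pi>_def)
  have "inj \<pi>" using ijk ijk' color_exhaust_distinct[OF ijk'] unfolding inj_def \<pi>_def by metis
  then have "bij \<pi>" using finite_UNIV_inj_surj[of \<pi>] by (simp add: bij_def)
  moreover have "[d' x = u * d (\<pi> x)] (mod m)" for x
  proof -
    have "[d k = - d i - d j] (mod m)" "[d' k' = - d' i' - d' j'] (mod m)"
      using third_entry[OF m_gt1 d ijk] third_entry[OF m_gt1 d' ijk'] by auto
    then have k: "m dvd d k + d i + d j" "m dvd d' k' + d' i' + d' j'" "m dvd d' i' - u * d i" "m dvd d' j' - u * d j"
      using e by (simp_all add: cong_iff_dvd_diff algebra_simps)
    have "d' k' - u * d k = (d' k' + d' i' + d' j') - u * (d k + d i + d j) - (d' i' - u * d i) - (d' j' - u * d j)"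
      by (simp add: algebra_simps)
    then have "[d' k' = u * d k] (mod m)" unfolding cong_iff_dvd_diff using k by (metis dvd_diff dvd_mult)
    then show ?thesis using e color_exhaust_distinct[OF ijk', of x] \<pi> by auto
  qed
  ultimately show ?thesis using triple_rel_iff[OF d d'] by blast
qed

lemma unit_multiple:
  assumes "coprime a m"
  obtains u where "[b = u * a] (mod m)"
proof -
  obtain w where w: "[a * w = 1] (mod m)" using cong_solve_coprime_int[OF assms] by blast
  then have "[b * (a * w) = b * 1] (mod m)" by (rule cong_scalar_left)
  then have "[b = (b * w) * a] (mod m)" by (simp add: cong_sym mult_ac)
  then show ?thesis using that by blast
qed

text \<open>The unit cancels from every divisibility and congruence, and what remains of a symmetry
  is a renaming of colors.\<close>

lemma symmetric_predicates:
  assumes dd: "(d, d') \<in> triple_rel m"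
  shows "(\<exists>i. d i = 0) \<longleftrightarrow> (\<exists>i. d' i = 0)"
    and "(\<exists>i j. i \<noteq> j \<and> d i = d j) \<longleftrightarrow> (\<exists>i j. i \<noteq> j \<and> d' i = d' j)"
    and "nondegenerate m d \<longleftrightarrow> nondegenerate m d'"
proof -
  have eqv: "equiv (difference_triples m) (triple_rel m)" using symmetry_orbits(1) m_gt1 by simp
  have d: "d \<in> difference_triples m" "d' \<in> difference_triples m"
    using dd eqv by (auto simp: equiv_def)
  obtain \<pi> u where \<pi>: "bij \<pi>" and cu: "coprime u m" and d': "d' = symmetry m (\<pi>, u) d"
    using dd unfolding triple_rel_def symmetry_group_def units_mod_def by auto
  have c: "[d' i = u * d (\<pi> i)] (mod m)" for i unfolding d' by (simp add: cong_def)
  have surj: "(\<exists>i. P (\<pi> i)) \<longleftrightarrow> (\<exists>i. P i)" for P using \<pi> by (metis bij_pointE)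
  have inj: "\<pi> i = \<pi> j \<longleftrightarrow> i = j" for i j using \<pi> by (simp add: bij_def inj_eq)
  have z: "m dvd a * d' i \<longleftrightarrow> m dvd a * d (\<pi> i)" for a i
  proof -
    have "m dvd a * d' i \<longleftrightarrow> m dvd a * (u * d (\<pi> i))" by (rule cong_dvd_iff) (intro cong_scalar_left c)
    also have "\<dots> \<longleftrightarrow> m dvd a * d (\<pi> i)" using coprime_dvd_cancel[OF cu, of "a * d (\<pi> i)"] by (simp add: mult_ac)
    finally show ?thesis .
  qed
  have e: "[d' i = d' j] (mod m) \<longleftrightarrow> [d (\<pi> i) = d (\<pi> j)] (mod m)" for i j
  proof -
    have "[d' i = d' j] (mod m) \<longleftrightarrow> [u * d (\<pi> i) = u * d (\<pi> j)] (mod m)"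
      using c[of i] c[of j] cong_sym cong_trans by meson
    then show ?thesis using cu by (simp add: cong_mult_lcancel)
  qed
  show "(\<exists>i. d i = 0) \<longleftrightarrow> (\<exists>i. d' i = 0)"
    using z[of 1] surj[of "\<lambda>i. d i = 0"] triple_dvd_iff[OF d(1)] triple_dvd_iff[OF d(2)] by simp
  have e': "d' i = d' j \<longleftrightarrow> d (\<pi> i) = d (\<pi> j)" for i j
    using e triple_cong_iff d by blast
  show "(\<exists>i j. i \<noteq> j \<and> d i = d j) \<longleftrightarrow> (\<exists>i j. i \<noteq> j \<and> d' i = d' j)"
    unfolding e' using \<pi> by (metis bij_pointE)
  show "nondegenerate m d \<longleftrightarrow> nondegenerate m d'"
    unfolding nondegenerate_def z e using \<pi> by (metis bij_pointE)
qed

lemma coprime_entry: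
  assumes d: "d \<in> difference_triples m" and ijk: "i \<noteq> j" "j \<noteq> k" "i \<noteq> k"
    and ij: "\<And>g. g dvd m \<Longrightarrow> g dvd d i \<Longrightarrow> g dvd d j"
  shows "coprime (d i) m"
proof -
  have "d i \<in> units_mod m"
  proof (rule triple_unit[OF m_gt1 d])
    fix g x assume g: "g dvd m" "g dvd d i"
    then show "g dvd d x"
      using third_entry_dvd[OF m_gt1 d ijk g] ij[OF g] color_exhaust_distinct[OF ijk, of x] by auto
  qed
  then show ?thesis by (simp add: units_mod_def)
qed

lemma zero_entry_shape:
  assumes d: "d \<in> difference_triples m" and z: "d i = 0"
  obtains j k where "i \<noteq> j" "j \<noteq> k" "i \<noteq> k" "coprime (d j) m"
proof -
  obtain j where "i \<noteq> j" by (cases i) auto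
  then obtain k where jk: "i \<noteq> j" "j \<noteq> k" "i \<noteq> k" by (cases i; cases j) auto
  have "coprime (d j) m" using jk z by (intro coprime_entry[OF d, of j i k]) auto
  then show ?thesis using that jk by blast
qed

lemma equal_entries_shape:
  assumes d: "d \<in> difference_triples m" and z: "d i = d j" and ij: "i \<noteq> j"
  obtains k where "i \<noteq> j" "j \<noteq> k" "i \<noteq> k" "coprime (d i) m"
proof -
  obtain k where jk: "i \<noteq> j" "j \<noteq> k" "i \<noteq> k" using ij by (cases i; cases j) auto
  have "coprime (d i) m" using jk z by (intro coprime_entry[OF d, of i j k]) auto
  then show ?thesis using that jk by blast
qed

text \<open>An entry strictly between 0 and \<open>m\<close> whose double is divisible by
  \<open>m\<close> is \<open>m div 2\<close>. By primitivity another entry is odd. A common divisor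
  of that entry and \<open>m\<close> is odd, so it divides \<open>m div 2\<close> and thereby the
  whole triple, which makes the odd entry a unit.\<close>

lemma half_entry_shape:
  assumes d: "d \<in> difference_triples m" and z: "m dvd 2 * d i" and nz: "d i \<noteq> 0"
  obtains j k where "i \<noteq> j" "j \<noteq> k" "i \<noteq> k" "coprime (d j) m" "m = 2 * d i"
proof -
  have r: "0 < d i" "d i < m" using triple_range[OF d, of i] nz by auto
  obtain c where c: "2 * d i = m * c" using z by (auto elim: dvdE)
  have "m * 0 < m * c" "m * c < m * 2" using r c by linarith+
  then have "0 < c" "c < 2" using m_gt1 by (simp_all only: mult_less_cancel_left_pos)
  then have m: "m = 2 * d i" using c by simp
  obtain j where "i \<noteq> j" by (cases i) auto
  then obtain k where ijk: "i \<noteq> j" "j \<noteq> k" "i \<noteq> k" by (cases i; cases j) auto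
  have cop: "coprime (d x) m" if ox: "odd (d x)" and xi: "x \<noteq> i" for x
  proof -
    obtain y where y: "x \<noteq> i" "i \<noteq> y" "x \<noteq> y" using xi by (cases x; cases i) auto
    show ?thesis
    proof (rule coprime_entry[OF d y])
      fix g assume g: "g dvd m" "g dvd d x"
      then have "odd g" using ox dvd_trans by blast
      then have "coprime g 2" by (simp add: coprime_right_2_iff_odd)
      then show "g dvd d i" using g(1) unfolding m by (simp add: coprime_dvd_mult_right_iff)
    qed
  qed
  have "odd (d j) \<or> odd (d k)"
  proof (rule ccontr)
    assume "\<not> (odd (d j) \<or> odd (d k))"
    then have ev: "2 dvd d j" "2 dvd d k" by auto
    have m2: "2 dvd m" using m by simp
    have "2 dvd d i" using third_entry_dvd[OF m_gt1 d, of j k i 2] ijk m2 ev by auto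
    then have "\<forall>x. 2 dvd d x" using ev color_exhaust_distinct[OF ijk] by metis
    then have "(2::int) dvd 1" using d m2 unfolding difference_triples_def by blast
    then show False by simp
  qed
  then show ?thesis
  proof
    assume "odd (d j)" then show ?thesis using that[of j k] ijk cop m by auto
  next
    assume "odd (d k)" then show ?thesis using that[of k j] ijk cop m by auto
  qed
qed

text \<open>In each case the triple has a unit entry and a second entry tied to it or fixed: 0, an
  equal entry, or \<open>m div 2\<close>. Scaling one unit entry to the entry in the corresponding
  place also matches the second entries, and \<open>triple_relI\<close> applies.\<close>

lemma degenerate_related_iff:
  assumes d: "d \<in> difference_triples m" "\<not> nondegenerate m d"
    and d': "d' \<in> difference_triples m" "\<not> nondegenerate m d'"
  shows "(d, d') \<in> triple_rel m \<longleftrightarrow> degeneracy d = degeneracy d'"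
proof
  assume "(d, d') \<in> triple_rel m"
  then show "degeneracy d = degeneracy d'"
    unfolding degeneracy_def using symmetric_predicates[of d d'] by simp
next
  assume eq: "degeneracy d = degeneracy d'"
  from degeneracy_cases[of d] show "(d, d') \<in> triple_rel m"
  proof (elim disjE)
    assume 1: "degeneracy d = 0"
    obtain i i' where z: "d i = 0" "d' i' = 0" using 1 eq degeneracy_0D by metis
    obtain j k where jk: "i \<noteq> j" "j \<noteq> k" "i \<noteq> k" "coprime (d j) m" using zero_entry_shape[OF d(1) z(1)] by blast
    obtain j' k' where jk': "i' \<noteq> j'" "j' \<noteq> k'" "i' \<noteq> k'" using zero_entry_shape[OF d'(1) z(2)] by blast
    obtain u where "[d' j' = u * d j] (mod m)" using unit_multiple[OF jk(4)] by blast
    then show ?thesis using triple_relI[OF d(1) d'(1) jk(1-3) jk'] z by simp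
  next
    assume 2: "degeneracy d = 1"
    obtain i j i' j' where z: "i \<noteq> j" "d i = d j" "i' \<noteq> j'" "d' i' = d' j'"
      using 2 eq degeneracy_1D by metis
    obtain k where jk: "i \<noteq> j" "j \<noteq> k" "i \<noteq> k" "coprime (d i) m" using equal_entries_shape[OF d(1) z(2,1)] by blast
    obtain k' where jk': "i' \<noteq> j'" "j' \<noteq> k'" "i' \<noteq> k'" using equal_entries_shape[OF d'(1) z(4,3)] by blast
    obtain u where "[d' i' = u * d i] (mod m)" using unit_multiple[OF jk(4)] by blast
    then show ?thesis using triple_relI[OF d(1) d'(1) jk(1-3) jk'] z by simp
  next
    assume 3: "degeneracy d = 2"
    have half: "\<exists>i. m dvd 2 * e i \<and> e i \<noteq> 0"
      if "degeneracy e = 2" "e \<in> difference_triples m" "\<not> nondegenerate m e" for e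
    proof -
      have "e i \<noteq> 0" "i \<noteq> j \<Longrightarrow> e i \<noteq> e j" for i j
        using that(1) degeneracy_2D by blast+
      then show ?thesis using that(3) triple_cong_iff[OF that(2)] unfolding nondegenerate_def by blast
    qed
    obtain i where i: "m dvd 2 * d i" "d i \<noteq> 0" using half[OF _ d] 3 by blast
    obtain i' where i': "m dvd 2 * d' i'" "d' i' \<noteq> 0" using half[OF _ d'] 3 eq by auto
    obtain j k where jk: "i \<noteq> j" "j \<noteq> k" "i \<noteq> k" "coprime (d j) m" "m = 2 * d i"
      using half_entry_shape[OF d(1) i] by blast
    obtain j' k' where jk': "i' \<noteq> j'" "j' \<noteq> k'" "i' \<noteq> k'" "coprime (d' j') m" "m = 2 * d' i'"
      using half_entry_shape[OF d'(1) i'] by blast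
    obtain u where u: "[d' j' = u * d j] (mod m)" using unit_multiple[OF jk(4)] by blast
    have same: "d' i' = d i" using jk(5) jk'(5) by simp
    \<comment> \<open>Since \<open>m\<close> is even, an even \<open>u\<close> would make the unit
      entry \<open>d' j'\<close> even. Oddness is what makes \<open>u\<close> fix the residue
      \<open>m div 2\<close>.\<close>
    have "odd u"
    proof
      assume "even u"
      then have "even (u * d j)" by simp
      moreover have "2 dvd m" using jk(5) by simp
      then have "[d' j' = u * d j] (mod 2)" using u cong_dvd_modulus by blast
      ultimately have "even (d' j')" by (metis cong_dvd_iff)
      then show False using jk'(4) \<open>2 dvd m\<close> by (metis coprime_common_divisor odd_one)
    qed
    then obtain c where "u = 2 * c + 1" by (rule oddE)
    then have "d' i' - u * d i = m * (- c)" unfolding same using jk(5) by (simp add: algebra_simps)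
    then have "[d' i' = u * d i] (mod m)" by (simp add: cong_iff_dvd_diff)
    then show ?thesis using triple_relI[OF d(1) d'(1) jk(1-3) jk'(1-3)] u by blast
  qed
qed

text \<open>By \<open>degenerate_related_iff\<close> the classes correspond to the attained values
  of \<open>degeneracy\<close>. The value 2 requires an entry \<open>m div 2\<close>, which an odd
  \<open>m\<close> does not allow.\<close>

lemma card_degenerate_classes:
  assumes "m > 4"
  shows "card ({d \<in> difference_triples m. \<not> nondegenerate m d} // triple_rel m) = (if odd m then 2 else 3)"
proof -
  let ?D = "{d \<in> difference_triples m. \<not> nondegenerate m d}"
  have eqv: "equiv (difference_triples m) (triple_rel m)" using symmetry_orbits(1) m_gt1 by simp
  have "card (?D // triple_rel m) = card (degeneracy ` ?D)"
    unfolding quotient_image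
  proof (rule card_image_eq_of_kernel_eq)
    fix a b assume "a \<in> ?D" "b \<in> ?D"
    then show "triple_rel m `` {a} = triple_rel m `` {b} \<longleftrightarrow> degeneracy a = degeneracy b"
      using degenerate_related_iff eq_equiv_class_iff[OF eqv] by simp
  qed
  also have "degeneracy ` ?D = (if odd m then {0, 1} else {0, 1, 2})"
  proof -
    have mem: "case_color a b c \<in> difference_triples m"
      if "0 \<le> a" "a < m" "0 \<le> b" "b < m" "0 \<le> c" "c < m" "m dvd a + b + c" "b = 1" for a b c
    proof -
      have "g dvd 1" if "\<forall>i. g dvd case_color a b c i" for g
        using that[rule_format, of Green] \<open>b = 1\<close> by simp
      then show ?thesis using that unfolding difference_triples_def by (auto simp: sum_color all_color)
    qed
    have 0: "0 \<in> degeneracy ` ?D"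
    proof (rule image_eqI[of _ _ "case_color 0 1 (m - 1)"])
      show "case_color 0 1 (m - 1) \<in> ?D" using assms mem[of 0 1 "m - 1"]
        by (auto simp: nondegenerate_def all_color)
    qed (auto simp: degeneracy_def ex_color)
    have 1: "1 \<in> degeneracy ` ?D"
    proof (rule image_eqI[of _ _ "case_color 1 1 (m - 2)"])
      show "case_color 1 1 (m - 2) \<in> ?D" using assms mem[of 1 1 "m - 2"]
        by (auto simp: nondegenerate_def all_color)
    qed (use assms in \<open>auto simp: degeneracy_def ex_color\<close>)
    have 2: "2 \<in> degeneracy ` ?D" if "even m"
    proof -
      obtain h where h: "m = 2 * h" using \<open>even m\<close> by blast
      show ?thesis
      \<comment> \<open>For \<open>m = 4\<close> this triple would have two equal entries and belong
        to the preceding orbit; here \<open>h\<close> exceeds 2.\<close>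
      proof (rule image_eqI[of _ _ "case_color h 1 (h - 1)"])
        show "case_color h 1 (h - 1) \<in> ?D" using assms h mem[of h 1 "h - 1"]
          by (auto simp: nondegenerate_def all_color)
      qed (use assms h in \<open>auto simp: degeneracy_def ex_color\<close>)
    qed
    have odd2: "degeneracy d \<noteq> 2" if m: "odd m" and dD: "d \<in> ?D" for d
    proof
      assume deg: "degeneracy d = 2"
      have d: "d \<in> difference_triples m" using dD by blast
      have ne: "d i \<noteq> 0" "i \<noteq> j \<Longrightarrow> d i \<noteq> d j" for i j
        using deg degeneracy_2D by blast+
      then obtain i where "m dvd 2 * d i"
        using dD triple_cong_iff[OF d] unfolding nondegenerate_def by blast
      then have "m dvd d i" using m by (simp add: coprime_dvd_mult_right_iff)
      then show False using triple_dvd_iff[OF d] ne by blast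
    qed
    show ?thesis
    proof (intro equalityI subsetI)
      fix n assume "n \<in> degeneracy ` ?D"
      then obtain d where "d \<in> ?D" "n = degeneracy d" by blast
      then show "n \<in> (if odd m then {0, 1} else {0, 1, 2})" using degeneracy_cases[of d] odd2[of d] by auto
    next
      fix n assume "n \<in> (if odd m then {0, 1} else {0, 1, 2 :: nat})"
      then have "n = 0 \<or> n = 1 \<or> even m \<and> n = 2" by (auto split: if_splits)
      then show "n \<in> degeneracy ` ?D" using 0 1 2 by metis
    qed
  qed
  also have "card (if odd m then {0, 1} else {0, 1, 2 :: nat}) = (if odd m then 2 else 3)" by simp
  finally show ?thesis .
qed

lemma card_nondegenerate_classes:
  assumes "m > 4"
  shows "card ({d \<in> difference_triples m. nondegenerate m d} // triple_rel m) + (if odd m then 2 else 3)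
    = card (difference_triples m // triple_rel m)"
proof -
  let ?D = "{d \<in> difference_triples m. \<not> nondegenerate m d}"
  let ?N = "{d \<in> difference_triples m. nondegenerate m d}"
  have eqv: "equiv (difference_triples m) (triple_rel m)" using symmetry_orbits(1) m_gt1 by simp
  have fin: "finite (difference_triples m)" using finite_difference_triples m_gt1 by simp
  have "difference_triples m = ?N \<union> ?D" by blast
  then have "difference_triples m // triple_rel m = ?N // triple_rel m \<union> ?D // triple_rel m"
    unfolding quotient_image by blast
  moreover have "(?N // triple_rel m) \<inter> (?D // triple_rel m) = {}"
  proof (rule ccontr)
    assume "(?N // triple_rel m) \<inter> (?D // triple_rel m) \<noteq> {}"
    then obtain a b where "a \<in> ?N" "b \<in> ?D" "triple_rel m `` {a} = triple_rel m `` {b}"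
      unfolding quotient_image by blast
    then have "(a, b) \<in> triple_rel m" "nondegenerate m a" "\<not> nondegenerate m b"
      using eq_equiv_class_iff[OF eqv] by blast+
    then show False using symmetric_predicates(3) by blast
  qed
  moreover have "finite (?N // triple_rel m)" "finite (?D // triple_rel m)"
    unfolding quotient_image using fin by simp_all
  ultimately have "card (difference_triples m // triple_rel m) = card (?N // triple_rel m) + card (?D // triple_rel m)"
    by (simp add: card_Un_disjoint)
  then show ?thesis using card_degenerate_classes[OF assms] by simp
qed

end

section \<open>From difference triples to configurations\<close>

fun next_color :: "color \<Rightarrow> color" where
  "next_color Red = Green" | "next_color Green = Blue" | "next_color Blue = Red"

text \<open>The side opposite to color \<open>i\<close> of the triangle of offsets. The cyclic
  orientation makes the three sides add up to 0 as integers, and up to sign they are all differences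
  of the base line.\<close>

definition differences :: "(color \<Rightarrow> int) \<Rightarrow> color \<Rightarrow> int" where
  "differences s i = s (next_color i) - s (next_color (next_color i))"

text \<open>A right inverse of \<open>differences\<close> modulo \<open>m\<close>, normalised to 0
  at \<open>Red\<close>. It is exact at \<open>Red\<close> and \<open>Green\<close>; at
  \<open>Blue\<close> the zero sum of the triple is used.\<close>

definition offsets :: "(color \<Rightarrow> int) \<Rightarrow> color \<Rightarrow> int" where
  "offsets d = case_color 0 (d Red + d Green) (d Green)"

lemma next_color_neq: "next_color i \<noteq> next_color (next_color i)"
  by (cases i) auto

lemma next_color_eq_iff: "next_color i = next_color j \<longleftrightarrow> i = j"
  by (cases i; cases j) auto

lemma ordered_color_pair:
  assumes "x \<noteq> y"
  obtains i where "x = next_color i" "y = next_color (next_color i)"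
    | i where "y = next_color i" "x = next_color (next_color i)"
proof -
  have "\<exists>i. x = next_color i \<and> y = next_color (next_color i) \<or> y = next_color i \<and> x = next_color (next_color i)"
    using assms by (cases x; cases y) (auto simp: ex_color)
  then show ?thesis using that by blast
qed

lemma sum_differences: "(\<Sum>i\<in>UNIV. differences s i) = 0"
  by (simp add: sum_color differences_def)

lemma differences_offsets:
  assumes "d \<in> difference_triples m"
  shows "[differences (offsets d) i = d i] (mod m)"
proof -
  have "m dvd d Red + d Green + d Blue" using assms by (simp add: difference_triples_def sum_color)
  then have "m dvd - (d Red + d Green + d Blue)" by (subst dvd_minus_iff)
  moreover have "differences (offsets d) Blue - d Blue = - (d Red + d Green + d Blue)"
    by (simp add: differences_def offsets_def)
  ultimately show ?thesis
    by (cases i) (simp_all only: cong_iff_dvd_diff, simp_all add: differences_def offsets_def)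
qed

lemma nondegenerate_cong:
  assumes "\<And>i. [d i = d' i] (mod m)"
  shows "nondegenerate m d \<longleftrightarrow> nondegenerate m d'"
proof -
  have "m dvd 2 * d i \<longleftrightarrow> m dvd 2 * d' i" for i
    by (rule cong_dvd_iff) (intro cong_scalar_left assms)
  moreover have "[d i = d j] (mod m) \<longleftrightarrow> [d' i = d' j] (mod m)" for i j
    using assms cong_sym cong_trans by meson
  ultimately show ?thesis unfolding nondegenerate_def by simp
qed

text \<open>The six ordered differences are the entries of \<open>differences s\<close> with both
  signs. A coincidence with equal signs means two equal entries. With opposite signs it means an
  entry of order at most two: the same entry on both sides, or the third entry, which the zero sum
  forces to vanish.\<close>

lemma sidon_iff: "sidon m s \<longleftrightarrow> nondegenerate m (differences s)"
proof
  assume sid: "sidon m s"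
  have "\<not> m dvd 2 * differences s i" for i
  proof
    assume "m dvd 2 * differences s i"
    then have "[s (next_color i) - s (next_color (next_color i)) =
        s (next_color (next_color i)) - s (next_color i)] (mod m)"
      by (simp add: differences_def cong_iff_dvd_diff algebra_simps)
    then show False using sidonD[OF sid next_color_neq next_color_neq[symmetric]] next_color_neq by blast
  qed
  moreover have "\<not> [differences s i = differences s j] (mod m)" if "i \<noteq> j" for i j
    using sidonD[OF sid next_color_neq[of i] next_color_neq[of j]] that next_color_eq_iff
    unfolding differences_def by blast
  ultimately show "nondegenerate m (differences s)" unfolding nondegenerate_def by blast
next
  assume nd: "nondegenerate m (differences s)"
  have same: "i = j" if "[differences s i = differences s j] (mod m)" for i j
    using nd that unfolding nondegenerate_def by blast
  have opposite: False if "[differences s i = - differences s j] (mod m)" for i j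
  proof (cases "i = j")
    case True
    then have "m dvd 2 * differences s i" using that by (simp add: cong_iff_dvd_diff)
    then show False using nd unfolding nondegenerate_def by blast
  next
    case False
    then obtain k where k: "i \<noteq> j" "j \<noteq> k" "i \<noteq> k" by (cases i; cases j) auto
    have "differences s i + differences s j + differences s k = 0"
      using sum_differences[of s] sum_color_distinct[OF k, of "differences s"] by simp
    then have "2 * differences s k = (- 2) * (differences s i - (- differences s j))" by simp
    moreover have "m dvd differences s i - (- differences s j)" using that by (simp add: cong_iff_dvd_diff)
    ultimately have "m dvd 2 * differences s k" by (metis dvd_mult)
    then show False using nd unfolding nondegenerate_def by blast
  qed
  show "sidon m s" unfolding sidon_def
  proof (intro allI impI)
    fix x y x' y' assume ne: "x \<noteq> y" "x' \<noteq> y'" and e: "[s x - s y = s x' - s y'] (mod m)"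
    have e': "[s y - s x = s y' - s x'] (mod m)" using cong_minus_minus_iff[of "s x - s y" "s x' - s y'" m] e by simp
    show "x = x' \<and> y = y'"
      using ne(1)
    proof (cases rule: ordered_color_pair)
      case i: (1 i)
      show ?thesis using ne(2)
      proof (cases rule: ordered_color_pair)
        case j: (1 j)
        then have "i = j" using e i by (intro same) (simp add: differences_def)
        then show ?thesis using i j by simp
      next
        case j: (2 j)
        then have False using e i by (intro opposite[of i j]) (simp add: differences_def)
        then show ?thesis ..
      qed
    next
      case i: (2 i)
      show ?thesis using ne(2)
      proof (cases rule: ordered_color_pair)
        case j: (1 j)
        then have False using e' i by (intro opposite[of i j]) (simp add: differences_def)
        then show ?thesis ..
      next
        case j: (2 j)
        then have "i = j" using e' i by (intro same) (simp add: differences_def)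
        then show ?thesis using i j by simp
      qed
    qed
  qed
qed

lemma primitive_iff:
  assumes d: "\<And>i. [differences s i = d i] (mod m)"
  shows "primitive m s \<longleftrightarrow> (\<forall>g. g dvd m \<longrightarrow> (\<forall>i. g dvd d i) \<longrightarrow> g dvd 1)"
proof -
  have "(\<forall>i j. g dvd s i - s j) \<longleftrightarrow> (\<forall>i. g dvd d i)" if "g dvd m" for g
  proof -
    have "g dvd differences s i \<longleftrightarrow> g dvd d i" for i
      using cong_dvd_modulus[OF d that] by (rule cong_dvd_iff)
    moreover have "(\<forall>i j. g dvd s i - s j) \<longleftrightarrow> (\<forall>i. g dvd differences s i)"
    proof
      assume *: "\<forall>i. g dvd differences s i"
      show "\<forall>i j. g dvd s i - s j"
      proof (intro allI)
        fix x y
        show "g dvd s x - s y"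
        proof (cases "x = y")
          case False
          then show ?thesis
          proof (cases rule: ordered_color_pair)
            case (1 i)
            then show ?thesis using *[rule_format, of i] by (simp add: differences_def)
          next
            case (2 i)
            then show ?thesis using *[rule_format, of i] by (simp add: differences_def dvd_diff_commute)
          qed
        qed simp
      qed
    qed (simp add: differences_def)
    ultimately show ?thesis by simp
  qed
  then show ?thesis unfolding primitive_def by blast
qed

text \<open>Relabelling the colors by an odd permutation reverses the cyclic order, which negates the
  differences; the sign is absorbed into the multiplier.\<close>

lemma differences_permute:
  assumes "bij \<pi>"
  obtains \<epsilon> :: int where "\<epsilon> = 1 \<or> \<epsilon> = -1"
    "\<And>t i. differences t (\<pi> i) = \<epsilon> * (t (\<pi> (next_color i)) - t (\<pi> (next_color (next_color i))))"
proof -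
  have "\<pi> \<in> {\<pi>. bij \<pi>}" using assms by simp
  then have "(\<forall>t i. differences t (\<pi> i) = 1 * (t (\<pi> (next_color i)) - t (\<pi> (next_color (next_color i)))))
    \<or> (\<forall>t i. differences t (\<pi> i) = (-1) * (t (\<pi> (next_color i)) - t (\<pi> (next_color (next_color i)))))"
    unfolding bijective_colorings by (auto simp: differences_def all_color)
  then show ?thesis using that by blast
qed

lemma affinely_equivalent_iff:
  "affinely_equivalent m s t \<longleftrightarrow>
    (\<exists>u \<pi>. bij \<pi> \<and> (\<forall>i. [differences t (\<pi> i) = u * differences s i] (mod m)))"
proof
  assume "affinely_equivalent m s t"
  then obtain u \<pi> where \<pi>: "bij \<pi>" and u: "\<And>i j. [t (\<pi> i) - t (\<pi> j) = u * (s i - s j)] (mod m)"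
    unfolding affinely_equivalent_def by blast
  obtain \<epsilon> where \<epsilon>: "\<And>t i. differences t (\<pi> i) = \<epsilon> * (t (\<pi> (next_color i)) - t (\<pi> (next_color (next_color i))))"
    using differences_permute[OF \<pi>] by blast
  have "[differences t (\<pi> i) = (\<epsilon> * u) * differences s i] (mod m)" for i
    unfolding \<epsilon> differences_def[of s] mult.assoc by (intro cong_scalar_left u)
  then show "\<exists>u \<pi>. bij \<pi> \<and> (\<forall>i. [differences t (\<pi> i) = u * differences s i] (mod m))" using \<pi> by blast
next
  assume "\<exists>u \<pi>. bij \<pi> \<and> (\<forall>i. [differences t (\<pi> i) = u * differences s i] (mod m))"
  then obtain u \<pi> where \<pi>: "bij \<pi>" and u: "\<And>i. [differences t (\<pi> i) = u * differences s i] (mod m)" by blast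
  obtain \<epsilon> :: int where sq: "\<epsilon> = 1 \<or> \<epsilon> = -1"
    and \<epsilon>: "\<And>t i. differences t (\<pi> i) = \<epsilon> * (t (\<pi> (next_color i)) - t (\<pi> (next_color (next_color i))))"
    using differences_permute[OF \<pi>] by blast
  have next_case: "[t (\<pi> (next_color i)) - t (\<pi> (next_color (next_color i))) =
      (\<epsilon> * u) * (s (next_color i) - s (next_color (next_color i)))] (mod m)" for i
  proof -
    have "[\<epsilon> * differences t (\<pi> i) = \<epsilon> * (u * differences s i)] (mod m)" by (intro cong_scalar_left u)
    then show ?thesis using sq unfolding \<epsilon> differences_def[of s] by (auto simp: algebra_simps)
  qed
  have "[t (\<pi> x) - t (\<pi> y) = (\<epsilon> * u) * (s x - s y)] (mod m)" for x y
  proof (cases "x = y")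
    case False
    then show ?thesis
    proof (cases rule: ordered_color_pair)
      case (1 i)
      then show ?thesis using next_case[of i] by simp
    next
      case (2 i)
      have "[- (t (\<pi> y) - t (\<pi> x)) = - ((\<epsilon> * u) * (s y - s x))] (mod m)"
        unfolding cong_minus_minus_iff using next_case[of i] 2 by simp
      then show ?thesis by (simp add: algebra_simps)
    qed
  qed simp
  then show "affinely_equivalent m s t" unfolding affinely_equivalent_def using \<pi> by blast
qed

text \<open>\<open>affinely_equivalent\<close> relabels the colors of the target and
  \<open>triple_rel\<close> those of the source, so the permutation has to be inverted.\<close>

lemma affinely_equivalent_offsets_iff:
  assumes "m > 1" and d: "d \<in> difference_triples m" and d': "d' \<in> difference_triples m"
  shows "affinely_equivalent m (offsets d) (offsets d') \<longleftrightarrow> (d, d') \<in> triple_rel m"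
proof -
  have e: "[differences (offsets d') (\<pi> i) = u * differences (offsets d) i] (mod m)
      \<longleftrightarrow> [d' (\<pi> i) = u * d i] (mod m)" for u \<pi> i
    using differences_offsets[OF d', of "\<pi> i"] cong_scalar_left[OF differences_offsets[OF d, of i], of u]
    by (meson cong_sym cong_trans)
  have "(\<exists>\<pi>. bij \<pi> \<and> (\<forall>i. [d' (\<pi> i) = u * d i] (mod m))) \<longleftrightarrow>
      (\<exists>\<pi>. bij \<pi> \<and> (\<forall>i. [d' i = u * d (\<pi> i)] (mod m)))" for u
  proof
    assume "\<exists>\<pi>. bij \<pi> \<and> (\<forall>i. [d' (\<pi> i) = u * d i] (mod m))"
    then obtain \<pi> where \<pi>: "bij \<pi>" "\<And>i. [d' (\<pi> i) = u * d i] (mod m)" by blast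
    have "[d' i = u * d (inv_into UNIV \<pi> i)] (mod m)" for i
      using \<pi>(2)[of "inv_into UNIV \<pi> i"] \<pi>(1) by (simp add: bij_is_surj surj_f_inv_f)
    then show "\<exists>\<pi>. bij \<pi> \<and> (\<forall>i. [d' i = u * d (\<pi> i)] (mod m))" using bij_imp_bij_inv[OF \<pi>(1)] by blast
  next
    assume "\<exists>\<pi>. bij \<pi> \<and> (\<forall>i. [d' i = u * d (\<pi> i)] (mod m))"
    then obtain \<pi> where \<pi>: "bij \<pi>" "\<And>i. [d' i = u * d (\<pi> i)] (mod m)" by blast
    have "[d' (inv_into UNIV \<pi> i) = u * d i] (mod m)" for i
      using \<pi>(2)[of "inv_into UNIV \<pi> i"] \<pi>(1) by (simp add: bij_is_surj surj_f_inv_f)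
    then show "\<exists>\<pi>. bij \<pi> \<and> (\<forall>i. [d' (\<pi> i) = u * d i] (mod m))" using bij_imp_bij_inv[OF \<pi>(1)] by blast
  qed
  then show ?thesis unfolding affinely_equivalent_iff e triple_rel_iff[OF assms] by blast
qed

lemma coordinatized_offsets:
  assumes "d \<in> difference_triples m" "nondegenerate m d" "coordinates m (offsets d) \<phi> C"
  shows "coordinatized m (offsets d) \<phi> C"
proof
  show "sidon m (offsets d)"
    unfolding sidon_iff using nondegenerate_cong[of "differences (offsets d)" d m, OF differences_offsets[OF assms(1)]] assms(2) by blast
  show "primitive m (offsets d)"
    using primitive_iff[of "offsets d" d m, OF differences_offsets[OF assms(1)]] assms(1) unfolding difference_triples_def by blast
qed (fact assms(3))

text \<open>\<open>s\<close> and \<open>offsets d\<close> have the same differences modulo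
  \<open>m\<close>, so they are affinely equivalent with multiplier 1 and the identity permutation,
  and coordinates can be changed from one to the other.\<close>

lemma coordinatized_imp_offsets:
  assumes "m > 1" and C: "coordinatized m s \<phi> C"
  obtains d \<psi> where "d \<in> difference_triples m" "nondegenerate m d" "coordinates m (offsets d) \<psi> C"
proof -
  interpret coordinatized m s \<phi> C by fact
  define d where "d i = differences s i mod m" for i
  have c: "[differences s i = d i] (mod m)" for i by (simp add: d_def)
  have "[d Red + d Green + d Blue = differences s Red + differences s Green + differences s Blue] (mod m)"
    by (intro cong_add cong_sym[OF c])
  then have "m dvd (\<Sum>i\<in>UNIV. d i)"
    using sum_differences[of s] by (simp add: sum_color cong_0_iff)
  then have d: "d \<in> difference_triples m"
    using primitive_iff[of s d m, OF c] prim assms(1) unfolding difference_triples_def by (simp add: d_def)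
  moreover have "nondegenerate m d" using nondegenerate_cong[of "differences s" d m, OF c] sid sidon_iff by blast
  moreover have "affinely_equivalent m s (offsets d)"
    unfolding affinely_equivalent_iff
  proof (intro exI[of _ 1] exI[of _ id] conjI allI)
    show "[differences (offsets d) (id i) = 1 * differences s i] (mod m)" for i
      using differences_offsets[OF d, of i] c[of i] by (metis cong_sym cong_trans id_apply mult_1)
  qed simp
  moreover have "primitive m (offsets d)"
    using primitive_iff[of "offsets d" d m, OF differences_offsets[OF d]] d unfolding difference_triples_def by blast
  ultimately show ?thesis using that coordinates_affine_change[OF coords] by blast
qed

text \<open>A choice of a triple \<open>c C\<close> for each configuration turns isomorphism into
  \<open>triple_rel\<close>: related triples give a change of coordinates, and conversely
  coordinates are unique up to affine maps. Every nondegenerate triple is realized, so the quotients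
  have equal size.\<close>

theorem num_connected_cyclic_eq:
  assumes "v > 4"
  shows "num_connected_cyclic v 3 =
    card ({d \<in> difference_triples (int v). nondegenerate (int v) d} // triple_rel (int v))"
proof -
  let ?m = "int v"
  let ?S = "connected_cyclic_configurations v 3"
  let ?N = "{d \<in> difference_triples ?m. nondegenerate ?m d}"
  have m: "?m > 1" "?m > 0" "\<not> ?m dvd 3" using assms by (auto dest: zdvd_imp_le)
  have "\<exists>d\<in>?N. \<exists>\<phi>. coordinates ?m (offsets d) \<phi> C" if C: "C \<in> ?S" for C
  proof -
    obtain s \<phi> where "coordinatized ?m s \<phi> C"
      using connected_cyclic_coordinatized[of v C] C assms
      unfolding connected_cyclic_configurations_def balanced_configuration_def by auto
    from coordinatized_imp_offsets[OF m(1) this] show ?thesis by blast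
  qed
  then obtain c where c: "\<And>C. C \<in> ?S \<Longrightarrow> c C \<in> ?N"
    "\<And>C. C \<in> ?S \<Longrightarrow> \<exists>\<phi>. coordinates ?m (offsets (c C)) \<phi> C" by metis
  \<comment> \<open>Arbitrary coordinates are allowed on both sides, so this applies both to the
    chosen triples \<open>c C\<close> and to a prescribed triple in the surjectivity
    argument.\<close>
  have rel: "(d, d') \<in> triple_rel ?m \<longleftrightarrow> (\<exists>f. isomorphism f C D)"
    if d: "d \<in> ?N" "coordinates ?m (offsets d) \<phi> C" and d': "d' \<in> ?N" "coordinates ?m (offsets d') \<psi> D"
    for d d' \<phi> \<psi> and C D :: "nat incidence"
  proof
    assume "(d, d') \<in> triple_rel ?m"
    then have "affinely_equivalent ?m (offsets d) (offsets d')"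
      using affinely_equivalent_offsets_iff[OF m(1)] d d' by blast
    moreover have "primitive ?m (offsets d')"
      using coordinatized_offsets d' coordinatized.prim by blast
    ultimately obtain \<psi>' where "coordinates ?m (offsets d') \<psi>' C"
      using coordinates_affine_change[OF d(2)] by blast
    then show "\<exists>f. isomorphism f C D" using coordinates_isomorphic d'(2) by blast
  next
    assume "\<exists>f. isomorphism f C D"
    then obtain f where "isomorphism f C D" by blast
    then have "coordinates ?m (offsets d) (f \<circ> \<phi>) D" using coordinates_transfer[OF d(2)] by blast
    then have "affinely_equivalent ?m (offsets d) (offsets d')"
      using coordinates_affinely_equivalent[of ?m "offsets d" "f \<circ> \<phi>" D "offsets d'" \<psi>]
        coordinatized_offsets d(1) d' m(3) by blast
    then show "(d, d') \<in> triple_rel ?m" using affinely_equivalent_offsets_iff[OF m(1)] d d' by blast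
  qed
  have surj: "\<exists>C\<in>?S. \<exists>\<phi>. coordinates ?m (offsets d) \<phi> C" if d: "d \<in> ?N" for d
  proof -
    obtain C :: "nat incidence" and \<phi> where coords: "coordinates ?m (offsets d) \<phi> C"
      using coordinates_exist[of v] assms by (metis gr_implies_not0 neq0_conv)
    then interpret coordinatized ?m "offsets d" \<phi> C using coordinatized_offsets d by blast
    have "C \<in> ?S"
      using configuration[OF m(2)] connected cyclic[OF m(2)] unfolding connected_cyclic_configurations_def by simp
    then show ?thesis using coords by blast
  qed
  have eqN: "equiv (difference_triples ?m) (triple_rel ?m)" using symmetry_orbits(1) m(2) by simp
  let ?g = "\<lambda>d. triple_rel ?m `` {d}"
  have "card (?S // isomorphic_on ?S) = card ((\<lambda>C. ?g (c C)) ` ?S)"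
    unfolding quotient_image
  proof (rule card_image_eq_of_kernel_eq)
    fix C D assume CD: "C \<in> ?S" "D \<in> ?S"
    have "isomorphic_on ?S `` {C} = isomorphic_on ?S `` {D} \<longleftrightarrow> (C, D) \<in> isomorphic_on ?S"
      using eq_equiv_class_iff[OF equiv_isomorphic_on CD] .
    also have "\<dots> \<longleftrightarrow> (\<exists>f. isomorphism f C D)" using CD by (simp add: isomorphic_on_def)
    also have "\<dots> \<longleftrightarrow> (c C, c D) \<in> triple_rel ?m"
    proof -
      obtain \<phi> \<psi> where "coordinates ?m (offsets (c C)) \<phi> C" "coordinates ?m (offsets (c D)) \<psi> D"
        using c(2) CD by blast
      from rel[OF c(1)[OF CD(1)] this(1) c(1)[OF CD(2)] this(2)] show ?thesis by (rule sym)
    qed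
    also have "\<dots> \<longleftrightarrow> ?g (c C) = ?g (c D)" using eq_equiv_class_iff[OF eqN] c(1) CD by auto
    finally show "isomorphic_on ?S `` {C} = isomorphic_on ?S `` {D} \<longleftrightarrow> ?g (c C) = ?g (c D)" .
  qed
  also have "(\<lambda>C. ?g (c C)) ` ?S = ?g ` ?N"
  proof (intro equalityI subsetI)
    fix z assume "z \<in> ?g ` ?N"
    then obtain d where d: "d \<in> ?N" "z = ?g d" by blast
    then obtain C \<phi> where C: "C \<in> ?S" "coordinates ?m (offsets d) \<phi> C" using surj by blast
    obtain \<psi> where "coordinates ?m (offsets (c C)) \<psi> C" using c(2) C(1) by blast
    from rel[OF d(1) C(2) c(1)[OF C(1)] this] have "(d, c C) \<in> triple_rel ?m" using isomorphism_refl by blast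
    then have "z = ?g (c C)" using d(2) equiv_class_eq[OF eqN] by blast
    then show "z \<in> (\<lambda>C. ?g (c C)) ` ?S" using C(1) by blast
  qed (use c(1) in blast)
  finally show ?thesis unfolding num_connected_cyclic_def quotient_image .
qed

theorem theoremA:
  fixes v :: nat
  assumes "v > 4"
  shows "real (num_connected_cyclic v 3) =
    (if odd v
     then real v / 6 * (\<Prod>p\<in>prime_factors v. 1 + 1 / real p)
            + alpha v * 2 ^ card (prime_factors v) - 2
     else real v / 6 * (\<Prod>p\<in>prime_factors v. 1 + 1 / real p)
            + beta v * 2 ^ card (prime_factors v) - 3)"
proof -
  have v1: "v > 1" using assms by simp
  have "real (num_connected_cyclic v 3) + (if odd v then 2 else 3) =
      real (card (difference_triples (int v) // triple_rel (int v)))"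
    using arg_cong[OF card_nondegenerate_classes[of "int v"], of real] assms
    by (simp add: num_connected_cyclic_eq split: if_splits)
  \<comment> \<open>For odd \<open>v\<close> the two root counts contribute 1/2 and
    \<open>alpha v - 1 / 2\<close>, which add up to \<open>alpha v\<close>; for even
    \<open>v\<close> only \<open>beta v\<close> remains.\<close>
  also have "\<dots> = real v / 6 * (\<Prod>p\<in>prime_factors v. 1 + 1 / real p)
      + (if odd v then 1 / 2 else beta v) * 2 ^ card (prime_factors v)
      + (if odd v then alpha v - 1 / 2 else 0) * 2 ^ card (prime_factors v)"
    unfolding real_card_triple_classes[OF v1] card_square_minus_one_roots[OF v1]
      card_cyclotomic3_roots[OF v1] ..
  finally show ?thesis by (simp add: algebra_simps split: if_splits)
qed

end
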